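(* Let $\{F_{a,b}\}$ be a family of lifts in Class $\mathcal{N}$. If $\frac{p}{q}$ is higher than $\frac{p'}{q'}$ in the Farey tree, then the reduced height of $Lock_{\frac{p}{q}}$ is greater than the reduced height of $Lock_{\frac{p'}{q'}}$.
   Context: A degree-one lift is a continuous $F:\mathbb{R}\to\mathbb{R}$ with $F(x+1)=F(x)+1$ for all $x$. Its rotation set $Rot(F)$ is the set of all values $\lim_{m\to\infty}\frac{F^m(x)-x}{m}$ over those $x\in\mathbb{R}$ for which the limit exists; it is a single point or a nondegenerate closed interval. Its lower and upper monotone bounds are $F_l(x)=\inf\{F(y)\mid y\ge x\}$ and $F_u(x)=\sup\{F(y)\mid y\le x\}$. Class $\mathcal{B}$: lifts $F$ of degree-one circle maps that are $C^3$, piecewise strictly monotone, have at most two critical points (per fundamental domain $[0,1)$), both turning points when there are two, and have negative Schwarzian derivative $S(F)=\frac{F'''}{F'}-\frac32\left(\frac{F''}{F'}\right)^2$ (where defined) when they have two critical points. Class $\mathcal{N}$: two-parameter families of lifts $\{F_{a,b}\}$ (with $a\in\mathbb{R}$ and $b$ real) such that (i) each $F_{a,b}$ is in Class $\mathcal{B}$; (ii) $F_{a,b}$ and $\frac{d}{dx}F_{a,b}$ depend continuously on $(a,b)$; (iii) $a$ is a translation parameter: $F_{a,b}=F_{0,b}+a$; (iv) the Hausdorff distance $\Delta$ between (the graphs of) the upper and lower monotone bounds of $F_{a,b}$ is a nondecreasing function of $b$ such that the value $0$ can be attained and the value $1$ can be exceeded. The critical line is the horizontal line $b=\max\{b\mid\Delta=0\}$.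 On it $F_{a,b}$ has a unique critical point in $[0,1)$, and above it $F_{a,b}$ has two. When $F_{a,b}$ has two turning points per fundamental domain, with maximum at $C$ and minimum at $K$, the origin is chosen so that $0\le C<K<1$; with $K^-$ the closest point below $K$ with the same image as $K$ and $C^+$ the closest point above $C$ with the same image as $C$, one assumes $0<K^-\le C\le K\le C^+<1$ when $0\le\Delta<1$ (all four points being equal to the unique critical point on the critical line). $Lock_\omega$ is the set of $(a,b)$ with $Rot(F_{a,b})=\{\omega\}$. $Lock^I_\omega$ is the connected component of $Lock_\omega$ that contains all parameters in $Lock_\omega$ of invertible maps. The reduced height of $Lock_\omega$ is the largest value of $b$ such that some $(a,b)$ belongs to $Lock^I_\omega$. Farey tree: all fractions are in lowest terms and in $[0,1]$. Fractions $\frac{p_1}{q_1},\frac{p_2}{q_2}$ are Farey neighbors if $p_1q_2-p_2q_1=\pm1$; their Farey sum is then $\frac{p_1}{q_1}\oplus\frac{p_2}{q_2}=\frac{p_1+p_2}{q_1+q_2}$. Every rational in $(0,1)$ is uniquely a Farey sum $\frac{p}{q}=\frac{p_1}{q_1}\oplus\frac{p_2}{q_2}$ with $\frac{p_1}{q_1}<\frac{p_2}{q_2}$ (left and right parents). For such $\frac pq$ set $l_j=\frac{jp+p_1}{jq+q_1}$, $r_j=\frac{jp+p_2}{jq+q_2}$; for $\frac01$ only $r_j$ is defined, with $\frac{p_2}{q_2}=\frac11$; for $\frac11$ only $l_j$ is defined, with $\frac{p_1}{q_1}=\frac01$. The first children of $\frac pq$ are $l_1$ and $r_1$ (those that are defined).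 The Farey tree has vertex set $\mathbb{Q}\cap[0,1]$ with one edge between every fraction and each of its first children. Vertices $\frac01,\frac11$ are at level $0$, and the vertices at level $n>0$ are the first children of the vertices at level $n-1$ (so $\frac12$ is at level 1, $\frac13,\frac23$ at level 2, etc.). If two fractions, at levels $m$ and $n$, are joined by a path in the tree that is monotone with respect to levels and $m<n$, the one at level $m$ is said to be higher than the one at level $n$.
   Formalization: The normalisation 0<K⁻≤C≤K≤C⁺<1 is assumed when F(C)−F(K)<1 rather than when Δ<1: with Δ the Hausdorff distance of the graphs, Δ<1 still holds where F(C)−F(K)=1, but there C⁺=K⁻+1, so literally Class N would be empty. *)

theory Defs
  imports "HOL-Analysis.Analysis"
begin

section \<open>Degree-one lifts, rotation sets and monotone bounds\<close>

definition degree_one_lift :: "(real \<Rightarrow> real) \<Rightarrow> bool" where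
  "degree_one_lift F \<longleftrightarrow> continuous_on UNIV F \<and> (\<forall>x. F (x + 1) = F x + 1)"

definition Rot :: "(real \<Rightarrow> real) \<Rightarrow> real set" where
  "Rot F = {\<rho>. \<exists>x. (\<lambda>m. ((F ^^ m) x - x) / real m) \<longlonglongrightarrow> \<rho>}"

text \<open>For a degree-one lift both sets below are nonempty and bounded on the relevant side.\<close>

definition lower_bound :: "(real \<Rightarrow> real) \<Rightarrow> real \<Rightarrow> real" where
  "lower_bound F x = (INF y\<in>{x..}. F y)"

definition upper_bound :: "(real \<Rightarrow> real) \<Rightarrow> real \<Rightarrow> real" where
  "upper_bound F x = (SUP y\<in>{..x}. F y)"

definition graph_of :: "(real \<Rightarrow> real) \<Rightarrow> (real \<times> real) set" where
  "graph_of f = {(x, f x) | x. True}"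

text \<open>The suprema are over bounded sets of reals for the graphs it is used on: the two monotone
  bounds of a degree-one lift stay at bounded vertical distance from each other.\<close>

definition hausdorff_distance :: "'a::metric_space set \<Rightarrow> 'a set \<Rightarrow> real" where
  "hausdorff_distance A B = max (SUP x\<in>A. infdist x B) (SUP y\<in>B. infdist y A)"

definition Delta :: "(real \<Rightarrow> real) \<Rightarrow> real" where
  "Delta F = hausdorff_distance (graph_of (lower_bound F)) (graph_of (upper_bound F))"


section \<open>Class B\<close>

definition C3 :: "(real \<Rightarrow> real) \<Rightarrow> bool" where
  "C3 F \<longleftrightarrow> (\<forall>k<3. (deriv ^^ k) F differentiable_on UNIV) \<and> continuous_on UNIV ((deriv ^^ 3) F)"

definition piecewise_strictly_monotone :: "(real \<Rightarrow> real) \<Rightarrow> bool" where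
  "piecewise_strictly_monotone F \<longleftrightarrow>
     (\<forall>a b. \<exists>S. finite S \<and>
        (\<forall>c d. c < d \<and> {c<..<d} \<subseteq> {a..b} - S \<longrightarrow>
           strict_mono_on {c..d} F \<or> strict_antimono_on {c..d} F))"

definition turning_max :: "(real \<Rightarrow> real) \<Rightarrow> real \<Rightarrow> bool" where
  "turning_max F c \<longleftrightarrow> (\<exists>e>0. strict_mono_on {c - e..c} F \<and> strict_antimono_on {c..c + e} F)"

definition turning_min :: "(real \<Rightarrow> real) \<Rightarrow> real \<Rightarrow> bool" where
  "turning_min F c \<longleftrightarrow> (\<exists>e>0. strict_antimono_on {c - e..c} F \<and> strict_mono_on {c..c + e} F)"

definition turning_point :: "(real \<Rightarrow> real) \<Rightarrow> real \<Rightarrow> bool" where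
  "turning_point F c \<longleftrightarrow> turning_max F c \<or> turning_min F c"

definition critical_points :: "(real \<Rightarrow> real) \<Rightarrow> real set" where
  "critical_points F = {c \<in> {0..<1}. deriv F c = 0}"

definition Schwarzian :: "(real \<Rightarrow> real) \<Rightarrow> real \<Rightarrow> real" where
  "Schwarzian F x =
     (deriv ^^ 3) F x / deriv F x - 3 / 2 * ((deriv ^^ 2) F x / deriv F x)\<^sup>2"

definition class_B :: "(real \<Rightarrow> real) \<Rightarrow> bool" where
  "class_B F \<longleftrightarrow>
     degree_one_lift F \<and> C3 F \<and> piecewise_strictly_monotone F \<and>
     finite (critical_points F) \<and> card (critical_points F) \<le> 2 \<and>
     (card (critical_points F) = 2 \<longrightarrow>
        (\<forall>c\<in>critical_points F. turning_point F c) \<and>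
        (\<forall>x. deriv F x \<noteq> 0 \<longrightarrow> Schwarzian F x < 0))"


section \<open>Class N\<close>

definition K_minus :: "(real \<Rightarrow> real) \<Rightarrow> real \<Rightarrow> real" where
  "K_minus F K = (GREATEST y. y < K \<and> F y = F K)"

definition C_plus :: "(real \<Rightarrow> real) \<Rightarrow> real \<Rightarrow> real" where
  "C_plus F C = (LEAST y. C < y \<and> F y = F C)"

text \<open>Normalised position of the origin for a map with two turning points.  The guard is the
  vertical gap \<^term>\<open>F C - F K\<close>, which is the uniform distance between the two monotone bounds and
  dominates \<^term>\<open>Delta F\<close>.  The inequalities can only hold while this gap is below 1: when it
  equals 1 one has \<^term>\<open>C_plus F C = K_minus F K + 1\<close>, although \<^term>\<open>Delta F\<close> is still
  smaller than 1 there, because the Euclidean distance of graphs also uses horizontal displacements.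
  Guarding by \<^term>\<open>Delta F < 1\<close> would therefore be unsatisfiable along a continuous family.\<close>

definition normalised_two_turning_points :: "(real \<Rightarrow> real) \<Rightarrow> bool" where
  "normalised_two_turning_points F \<longleftrightarrow>
     (\<exists>C K. critical_points F = {C, K} \<and> turning_max F C \<and> turning_min F K \<and>
        0 \<le> C \<and> C < K \<and> K < 1 \<and>
        (F C - F K < 1 \<longrightarrow>
           0 < K_minus F K \<and> K_minus F K \<le> C \<and> C \<le> K \<and> K \<le> C_plus F C \<and> C_plus F C < 1))"

text \<open>\<^term>\<open>F a b\<close> is the lift with parameters \<^term>\<open>a\<close> and \<^term>\<open>b\<close>.  \<^const>\<open>Delta\<close> is invariant
  under adding a constant to the map, so it is enough to look at \<^term>\<open>F 0 b\<close>.\<close>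

definition critical_height :: "(real \<Rightarrow> real \<Rightarrow> real \<Rightarrow> real) \<Rightarrow> real" where
  "critical_height F = (GREATEST b. Delta (F 0 b) = 0)"

text \<open>On the critical line the four points \<open>K\<^sup>-\<close>, \<open>C\<close>, \<open>K\<close>, \<open>C\<^sup>+\<close> all denote the
  unique critical point.\<close>

definition normalised_origin :: "(real \<Rightarrow> real \<Rightarrow> real \<Rightarrow> real) \<Rightarrow> bool" where
  "normalised_origin F \<longleftrightarrow>
     (\<forall>a. \<exists>c. critical_points (F a (critical_height F)) = {c} \<and> 0 < c \<and> c < 1) \<and>
     (\<forall>a b. critical_height F < b \<longrightarrow> normalised_two_turning_points (F a b))"

definition class_N :: "(real \<Rightarrow> real \<Rightarrow> real \<Rightarrow> real) \<Rightarrow> bool" where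
  "class_N F \<longleftrightarrow>
     (\<forall>a b. class_B (F a b)) \<and>
     (\<forall>a b. uniform_limit UNIV (\<lambda>(a', b'). F a' b') (F a b) (at (a, b))) \<and>
     (\<forall>a b. uniform_limit UNIV (\<lambda>(a', b'). deriv (F a' b')) (deriv (F a b)) (at (a, b))) \<and>
     (\<forall>a b x. F a b x = F 0 b x + a) \<and>
     mono (\<lambda>b. Delta (F 0 b)) \<and>
     (\<exists>b. Delta (F 0 b) = 0) \<and>
     (\<exists>b. Delta (F 0 b) > 1) \<and>
     normalised_origin F"


section \<open>Locking regions\<close>

definition Lock :: "(real \<Rightarrow> real \<Rightarrow> real \<Rightarrow> real) \<Rightarrow> real \<Rightarrow> (real \<times> real) set" where
  "Lock F \<omega> = {(a, b). Rot (F a b) = {\<omega>}}"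

definition Lock_I :: "(real \<Rightarrow> real \<Rightarrow> real \<Rightarrow> real) \<Rightarrow> real \<Rightarrow> (real \<times> real) set" where
  "Lock_I F \<omega> =
     (THE T. T \<in> components (Lock F \<omega>) \<and> {(a, b) \<in> Lock F \<omega>. bij (F a b)} \<subseteq> T)"

definition reduced_height :: "(real \<Rightarrow> real \<Rightarrow> real \<Rightarrow> real) \<Rightarrow> real \<Rightarrow> real" where
  "reduced_height F \<omega> = (GREATEST b. \<exists>a. (a, b) \<in> Lock_I F \<omega>)"


section \<open>The Farey tree\<close>

definition farey_neighbors :: "rat \<Rightarrow> rat \<Rightarrow> bool" where
  "farey_neighbors r s \<longleftrightarrow>
     (let (p1, q1) = quotient_of r; (p2, q2) = quotient_of s in \<bar>p1 * q2 - p2 * q1\<bar> = 1)"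

definition farey_sum :: "rat \<Rightarrow> rat \<Rightarrow> rat" where
  "farey_sum r s =
     (let (p1, q1) = quotient_of r; (p2, q2) = quotient_of s in Fract (p1 + p2) (q1 + q2))"

definition farey_parents :: "rat \<Rightarrow> rat \<Rightarrow> rat \<Rightarrow> bool" where
  "farey_parents x r s \<longleftrightarrow>
     r \<in> {0..1} \<and> s \<in> {0..1} \<and> r < s \<and> farey_neighbors r s \<and> x = farey_sum r s"

text \<open>The conventions for the two roots: \<open>0/1\<close> only has the right parent \<open>1/1\<close>, and \<open>1/1\<close> only has
  the left parent \<open>0/1\<close>.\<close>

definition left_parent :: "rat \<Rightarrow> rat \<Rightarrow> bool" where
  "left_parent x r \<longleftrightarrow> (\<exists>s. farey_parents x r s) \<or> (x = 1 \<and> r = 0)"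

definition right_parent :: "rat \<Rightarrow> rat \<Rightarrow> bool" where
  "right_parent x s \<longleftrightarrow> (\<exists>r. farey_parents x r s) \<or> (x = 0 \<and> s = 1)"

text \<open>\<open>l\<^sub>1 = (p + p\<^sub>1) / (q + q\<^sub>1)\<close> and \<open>r\<^sub>1 = (p + p\<^sub>2) / (q + q\<^sub>2)\<close> are the Farey sums of \<open>p / q\<close> with
  its left and right parent.\<close>

definition first_children :: "rat \<Rightarrow> rat set" where
  "first_children x =
     {farey_sum x r | r. left_parent x r} \<union> {farey_sum x s | s. right_parent x s}"

definition farey_edge :: "rat \<Rightarrow> rat \<Rightarrow> bool" where
  "farey_edge x y \<longleftrightarrow>
     x \<in> {0..1} \<and> y \<in> {0..1} \<and> (y \<in> first_children x \<or> x \<in> first_children y)"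

primrec farey_level_set :: "nat \<Rightarrow> rat set" where
  "farey_level_set 0 = {0, 1}"
| "farey_level_set (Suc n) = (\<Union>x\<in>farey_level_set n. first_children x)"

definition farey_level :: "rat \<Rightarrow> nat" where
  "farey_level x = (THE n. x \<in> farey_level_set n)"

text \<open>A level-monotone path from the lower level to the larger one is necessarily level-increasing,
  hence \<^const>\<open>sorted\<close>.\<close>

definition farey_higher :: "rat \<Rightarrow> rat \<Rightarrow> bool" where
  "farey_higher x y \<longleftrightarrow>
     farey_level x < farey_level y \<and>
     (\<exists>vs. vs \<noteq> [] \<and> hd vs = x \<and> last vs = y \<and> successively farey_edge vs \<and>
        sorted (map farey_level vs))"

end

theory Submission
  imports Defs
begin

text \<open>For a lift \<open>f\<close> write \<open>G\<close> and \<open>H\<close> for its upper and lower monotone bounds.  The map \<open>f + a\<close> has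
  rotation set \<open>{p / q}\<close> iff some \<open>x\<close> has \<open>(G + a)^q x \<le> x + p\<close> and some \<open>y\<close> has
  \<open>(H + a)^q y \<ge> y + p\<close>, so at height \<open>b\<close> the locking region is an interval \<open>[L b, U b]\<close>
  (possibly empty) with continuous ends, and its reduced height is the first \<open>b\<close> above the critical
  line at which \<open>L b = U b\<close>.
  It remains to see that the children of \<open>p / q\<close> are not locked at that height.

  There \<open>G^q \<ge> id + p\<close> and \<open>H^q \<le> id + p\<close>, both with equality somewhere.  Negative Schwarzian
  derivative makes monotone branches of iterates expand cross-ratios; such a branch \<open>\<phi>\<close> cannot satisfy
  \<open>\<phi> a < a + p\<close>, \<open>\<phi> b \<ge> b + p\<close>, \<open>\<phi> c \<le> c + p\<close>, \<open>\<phi> d > d + p\<close> for \<open>a < b < c < d\<close>.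
  Applied to suitable branches of \<open>f^q\<close> this forces \<open>H^q1 K \<le> C\<^sup>+ + p1\<close>, where \<open>p1 / q1\<close> is the left
  parent.  If the left child were locked at the same \<open>b\<close>, then at a smaller \<open>a\<close>, so there
  \<open>H^q1 K < C\<^sup>+ + p1\<close>, which the same pattern excludes for the child.  The right child follows by
  the reflection \<open>x \<mapsto> 1 - f (- x)\<close>.\<close>

section \<open>Expansion of cross-ratios\<close>

text \<open>The bounds \<open>G\<close> and \<open>H\<close> are flat on intervals, so their
  iterates have no useful Schwarzian derivative, while \<open>f\<close> itself is not monotone. The
  argument therefore follows the ends of a branch of \<open>f^q\<close> with orbits of
  \<open>G\<close> and \<open>H\<close>: where these avoid the flat pieces, \<open>f\<close> agrees
  with the bound, and elsewhere one of the inequalities between \<open>H\<close>, \<open>f\<close>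
  and \<open>G\<close> suffices. The ends of a branch may meet turning points, where the derivative
  vanishes. For this reason the differential condition is traded for growth of the cross-ratio
  \<open>(c - a)(d - b) / ((b - a)(d - c))\<close>, stated without division, which survives
  composition and makes sense up to the end points. A second obstacle is that a locking interval
  might stay nonempty for all large \<open>b\<close>, so that no reduced height would exist.
  Emptiness of the child's interval at the parent's height settles this together with the
  inequality: it shows that the child has a height and that this height is smaller. Existence thus
  travels down the tree from the roots, where it comes from \<open>Delta > 1\<close>.\<close>

definition cr_expanding :: "real set \<Rightarrow> (real \<Rightarrow> real) \<Rightarrow> bool" where
  "cr_expanding S f \<longleftrightarrow> strict_mono_on S f \<and>
     (\<forall>a\<in>S. \<forall>b\<in>S. \<forall>c\<in>S. \<forall>d\<in>S. a < b \<longrightarrow> b < c \<longrightarrow> c < d \<longrightarrow>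
        (c - a) * (d - b) * ((f b - f a) * (f d - f c)) \<le> (f c - f a) * (f d - f b) * ((b - a) * (d - c)))"

lemma cr_expanding_mono: "cr_expanding S f \<Longrightarrow> strict_mono_on S f"
  by (simp add: cr_expanding_def)

lemma cr_expandingD:
  assumes "cr_expanding S f" "a \<in> S" "b \<in> S" "c \<in> S" "d \<in> S" "a < b" "b < c" "c < d"
  shows "(c - a) * (d - b) * ((f b - f a) * (f d - f c)) \<le> (f c - f a) * (f d - f b) * ((b - a) * (d - c))"
  using assms unfolding cr_expanding_def by blast

lemma cr_expanding_id: "cr_expanding S (\<lambda>x. x)"
  unfolding cr_expanding_def strict_mono_on_def by (auto simp: algebra_simps)

text \<open>When the two inequalities are multiplied, the cross-ratio of the intermediate points
  cancels. Hence an iterate needs no Schwarzian computation of its own.\<close>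

lemma cr_expanding_compose:
  assumes f: "cr_expanding S f" and g: "cr_expanding T g" and sub: "f ` S \<subseteq> T"
  shows "cr_expanding S (\<lambda>x. g (f x))"
  unfolding cr_expanding_def
proof (intro conjI ballI impI)
  have sf: "\<And>x y. x \<in> S \<Longrightarrow> y \<in> S \<Longrightarrow> x < y \<Longrightarrow> f x < f y"
    using cr_expanding_mono[OF f] by (simp add: strict_mono_on_def)
  have sg: "\<And>x y. x \<in> T \<Longrightarrow> y \<in> T \<Longrightarrow> x < y \<Longrightarrow> g x < g y"
    using cr_expanding_mono[OF g] by (simp add: strict_mono_on_def)
  show "strict_mono_on S (\<lambda>x. g (f x))"
    unfolding strict_mono_on_def using sf sg sub by blast
  fix a b c d assume S: "a \<in> S" "b \<in> S" "c \<in> S" "d \<in> S" and lt: "a < b" "b < c" "c < d"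
  have T: "f a \<in> T" "f b \<in> T" "f c \<in> T" "f d \<in> T" using S sub by auto
  have flt: "f a < f b" "f b < f c" "f c < f d" using sf S lt by auto
  have glt: "g (f a) < g (f b)" "g (f b) < g (f c)" "g (f c) < g (f d)" using sg T flt by auto
  define X where "X = (c - a) * (d - b)"
  define Y where "Y = (b - a) * (d - c)"
  define fX where "fX = (f c - f a) * (f d - f b)"
  define fY where "fY = (f b - f a) * (f d - f c)"
  define gX where "gX = (g (f c) - g (f a)) * (g (f d) - g (f b))"
  define gY where "gY = (g (f b) - g (f a)) * (g (f d) - g (f c))"
  have 1: "X * fY \<le> fX * Y"
    using cr_expandingD[OF f S lt] by (simp add: X_def Y_def fX_def fY_def)
  have 2: "fX * gY \<le> gX * fY"
    using cr_expandingD[OF g T flt] by (simp add: gX_def gY_def fX_def fY_def)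
  have pos: "fY > 0" "gY > 0" "Y > 0" using flt glt lt by (simp_all add: fY_def gY_def Y_def)
  have "(X * gY) * fY = (X * fY) * gY" by simp
  also have "\<dots> \<le> (fX * Y) * gY" using 1 pos by (intro mult_right_mono) auto
  also have "\<dots> = (fX * gY) * Y" by simp
  also have "\<dots> \<le> (gX * fY) * Y" using 2 pos by (intro mult_right_mono) auto
  also have "\<dots> = (gX * Y) * fY" by simp
  finally have "X * gY \<le> gX * Y" using pos by simp
  then show "(c - a) * (d - b) * ((g (f b) - g (f a)) * (g (f d) - g (f c)))
        \<le> (g (f c) - g (f a)) * (g (f d) - g (f b)) * ((b - a) * (d - c))"
    by (simp add: X_def Y_def gX_def gY_def)
qed

text \<open>The pattern stretches the two outer gaps strictly and does not stretch the middle one.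
  Both factors \<open>(c - a) / (b - a)\<close> and \<open>(d - b) / (d - c)\<close> then decrease
  strictly under \<open>\<phi>\<close>, and with them the cross-ratio.\<close>

lemma cr_expanding_no_pattern:
  assumes "cr_expanding S \<phi>" "a \<in> S" "b \<in> S" "c \<in> S" "d \<in> S" "a < b" "b < c" "c < d"
    and g: "\<phi> a < a + p" "\<phi> b \<ge> b + p" "\<phi> c \<le> c + p" "\<phi> d > d + p"
  shows False
proof -
  define A where "A = \<phi> b - \<phi> a"
  define B where "B = \<phi> c - \<phi> b"
  define D where "D = \<phi> d - \<phi> c"
  have sm: "\<And>x y. x \<in> S \<Longrightarrow> y \<in> S \<Longrightarrow> x < y \<Longrightarrow> \<phi> x < \<phi> y"
    using cr_expanding_mono[OF assms(1)] by (simp add: strict_mono_on_def)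
  have B: "0 < B" "B \<le> c - b" using sm[of b c] assms by (auto simp: B_def)
  have A: "A > b - a" and D: "D > d - c" using g by (auto simp: A_def D_def)
  have "(A + B) * (b - a) < A * (c - a)"
  proof -
    have "B * (b - a) \<le> (c - b) * (b - a)" using B assms by (intro mult_right_mono) auto
    also have "\<dots> < (c - b) * A" using A assms by (intro mult_strict_left_mono) auto
    finally show ?thesis by (simp add: algebra_simps)
  qed
  moreover have "(B + D) * (d - c) < D * (d - b)"
  proof -
    have "B * (d - c) \<le> (c - b) * (d - c)" using B assms by (intro mult_right_mono) auto
    also have "\<dots> < (c - b) * D" using D assms by (intro mult_strict_left_mono) auto
    finally show ?thesis by (simp add: algebra_simps)
  qed
  moreover have "0 < A * (c - a)" "0 \<le> (B + D) * (d - c)" using A B D assms by auto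
  ultimately have "((A + B) * (b - a)) * ((B + D) * (d - c)) < (A * (c - a)) * (D * (d - b))"
    by (rule mult_strict_mono)
  moreover have "(c - a) * (d - b) * (A * D) \<le> (A + B) * (B + D) * ((b - a) * (d - c))"
    using cr_expandingD[OF assms(1-8)] by (simp add: A_def B_def D_def)
  ultimately show False by (simp add: algebra_simps)
qed

text \<open>Here \<open>la\<close>, \<open>lb\<close>, \<open>lc\<close> are the values of an affine
  \<open>l\<close> at \<open>a\<close>, \<open>b\<close>, \<open>c\<close>. A Moebius map with
  derivative \<open>1 / l^2\<close> has increments \<open>(y - x) / (l x * l y)\<close> and turns
  the claim into an equality; a smaller outer increment \<open>A\<close> and a larger inner
  increment \<open>B\<close> only help. If \<open>la\<close> is not positive, that map has a pole in
  \<open>[a, b)\<close>, and the term with \<open>la\<close> is nonpositive anyway.\<close>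

lemma ratio_less_by_affine_bound:
  fixes a b c la lb lc A B :: real
  assumes "a < b" "b < c" "0 < lb" "0 < lc" and aff: "(c - b) * la + (b - a) * lc = (c - a) * lb"
    and B: "B \<ge> (c - b) / (lb * lc)" and A: "A > 0" "la > 0 \<Longrightarrow> A \<le> (b - a) / (la * lb)"
  shows "(c - a) * lb * A \<le> (A + B) * ((b - a) * lc)"
proof -
  have "(c - b) * la * A \<le> B * ((b - a) * lc)"
  proof (cases "la > 0")
    case True
    have "(c - b) * la * A \<le> (c - b) * la * ((b - a) / (la * lb))"
      using A(2)[OF True] assms True by (intro mult_left_mono) auto
    also have "\<dots> = (c - b) / (lb * lc) * ((b - a) * lc)" using True assms by (simp add: field_simps)
    also have "\<dots> \<le> B * ((b - a) * lc)" using B assms by (intro mult_right_mono) auto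
    finally show ?thesis .
  next
    case False
    have "(c - b) * la * A \<le> 0" using False assms by (simp add: mult_nonneg_nonpos mult_nonpos_nonneg)
    moreover have "B \<ge> 0" using B assms by (smt (verit) divide_nonneg_nonneg mult_nonneg_nonneg)
    ultimately show ?thesis using assms by (smt (verit) mult_nonneg_nonneg)
  qed
  moreover have "(c - a) * lb * A = (c - b) * la * A + A * ((b - a) * lc)"
    using aff by (metis (no_types, lifting) distrib_right mult.commute)
  ultimately show ?thesis by (simp add: algebra_simps)
qed

lemma deriv_affine_quotient:
  fixes l0 l1 b x :: real
  assumes "l0 > 0" "l0 + l1 * (x - b) > 0"
  shows "((\<lambda>x. (x - b) / (l0 * (l0 + l1 * (x - b)))) has_real_derivative
          1 / (l0 + l1 * (x - b))\<^sup>2) (at x)"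
proof -
  have "((\<lambda>x. (x - b) / (l0 * (l0 + l1 * (x - b)))) has_real_derivative
      (1 * (l0 * (l0 + l1 * (x - b))) - (x - b) * (l0 * l1)) / (l0 * (l0 + l1 * (x - b)))\<^sup>2) (at x)"
    using assms by (auto intro!: derivative_eq_intros simp: power2_eq_square)
  moreover have "1 * (l0 * (l0 + l1 * (x - b))) - (x - b) * (l0 * l1) = l0\<^sup>2"
    by (simp add: power2_eq_square algebra_simps)
  moreover have "l0\<^sup>2 / (l0 * (l0 + l1 * (x - b)))\<^sup>2 = 1 / (l0 + l1 * (x - b))\<^sup>2"
    using assms by (simp add: power_mult_distrib)
  ultimately show ?thesis by simp
qed

text \<open>The factor \<open>s\<close> covers both directions: it is used with \<open>1\<close> for
  an upper and with \<open>-1\<close> for a lower estimate of the increment.\<close>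

lemma increment_le_affine:
  fixes f D :: "real \<Rightarrow> real"
  assumes "x < y" "continuous_on {x..y} f"
    and d: "\<And>z. x < z \<Longrightarrow> z < y \<Longrightarrow> (f has_real_derivative D z) (at z)"
    and l: "\<And>z. l z = l x + m * (z - x)" and pos: "l x > 0" "l y > 0"
    and le: "\<And>z. x < z \<Longrightarrow> z < y \<Longrightarrow> s * D z \<le> s / (l z)\<^sup>2"
  shows "s * (f y - f x) \<le> s * ((y - x) / (l x * l y))"
proof -
  have lpos: "l z > 0" if "x \<le> z" "z \<le> y" for z
  proof (cases "m \<ge> 0")
    case True
    then have "m * (z - x) \<ge> 0" using that by simp
    then show ?thesis using l[of z] pos by simp
  next
    case False
    then have "m * (y - x) \<le> m * (z - x)" using that by (intro mult_left_mono_neg) auto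
    then show ?thesis using l[of z] l[of y] pos by simp
  qed
  define h where "h = (\<lambda>z. s * ((z - x) / (l x * (l x + m * (z - x)))) - s * f z)"
  have "h x \<le> h y"
  proof (rule DERIV_nonneg_imp_increasing_open[of x y h])
    show "x \<le> y" using assms(1) by simp
    show "\<exists>E. (h has_real_derivative E) (at z) \<and> E \<ge> 0" if "x < z" "z < y" for z
    proof -
      have "l x + m * (z - x) > 0" using lpos[of z] l[of z] that by simp
      then have "(h has_real_derivative s * (1 / (l x + m * (z - x))\<^sup>2) - s * D z) (at z)"
        unfolding h_def using that by (intro DERIV_diff DERIV_cmult deriv_affine_quotient d pos)
      moreover have "0 \<le> s * (1 / (l x + m * (z - x))\<^sup>2) - s * D z" using le[OF that] l[of z] by simp
      ultimately show ?thesis by blast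
    qed
    have "l x + m * (z - x) \<noteq> 0" if "z \<in> {x..y}" for z using lpos[of z] l[of z] that by simp
    then show "continuous_on {x..y} h"
      unfolding h_def using pos by (intro continuous_intros assms(2)) auto
  qed
  then have "s * f y - s * f x \<le> s * ((y - x) / (l x * (l x + m * (y - x))))" by (simp add: h_def)
  then show ?thesis unfolding l[of y, symmetric] by (simp add: right_diff_distrib)
qed

text \<open>In effect \<open>u\<close> is \<open>(f')^(-1/2)\<close>. Let \<open>l\<close> be the
  affine function through its values at \<open>b\<close> and \<open>c\<close>. Convexity puts
  \<open>u\<close> below \<open>l\<close> between these points and above \<open>l\<close> outside.
  Compared with the Moebius map of derivative \<open>1 / l^2\<close>, which preserves cross-ratios,
  the middle increment \<open>B\<close> of \<open>f\<close> is therefore larger and the outer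
  increments \<open>A\<close>, \<open>D\<close> are smaller. The cross-ratio of the images is
  \<open>(1 + B / A) * (1 + B / D)\<close>, so it grows.\<close>

lemma cr_expanding_of_convex:
  fixes f u :: "real \<Rightarrow> real"
  assumes cont: "continuous_on {\<alpha>..\<beta>} f"
    and d: "\<And>z. z \<in> {\<alpha><..<\<beta>} \<Longrightarrow> (f has_real_derivative 1 / (u z)\<^sup>2) (at z)"
    and pos: "\<And>z. z \<in> {\<alpha><..<\<beta>} \<Longrightarrow> u z > 0"
    and conv: "convex_on {\<alpha><..<\<beta>} u"
  shows "cr_expanding {\<alpha>..\<beta>} f"
  unfolding cr_expanding_def
proof (intro conjI ballI impI)
  have sm: "f x < f y" if "x \<in> {\<alpha>..\<beta>}" "y \<in> {\<alpha>..\<beta>}" "x < y" for x y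
  proof (rule DERIV_pos_imp_increasing_open[OF that(3)])
    show "\<exists>D. (f has_real_derivative D) (at z) \<and> D > 0" if "x < z" "z < y" for z
      using d[of z] pos[of z] that \<open>x \<in> _\<close> \<open>y \<in> _\<close>
      by (intro exI[of _ "1 / (u z)\<^sup>2"]) auto
    show "continuous_on {x..y} f" using cont that by (auto intro: continuous_on_subset)
  qed
  then show "strict_mono_on {\<alpha>..\<beta>} f" by (simp add: strict_mono_on_def)
  fix a b c e assume S: "a \<in> {\<alpha>..\<beta>}" "b \<in> {\<alpha>..\<beta>}" "c \<in> {\<alpha>..\<beta>}" "e \<in> {\<alpha>..\<beta>}"
    and lt: "a < b" "b < c" "c < e"
  have bI: "b \<in> {\<alpha><..<\<beta>}" and cI: "c \<in> {\<alpha><..<\<beta>}" using S lt by auto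
  define lb where "lb = u b"
  define lc where "lc = u c"
  define m where "m = (lc - lb) / (c - b)"
  define l where "l = (\<lambda>z. lb + m * (z - b))"
  have lpos: "lb > 0" "lc > 0" using pos bI cI by (auto simp: lb_def lc_def)
  have lc: "l c = lc" using lt by (simp add: l_def m_def)
  have lb: "l b = lb" by (simp add: l_def)
  have inner: "u z \<le> l z" if "b \<le> z" "z \<le> c" for z
  proof -
    define t where "t = (z - b) / (c - b)"
    have "t * (c - b) = z - b" using lt by (simp add: t_def)
    then have t3: "z = (1 - t) * b + t * c" by (simp add: algebra_simps)
    have t: "0 \<le> t" "t \<le> 1" using that lt
      by (auto simp: t_def)
    have "u z \<le> (1 - t) * u b + t * u c"
      using convex_onD[OF conv t(1,2) bI cI] t3 by simp
    also have "\<dots> = u b + t * (u c - u b)" by (simp add: algebra_simps)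
    also have "t * (u c - u b) = m * (z - b)" by (simp add: t_def m_def lb_def lc_def)
    also have "u b + m * (z - b) = l z" by (simp add: l_def lb_def)
    finally show ?thesis .
  qed
  have outerl: "l z \<le> u z" if "z \<in> {\<alpha><..<\<beta>}" "z \<le> b" for z
  proof -
    define t where "t = (b - z) / (c - z)"
    have cz: "c - z > 0" using that lt by simp
    have tt: "t * (c - z) = b - z" using cz by (simp add: t_def)
    then have t3: "b = (1 - t) * z + t * c" by (simp add: algebra_simps)
    have t: "0 \<le> t" "t \<le> 1" using that lt cz
      by (auto simp: t_def)
    have "u b \<le> (1 - t) * u z + t * u c"
      using convex_onD[OF conv t(1) _ that(1) cI] t t3 by simp
    then have "(c - z) * u b \<le> (c - z) * ((1 - t) * u z + t * u c)" using cz by simp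
    also have "\<dots> = (c - z) * u z + (t * (c - z)) * (u c - u z)" by (simp add: algebra_simps)
    also have "\<dots> = (c - b) * u z + (b - z) * u c" unfolding tt by (simp add: algebra_simps)
    finally have "(c - z) * lb - (b - z) * lc \<le> (c - b) * u z" by (simp add: lb_def lc_def)
    moreover have "(c - b) * l z = (c - z) * lb - (b - z) * lc"
      using lt by (simp add: l_def m_def field_simps)
    ultimately have "(c - b) * l z \<le> (c - b) * u z" by simp
    then show ?thesis using lt by simp
  qed
  have outerr: "l z \<le> u z" if "z \<in> {\<alpha><..<\<beta>}" "c \<le> z" for z
  proof -
    define t where "t = (c - b) / (z - b)"
    have cz: "z - b > 0" using that lt by simp
    have tt: "t * (z - b) = c - b" using cz by (simp add: t_def)
    then have t3: "c = (1 - t) * b + t * z" by (simp add: algebra_simps)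
    have t: "0 \<le> t" "t \<le> 1" using that lt cz
      by (auto simp: t_def)
    have "u c \<le> (1 - t) * u b + t * u z"
      using convex_onD[OF conv t(1,2) bI that(1)] t3 by simp
    then have "(z - b) * u c \<le> (z - b) * ((1 - t) * u b + t * u z)" using cz by simp
    also have "\<dots> = (z - b) * u b + (t * (z - b)) * (u z - u b)" by (simp add: algebra_simps)
    also have "\<dots> = (z - c) * u b + (c - b) * u z" unfolding tt by (simp add: algebra_simps)
    finally have "(z - b) * lc - (z - c) * lb \<le> (c - b) * u z" by (simp add: lb_def lc_def)
    moreover have "(c - b) * l z = (z - b) * lc - (z - c) * lb"
      using lt by (simp add: l_def m_def field_simps)
    ultimately have "(c - b) * l z \<le> (c - b) * u z" by simp
    then show ?thesis using lt by simp
  qed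
  have aff: "l z = l x + m * (z - x)" for x z by (simp add: l_def algebra_simps)
  have df: "(f has_real_derivative 1 / (u z)\<^sup>2) (at z)" if "\<alpha> < z" "z < \<beta>" for z using d that by simp
  have B: "f c - f b \<ge> (c - b) / (lb * lc)"
  proof -
    have "-1 * (f c - f b) \<le> -1 * ((c - b) / (l b * l c))"
    proof (rule increment_le_affine[OF lt(2) _ df aff])
      show "continuous_on {b..c} f" using cont S by (auto intro: continuous_on_subset)
      fix z assume z: "b < z" "z < c"
      then have zI: "z \<in> {\<alpha><..<\<beta>}" using bI cI by auto
      have "(u z)\<^sup>2 \<le> (l z)\<^sup>2" using inner[of z] pos[OF zI] z by (intro power_mono) auto
      then have "1 / (l z)\<^sup>2 \<le> 1 / (u z)\<^sup>2" using pos[OF zI] by (intro divide_left_mono) (auto simp: zero_less_mult_iff)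
      then show "-1 * (1 / (u z)\<^sup>2) \<le> -1 / (l z)\<^sup>2" by simp
    qed (use bI cI lpos lb lc in auto)
    then show ?thesis using lb lc by (simp add: diff_divide_distrib)
  qed
  have outer: "f y - f x \<le> (y - x) / (l x * l y)"
    if xy: "x < y" "x \<in> {\<alpha>..\<beta>}" "y \<in> {\<alpha>..\<beta>}" "y \<le> b \<or> c \<le> x" and lp: "l x > 0" "l y > 0" for x y
  proof -
    have "1 * (f y - f x) \<le> 1 * ((y - x) / (l x * l y))"
    proof (rule increment_le_affine[OF xy(1) _ df aff lp])
      show "continuous_on {x..y} f" using cont xy by (auto intro: continuous_on_subset)
      fix z assume z: "x < z" "z < y"
      then have zI: "z \<in> {\<alpha><..<\<beta>}" using xy by auto
      have "l x + m * (z - x) \<ge> min (l x) (l y)"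
      proof (cases "m \<ge> 0")
        case False
        then have "m * (y - x) \<le> m * (z - x)" using z by (intro mult_left_mono_neg) auto
        then show ?thesis using aff[of y x] by simp
      next
        case True
        then have "m * (z - x) \<ge> 0" using z by simp
        then show ?thesis by simp
      qed
      then have lz0: "0 < l z" using aff[of z x] lp by simp
      have "l z \<le> u z" using outerl[OF zI] outerr[OF zI] xy(4) z by auto
      then have "(l z)\<^sup>2 \<le> (u z)\<^sup>2" using lz0 by (intro power_mono) auto
      then have "1 / (u z)\<^sup>2 \<le> 1 / (l z)\<^sup>2" using lz0 by (intro divide_left_mono) (auto simp: zero_less_mult_iff)
      then show "1 * (1 / (u z)\<^sup>2) \<le> 1 / (l z)\<^sup>2" by simp
    qed (use xy in auto)
    then show ?thesis by simp
  qed
  have A: "f b - f a \<le> (b - a) / (l a * lb)" if "l a > 0"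
    using outer[of a b] that S lt lpos lb by simp
  have D: "f e - f c \<le> (e - c) / (l e * lc)" if "l e > 0"
    using outer[of c e] that S lt lpos lc by (simp add: mult.commute)
  have pa: "f b - f a > 0" and pe: "f e - f c > 0" and pb: "f c - f b > 0"
    using sm S lt by auto
  have 1: "(c - a) * lb * (f b - f a) \<le> ((f b - f a) + (f c - f b)) * ((b - a) * lc)"
  proof (rule ratio_less_by_affine_bound[where la = "l a"])
    show "(c - b) * l a + (b - a) * lc = (c - a) * lb"
      using lt by (simp add: l_def m_def field_simps)
  qed (use lt lpos B A pa in auto)
  \<comment> \<open>The right half is the left half for the mirrored points
    \<open>-e < -c < -b\<close>.\<close>
  have 2: "((-b) - (-e)) * lc * (f e - f c) \<le> ((f e - f c) + (f c - f b)) * (((-c) - (-e)) * lb)"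
  proof (rule ratio_less_by_affine_bound[where la = "l e" and b = "-c"])
    show "((-b) - (-c)) * l e + ((-c) - (-e)) * lb = ((-b) - (-e)) * lc"
      using lt by (simp add: l_def m_def field_simps)
  qed (use lt lpos B D pe in \<open>auto simp: mult.commute\<close>)
  have "((c - a) * lb * (f b - f a)) * ((e - b) * lc * (f e - f c))
      \<le> ((f c - f a) * ((b - a) * lc)) * ((f e - f b) * ((e - c) * lb))"
  proof (rule mult_mono)
    show "(c - a) * lb * (f b - f a) \<le> (f c - f a) * ((b - a) * lc)" using 1 by simp
    show "(e - b) * lc * (f e - f c) \<le> (f e - f b) * ((e - c) * lb)" using 2 by simp
  qed (use lt lpos pa pe pb in auto)
  then have "(lb * lc) * ((c - a) * (e - b) * ((f b - f a) * (f e - f c)))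
     \<le> (lb * lc) * ((f c - f a) * (f e - f b) * ((b - a) * (e - c)))"
    by (simp add: algebra_simps)
  moreover have "lb * lc > 0" using lpos by simp
  ultimately show "(c - a) * (e - b) * ((f b - f a) * (f e - f c))
     \<le> (f c - f a) * (f e - f b) * ((b - a) * (e - c))"
    by (simp only: mult_le_cancel_left_pos)
qed

text \<open>The second derivative of \<open>(f')^(-1/2)\<close> is \<open>-1/2 * (f')^(-1/2)\<close>
  times the Schwarzian derivative. At the end points only continuity is asked for, because they will
  be turning points.\<close>

lemma cr_expanding_of_Schwarzian:
  fixes f f1 f2 f3 :: "real \<Rightarrow> real"
  assumes cont: "continuous_on {\<alpha>..\<beta>} f"
    and d: "\<And>z. z \<in> {\<alpha><..<\<beta>} \<Longrightarrow> (f has_real_derivative f1 z) (at z)"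
      "\<And>z. z \<in> {\<alpha><..<\<beta>} \<Longrightarrow> (f1 has_real_derivative f2 z) (at z)"
      "\<And>z. z \<in> {\<alpha><..<\<beta>} \<Longrightarrow> (f2 has_real_derivative f3 z) (at z)"
    and pos: "\<And>z. z \<in> {\<alpha><..<\<beta>} \<Longrightarrow> f1 z > 0"
    and neg: "\<And>z. z \<in> {\<alpha><..<\<beta>} \<Longrightarrow> f3 z / f1 z - 3 / 2 * (f2 z / f1 z)\<^sup>2 \<le> 0"
  shows "cr_expanding {\<alpha>..\<beta>} f"
proof (rule cr_expanding_of_convex[where u = "\<lambda>z. f1 z powr (-1/2)"])
  show "(f has_real_derivative 1 / (f1 z powr (-1/2))\<^sup>2) (at z)" if "z \<in> {\<alpha><..<\<beta>}" for z
  proof -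
    have "(f1 z powr (-1/2))\<^sup>2 = f1 z powr (-1)" by (simp add: power2_eq_square flip: powr_add)
    then show ?thesis using d(1)[OF that] pos[OF that] by (simp add: powr_minus_divide)
  qed
  show "convex_on {\<alpha><..<\<beta>} (\<lambda>z. f1 z powr (-1/2))"
  proof (rule f''_ge0_imp_convex)
    fix z assume "z \<in> {\<alpha><..<\<beta>}"
    note z = d[OF this] pos[OF this] neg[OF this]
    show "((\<lambda>z. f1 z powr (-1/2)) has_real_derivative (-1/2) * f1 z powr (-3/2) * f2 z) (at z)"
      using DERIV_fun_powr[OF z(2,4), of "-1/2"] by simp
    show "((\<lambda>z. (-1/2) * f1 z powr (-3/2) * f2 z) has_real_derivative
       (3/4) * f1 z powr (-5/2) * (f2 z)\<^sup>2 - (1/2) * f1 z powr (-3/2) * f3 z) (at z)"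
    proof -
      have "((\<lambda>z. f1 z powr (-3/2)) has_real_derivative (-3/2) * f1 z powr (-5/2) * f2 z) (at z)"
        using DERIV_fun_powr[OF z(2,4), of "-3/2"] by simp
      from DERIV_cmult[OF DERIV_mult[OF this z(3)], of "-1/2"] show ?thesis
        by (simp add: algebra_simps power2_eq_square)
    qed
    have "(3/4) * f1 z powr (-5/2) * (f2 z)\<^sup>2 - (1/2) * f1 z powr (-3/2) * f3 z
       = (-1/2) * f1 z powr (-1/2) * (f3 z / f1 z - 3 / 2 * (f2 z / f1 z)\<^sup>2)"
    proof -
      define w where "w = f1 z powr (-1/2)"
      have "f1 z powr (-5/2) = w * (f1 z powr (-2))" unfolding w_def by (subst powr_add[symmetric]) simp
      then have e1: "f1 z powr (-5/2) = w / (f1 z)\<^sup>2" using z by (simp add: powr_minus_divide)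
      have "f1 z powr (-3/2) = w * (f1 z powr (-1))" unfolding w_def by (subst powr_add[symmetric]) simp
      then have e2: "f1 z powr (-3/2) = w / f1 z" using z by (simp add: powr_minus_divide)
      show ?thesis unfolding e1 e2 w_def[symmetric] using z(4) by (simp add: field_simps power2_eq_square)
    qed
    also have "\<dots> \<ge> 0" using z by (simp add: mult_nonpos_nonpos mult_nonneg_nonpos)
    finally show "0 \<le> (3/4) * f1 z powr (-5/2) * (f2 z)\<^sup>2 - (1/2) * f1 z powr (-3/2) * f3 z" .
  qed auto
qed (use cont pos in \<open>auto simp: less_imp_neq[symmetric]\<close>)

section \<open>Ordered periodic orbits of monotone degree-one maps\<close>

lemma deg_one_int:
  fixes g :: "real \<Rightarrow> real"
  assumes "\<And>x. g (x + 1) = g x + 1"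
  shows "g (x + of_int m) = g x + of_int m"
proof -
  have nat: "g (x + of_nat n) = g x + of_nat n" for n x
    by (induction n) (use assms[of "x + of_nat _"] in \<open>auto simp: add.assoc[symmetric] add.commute[of 1]\<close>)
  show ?thesis
  proof (cases "m \<ge> 0")
    case True
    then show ?thesis using nat[of x "nat m"] by simp
  next
    case False
    then show ?thesis using nat[of "x + of_int m" "nat (- m)"] by simp
  qed
qed

lemma deg_one_funpow:
  fixes g :: "real \<Rightarrow> real"
  assumes "\<And>x. g (x + 1) = g x + 1"
  shows "(g ^^ n) (x + of_int m) = (g ^^ n) x + of_int m"
  by (induction n) (simp_all add: deg_one_int[of g, OF assms])

text \<open>Only the larger map is assumed monotone, and only the smaller one in the companion
  lemma. This lets iterates of a non-monotone lift be squeezed between those of its bounds.\<close>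

lemma funpow_le_funpow:
  fixes g h :: "real \<Rightarrow> real"
  assumes "mono h" "\<And>x. g x \<le> h x" "x \<le> y"
  shows "(g ^^ n) x \<le> (h ^^ n) y"
proof (induction n)
  case (Suc n)
  have "g ((g ^^ n) x) \<le> h ((g ^^ n) x)" by (rule assms)
  also have "\<dots> \<le> h ((h ^^ n) y)" using monoD[OF assms(1) Suc] by simp
  finally show ?case by simp
qed (use assms in auto)

lemma funpow_le_funpow':
  fixes g h :: "real \<Rightarrow> real"
  assumes "mono h" "\<And>x. h x \<le> g x" "x \<le> y"
  shows "(h ^^ n) x \<le> (g ^^ n) y"
proof (induction n)
  case (Suc n)
  have "h ((h ^^ n) x) \<le> h ((g ^^ n) y)" using monoD[OF assms(1) Suc] by simp
  also have "\<dots> \<le> g ((g ^^ n) y)" by (rule assms)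
  finally show ?case by simp
qed (use assms in auto)

lemma IVT_unordered:
  fixes h :: "real \<Rightarrow> real"
  assumes c: "continuous_on UNIV h" and "h a \<le> y" "y \<le> h b"
  obtains v where "h v = y"
proof (cases "a \<le> b")
  case True
  then show ?thesis using IVT'[of h a y b] assms continuous_on_subset[OF c] that by blast
next
  case False
  then show ?thesis using IVT2'[of h a y b] assms continuous_on_subset[OF c] that by force
qed

lemma continuous_funpow:
  assumes "continuous_on UNIV (g :: real \<Rightarrow> real)" shows "continuous_on UNIV (g ^^ n)"
proof (induction n)
  case (Suc n)
  then show ?case
    using continuous_on_compose[OF Suc continuous_on_subset[OF assms]] by simp
qed (simp add: continuous_on_id id_def)

locale deg_one_mono =
  fixes g :: "real \<Rightarrow> real"
  assumes mono: "mono g" and deg: "g (x + 1) = g x + 1"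
begin

lemma funpow_mono': "x \<le> y \<Longrightarrow> (g ^^ n) x \<le> (g ^^ n) y"
  using funpow_mono[OF mono] by blast

lemma funpow_int: "(g ^^ n) (x + of_int m) = (g ^^ n) x + of_int m"
  using deg_one_funpow[of g, OF deg] .

lemma funpow_nat: "(g ^^ n) (x + real m) = (g ^^ n) x + real m"
  using funpow_int[of n x "int m"] by simp

lemma funpow_nat_diff: "(g ^^ n) (x - real m) = (g ^^ n) x - real m"
  using funpow_int[of n x "- int m"] by simp

lemma funpow_mult_ge:
  assumes "\<And>x. (g ^^ q) x \<ge> x + c"
  shows "(g ^^ (n * q)) x \<ge> x + real n * c"
proof (induction n)
  case (Suc n)
  have "x + real (Suc n) * c \<le> (g ^^ (n * q)) x + c" using Suc by (simp add: algebra_simps)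
  also have "\<dots> \<le> (g ^^ q) ((g ^^ (n * q)) x)" by (rule assms)
  finally show ?case by (simp add: funpow_add)
qed auto

end

locale periodic_orbit = deg_one_mono +
  fixes p q p1 q1 :: nat and w :: real
  assumes per: "(g ^^ q) w = w + real p" and farey: "p * q1 = p1 * q + 1"
begin

text \<open>The orbit of \<open>w\<close> modulo integers in its natural order: the index shift by one is
  realised by \<open>g^q1 - p1\<close> because \<open>p1 / q1\<close> is a Farey neighbour of \<open>p / q\<close>.\<close>

definition W :: "nat \<Rightarrow> real" where
  "W j = (g ^^ (j * q1)) w - real (j * p1)"

lemma W_0 [simp]: "W 0 = w" by (simp add: W_def)

lemma per_mult: "(g ^^ (n + q * k)) w = (g ^^ n) w + real (k * p)"
proof (induction k)
  case (Suc k)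
  have "(g ^^ (n + q * Suc k)) w = (g ^^ (n + q * k)) ((g ^^ q) w)"
    by (simp flip: funpow_add comp_apply[of "g ^^ _" "g ^^ _"] add: algebra_simps)
  also have "\<dots> = (g ^^ (n + q * k)) w + real p" by (simp add: per funpow_nat)
  finally show ?case using Suc by simp
qed simp

text \<open>Since \<open>p * q1\<close> is \<open>1\<close> modulo \<open>q\<close>, one application
  of \<open>g\<close> moves the index by \<open>p\<close>; each surplus block of \<open>q\<close>
  applications contributes the integer \<open>p\<close>.\<close>

lemma funpow_W: "(g ^^ i) (W j) = W (j + i * p)"
proof -
  have e: "(j + i * p) * q1 = (i + j * q1) + q * (i * p1)"
  proof -
    have "(j + i * p) * q1 = j * q1 + i * (p * q1)" by (simp add: algebra_simps)
    then show ?thesis unfolding farey by (simp add: algebra_simps)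
  qed
  have "(g ^^ i) (W j) = (g ^^ (i + j * q1)) w - real (j * p1)"
    unfolding W_def funpow_nat_diff by (simp add: funpow_add)
  moreover have "W (j + i * p) = (g ^^ (i + j * q1)) w + real (i * p1 * p) - real ((j + i * p) * p1)"
    unfolding W_def e per_mult by simp
  ultimately show ?thesis by (simp add: algebra_simps)
qed

lemma W_add_q: "W (j + q) = W j + 1"
proof -
  have "W (j + q) = (g ^^ (j * q1 + q * q1)) w - real ((j + q) * p1)"
    unfolding W_def by (simp add: algebra_simps)
  also have "\<dots> = W j + (real (q1 * p) - real (q * p1))"
    unfolding per_mult W_def by (simp add: algebra_simps)
  also have "real (q1 * p) - real (q * p1) = 1" using farey by (simp add: mult.commute)
  finally show ?thesis .
qed

lemma W_add_mult_q: "W (j + m * q) = W j + real m"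
proof (induction m)
  case (Suc m)
  have "W (j + Suc m * q) = W ((j + m * q) + q)" by (simp add: algebra_simps)
  then show ?case using Suc W_add_q[of "j + m * q"] by simp
qed simp

lemma W_Suc: "W (Suc j) = (g ^^ q1) (W j) - real p1"
  unfolding W_def funpow_nat_diff by (simp add: funpow_add)

text \<open>A gap that is not positive would propagate by monotonicity, so the sequence would never
  rise above \<open>W j\<close> again, against \<open>W (j + q) = W j + 1\<close>.\<close>

lemma W_less_Suc: "W j < W (Suc j)"
proof (rule ccontr)
  assume "\<not> ?thesis"
  then have le: "W (Suc j) \<le> W j" by simp
  have "W (j + k) \<le> W j" for k
  proof (induction k)
    case (Suc k)
    have "W (Suc (j + k)) \<le> W (Suc j)" unfolding W_Suc using funpow_mono'[OF Suc, of q1] by simp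
    then show ?case using le by simp
  qed simp
  from this[of q] show False using W_add_q[of j] by simp
qed

lemma W_strict: "i < j \<Longrightarrow> W i < W j"
  by (rule lift_Suc_mono_less[of W]) (rule W_less_Suc)

lemma W_mono: "i \<le> j \<Longrightarrow> W i \<le> W j"
  using W_strict[of i j] by (cases "i = j") auto

lemma W_per: "(g ^^ q) (W j) = W j + real p"
  unfolding funpow_W using W_add_mult_q[of j p] by (simp add: mult.commute)

lemma q_pos: "q > 0"
  using W_add_q[of 0] by (cases q) auto

lemma coprime_p_q: "coprime p q"
proof (rule coprimeI)
  fix c assume "c dvd p" "c dvd q"
  then have "c dvd p1 * q + 1" using farey by (metis dvd_mult2)
  then show "is_unit c" using \<open>c dvd q\<close> by (metis dvd_add_right_iff dvd_mult)
qed

text \<open>After \<open>i\<close> steps the index has moved by \<open>i * p\<close>: the residue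
  \<open>j\<close> is the position within one period, the quotient \<open>m\<close> the integer
  translate. Coprimality keeps the residue away from \<open>0\<close> before time
  \<open>q\<close>.\<close>

lemma W_index:
  assumes "0 < i" "i < q"
  obtains j m where "i * p = j + m * q" "1 \<le> j" "j < q"
proof
  show "i * p = (i * p) mod q + (i * p) div q * q" by simp
  show "(i * p) mod q < q" using q_pos by simp
  have "\<not> q dvd i * p" using assms coprime_p_q
    by (metis coprime_commute coprime_dvd_mult_left_iff dvd_imp_le not_le)
  then show "1 \<le> (i * p) mod q" by (simp add: Suc_le_eq mod_greater_zero_iff_not_dvd)
qed

text \<open>Singles out the only time before \<open>q\<close> at which a prescribed residue occurs.
  In the pattern arguments this is the time at which an end of the branch meets a translate of a
  turning point.\<close>

lemma index_unique:
  assumes "i * p + a = m * q" "k * p + a = n * q" "i < q" "k < q"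
  shows "i = k" "m = n"
proof -
  have aux: False if "i * p + a = m * q" "k * p + a = n * q" "i < k" "k < q" for i k m n
  proof -
    have "(k - i) * p = (n - m) * q" using that by (simp add: diff_mult_distrib)
    then have "q dvd (k - i) * p" by simp
    then have "q dvd k - i" using coprime_p_q by (metis coprime_commute coprime_dvd_mult_left_iff)
    then show False using that by (auto dest: dvd_imp_le)
  qed
  show "i = k" using aux[OF assms(1,2)] aux[OF assms(2,1)] assms(3,4) by (meson linorder_neqE_nat)
  then show "m = n" using assms q_pos by auto
qed

end

text \<open>The orbit is relabelled so that index \<open>0\<close> belongs to the last point below
  \<open>t\<close>; its successor in the natural order is reached by \<open>g^q1\<close>, up to
  \<open>p1\<close>.\<close>

lemma (in deg_one_mono) orbit_window:
  assumes "(g ^^ q) z = z + real p" "p * q1 = p1 * q + 1"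
  obtains w where "(g ^^ q) w = w + real p" "w < t" "t \<le> (g ^^ q1) w - real p1"
proof -
  define z' where "z' = z + of_int (\<lceil>t - z\<rceil> - 1)"
  have z': "z' < t" "t \<le> z' + 1" unfolding z'_def by linarith+
  interpret O: periodic_orbit g p q p1 q1 z'
    by unfold_locales (use assms funpow_int[of q z "\<lceil>t - z\<rceil> - 1"] in \<open>auto simp: z'_def\<close>)
  define j where "j = (LEAST j. O.W j \<ge> t)"
  have ex: "O.W q \<ge> t" using O.W_add_q[of 0] z' by simp
  have j: "O.W j \<ge> t" unfolding j_def using ex by (rule LeastI)
  have "j \<noteq> 0" using j z' by (intro notI) simp
  then obtain i where i: "j = Suc i" by (cases j) auto
  have "O.W i < t" using not_less_Least[of i "\<lambda>j. O.W j \<ge> t"] i by (simp add: j_def)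
  then show ?thesis using that[of "O.W i"] O.W_per[of i] O.W_Suc[of i] j i by simp
qed

section \<open>Monotone bounds\<close>

text \<open>The summand \<open>1\<close> turns a rotation number \<open>rho\<close> into
  \<open>1 - rho\<close> instead of \<open>- rho\<close>, so that a numerator \<open>p <= q\<close>
  becomes the natural number \<open>q - p\<close>.\<close>

definition rfl :: "(real \<Rightarrow> real) \<Rightarrow> real \<Rightarrow> real" where
  "rfl f x = 1 - f (- x)"

lemma rfl_rfl [simp]: "rfl (rfl f) = f"
  by (simp add: rfl_def fun_eq_iff)

lemma rfl_funpow:
  assumes "\<And>x. f (x + 1) = f x + 1" shows "(rfl f ^^ n) x = real n - (f ^^ n) (- x)"
proof (induction n)
  case (Suc n)
  have "(rfl f ^^ Suc n) x = rfl f (real n - (f ^^ n) (- x))" by (simp add: Suc)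
  also have "\<dots> = 1 - f ((f ^^ n) (- x) - real n)" by (simp add: rfl_def)
  also have "\<dots> = 1 - (f ((f ^^ n) (- x)) - real n)"
    using deg_one_int[of f, OF assms, of "(f ^^ n) (- x)" "- int n"] by simp
  finally show ?case by simp
qed simp

lemma lift_deg: assumes "degree_one_lift f" shows "f (x + 1) = f x + 1"
  using assms by (simp add: degree_one_lift_def)

lemma lift_cont: assumes "degree_one_lift f" shows "continuous_on A f"
proof (rule continuous_on_subset)
  show "continuous_on UNIV f" using assms by (simp add: degree_one_lift_def)
qed simp

lemma lift_int: assumes "degree_one_lift f" shows "f (x + of_int m) = f x + of_int m"
  by (rule deg_one_int[of f, OF lift_deg[OF assms]])

lemma lift_add: assumes "degree_one_lift f" shows "degree_one_lift (\<lambda>x. f x + a)"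
  unfolding degree_one_lift_def
proof (intro conjI allI)
  show "continuous_on UNIV (\<lambda>x. f x + a)" using lift_cont[OF assms] by (intro continuous_on_add continuous_on_const)
  show "f (x + 1) + a = f x + a + 1" for x using lift_deg[OF assms, of x] by simp
qed

lemma lift_rfl: assumes "degree_one_lift f" shows "degree_one_lift (rfl f)"
  unfolding degree_one_lift_def
proof (intro conjI allI)
  have "continuous_on UNIV (\<lambda>x. f (- x))"
    by (rule continuous_on_compose2[OF lift_cont[OF assms, of UNIV]]) (auto intro: continuous_intros)
  then show "continuous_on UNIV (rfl f)" unfolding rfl_def[abs_def]
    by (intro continuous_on_diff continuous_on_const)
  show "rfl f (x + 1) = rfl f x + 1" for x
    using lift_deg[OF assms, of "- x - 1"] by (simp add: rfl_def)
qed

text \<open>Moving \<open>t\<close> up by a nonnegative integer can only raise the value, so suprema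
  over half-lines are suprema over one period.\<close>

lemma lift_dominated:
  assumes f: "degree_one_lift f" and "t \<le> x"
  obtains s where "x - 1 < s" "s \<le> x" "t \<le> s" "f t \<le> f s"
proof
  define s where "s = t + of_int \<lfloor>x - t\<rfloor>"
  have "\<lfloor>x - t\<rfloor> \<ge> 0" using assms by simp
  then show "t \<le> s" by (simp add: s_def)
  show "x - 1 < s" "s \<le> x" unfolding s_def by linarith+
  show "f t \<le> f s" unfolding s_def lift_int[OF f] using assms by simp
qed

lemma upper_bound_attained:
  assumes f: "degree_one_lift f"
  obtains y where "x - 1 \<le> y" "y \<le> x" "upper_bound f x = f y" "\<And>z. z \<le> x \<Longrightarrow> f z \<le> f y"
proof -
  obtain y where y: "y \<in> {x-1..x}" "\<And>z. z \<in> {x-1..x} \<Longrightarrow> f z \<le> f y"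
    using continuous_attains_sup[OF compact_Icc, of "x - 1" x f] lift_cont[OF f] by auto
  have le: "f z \<le> f y" if z: "z \<le> x" for z
  proof -
    obtain s where "x - 1 < s" "s \<le> x" "f z \<le> f s" using lift_dominated[OF f z] by blast
    then show ?thesis using y(2)[of s] by simp
  qed
  have "upper_bound f x = f y" unfolding upper_bound_def
    by (rule cSup_eq_maximum) (use y le in auto)
  then show ?thesis using that[of y] y le by auto
qed

lemma upper_bound_eqI:
  assumes "y \<le> x" "\<And>z. z \<le> x \<Longrightarrow> f z \<le> f y"
  shows "upper_bound f x = f y"
  unfolding upper_bound_def by (rule cSup_eq_maximum) (use assms in auto)

lemma upper_bound_ge:
  assumes "degree_one_lift f" "z \<le> x" shows "f z \<le> upper_bound f x"
  using upper_bound_attained[OF assms(1), of x] assms(2) by metis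

lemma mono_upper_bound: assumes f: "degree_one_lift f" shows "mono (upper_bound f)"
proof (rule monoI)
  fix x y :: real assume "x \<le> y"
  obtain z where "z \<le> x" "upper_bound f x = f z" using upper_bound_attained[OF f, of x] by metis
  then show "upper_bound f x \<le> upper_bound f y" using upper_bound_ge[OF f, of z y] \<open>x \<le> y\<close> by simp
qed

lemma upper_bound_deg:
  assumes f: "degree_one_lift f" shows "upper_bound f (x + 1) = upper_bound f x + 1"
proof -
  obtain y where y: "y \<le> x" "upper_bound f x = f y" "\<And>z. z \<le> x \<Longrightarrow> f z \<le> f y"
    using upper_bound_attained[OF f, of x] by metis
  have "upper_bound f (x + 1) = f (y + 1)"
  proof (rule upper_bound_eqI)
    fix z assume "z \<le> x + 1"
    then have "f (z - 1) \<le> f y" using y(3)[of "z - 1"] by simp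
    then show "f z \<le> f (y + 1)" using lift_deg[OF f, of y] lift_deg[OF f, of "z - 1"] by simp
  qed (use y in auto)
  then show ?thesis using y lift_deg[OF f] by simp
qed

lemma upper_bound_add:
  assumes f: "degree_one_lift f" shows "upper_bound (\<lambda>x. f x + a) x = upper_bound f x + a"
proof -
  obtain y where y: "y \<le> x" "upper_bound f x = f y" "\<And>z. z \<le> x \<Longrightarrow> f z \<le> f y"
    using upper_bound_attained[OF f, of x] by metis
  have "upper_bound (\<lambda>x. f x + a) x = (\<lambda>x. f x + a) y"
    by (rule upper_bound_eqI) (use y in auto)
  then show ?thesis using y by simp
qed

lemma upper_bound_le_add:
  assumes f: "degree_one_lift f" and g: "degree_one_lift g" and le: "\<And>x. f x \<le> g x + e"
  shows "upper_bound f x \<le> upper_bound g x + e"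
proof -
  obtain y where y: "y \<le> x" "upper_bound f x = f y"
    using upper_bound_attained[OF f, of x] by metis
  then show ?thesis using le[of y] upper_bound_ge[OF g y(1)] by simp
qed

lemma upper_bound_mono: "mono f \<Longrightarrow> upper_bound f = f"
  by (intro ext upper_bound_eqI) (auto simp: mono_def)

lemma continuous_upper_bound:
  assumes f: "degree_one_lift f" shows "continuous_on A (upper_bound f)"
proof -
  have "isCont (upper_bound f) x" for x
    unfolding continuous_at_eps_delta
  proof (intro allI impI)
    fix e :: real assume "e > 0"
    have "isCont f x" using lift_cont[OF f, of UNIV] by (simp add: continuous_on_eq_continuous_at)
    then obtain d where d: "d > 0" "\<And>y. dist y x < d \<Longrightarrow> dist (f y) (f x) < e / 3"
      unfolding continuous_at_eps_delta using \<open>e > 0\<close> by (metis divide_pos_pos zero_less_numeral)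
    \<comment> \<open>A maximiser for \<open>v\<close> that lies beyond \<open>u\<close> is within
      \<open>d\<close> of \<open>x\<close>, so its value is close to \<open>f u\<close>, which the
      bound at \<open>u\<close> dominates.\<close>
    have key: "upper_bound f v \<le> upper_bound f u + 2 * e / 3"
      if "dist u x < d" "dist v x < d" "u \<le> v" for u v
    proof -
      obtain y where y: "y \<le> v" "upper_bound f v = f y"
        using upper_bound_attained[OF f, of v] by metis
      show ?thesis
      proof (cases "y \<le> u")
        case True
        then show ?thesis using upper_bound_ge[OF f True] y \<open>e > 0\<close> by simp
      next
        case False
        then have "dist y x < d" using that y by (auto simp: dist_real_def)
        then have "\<bar>f y - f x\<bar> < e / 3" "\<bar>f u - f x\<bar> < e / 3"
          using d(2)[of y] d(2)[of u] that by (simp_all add: dist_real_def)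
        then have "f y \<le> f u + 2 * e / 3" by linarith
        then show ?thesis using upper_bound_ge[OF f, of u u] y by simp
      qed
    qed
    show "\<exists>d>0. \<forall>y. dist y x < d \<longrightarrow> dist (upper_bound f y) (upper_bound f x) < e"
    proof (intro exI[of _ d] conjI allI impI)
      fix y assume y: "dist y x < d"
      have "\<bar>upper_bound f y - upper_bound f x\<bar> \<le> 2 * e / 3"
      proof (cases "y \<le> x")
        case True
        then show ?thesis using key[of y x] y d(1) monoD[OF mono_upper_bound[OF f], of y x] by auto
      next
        case False
        then show ?thesis using key[of x y] y d(1) monoD[OF mono_upper_bound[OF f], of x y] by auto
      qed
      then show "dist (upper_bound f y) (upper_bound f x) < e" using \<open>e > 0\<close> by (simp add: dist_real_def)
    qed (rule d)
  qed
  then show ?thesis by (simp add: continuous_at_imp_continuous_on)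
qed

text \<open>Through this identity the facts about the lower bound are inherited from the upper
  bound.\<close>

lemma lower_bound_rfl:
  assumes f: "degree_one_lift f" shows "lower_bound f = rfl (upper_bound (rfl f))"
proof
  fix x
  obtain y where y: "y \<le> - x" "upper_bound (rfl f) (- x) = rfl f y" "\<And>z. z \<le> - x \<Longrightarrow> rfl f z \<le> rfl f y"
    using upper_bound_attained[OF lift_rfl[OF f], of "- x"] by metis
  have "lower_bound f x = f (- y)" unfolding lower_bound_def
  proof (rule cInf_eq_minimum)
    show "f (- y) \<in> f ` {x..}" using y(1) by auto
    fix t assume "t \<in> f ` {x..}"
    then obtain z where "t = f z" "x \<le> z" by auto
    then show "f (- y) \<le> t" using y(3)[of "- z"] by (simp add: rfl_def)
  qed
  then show "lower_bound f x = rfl (upper_bound (rfl f)) x" using y(2) by (simp add: rfl_def)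
qed

lemma upper_bound_rfl: "degree_one_lift f \<Longrightarrow> upper_bound (rfl f) = rfl (lower_bound f)"
  using lower_bound_rfl[of f] by simp

lemma lower_bound_rfl': "degree_one_lift f \<Longrightarrow> lower_bound (rfl f) = rfl (upper_bound f)"
  using lower_bound_rfl[OF lift_rfl, of f] by simp

lemma rfl_deg: "(\<And>x. g (x + 1) = g x + 1) \<Longrightarrow> rfl g (x + 1) = rfl g x + (1::real)"
  using deg_one_int[of g "- x" "- 1"] unfolding rfl_def by simp

lemma mono_rfl: "mono g \<Longrightarrow> mono (rfl g)"
  unfolding mono_def rfl_def by simp

lemma lower_bound_le: "degree_one_lift f \<Longrightarrow> x \<le> z \<Longrightarrow> lower_bound f x \<le> f z"
  using upper_bound_ge[OF lift_rfl, of f "- z" "- x"] by (simp add: lower_bound_rfl rfl_def)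

lemma mono_lower_bound: "degree_one_lift f \<Longrightarrow> mono (lower_bound f)"
  by (simp add: lower_bound_rfl mono_rfl mono_upper_bound lift_rfl)

lemma lower_bound_deg: "degree_one_lift f \<Longrightarrow> lower_bound f (x + 1) = lower_bound f x + 1"
  by (simp add: lower_bound_rfl rfl_deg upper_bound_deg lift_rfl)

lemma continuous_lower_bound:
  assumes "degree_one_lift f" shows "continuous_on A (lower_bound f)"
proof -
  have "continuous_on A (\<lambda>x. upper_bound (rfl f) (- x))"
    by (rule continuous_on_compose2[OF continuous_upper_bound[OF lift_rfl[OF assms], of UNIV]])
       (auto intro: continuous_intros)
  then have "continuous_on A (\<lambda>x. 1 - upper_bound (rfl f) (- x))"
    by (intro continuous_intros)
  then show ?thesis unfolding lower_bound_rfl[OF assms] by (simp add: rfl_def[abs_def])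
qed

lemma lower_bound_mono: "mono f \<Longrightarrow> lower_bound f = f"
  unfolding lower_bound_def by (intro ext cInf_eq_minimum) (auto simp: mono_def)

lemma lower_bound_add:
  assumes f: "degree_one_lift f" shows "lower_bound (\<lambda>x. f x + a) x = lower_bound f x + a"
proof -
  have "rfl (\<lambda>x. f x + a) = (\<lambda>x. rfl f x + (- a))" by (auto simp: rfl_def)
  then show ?thesis
    using upper_bound_add[OF lift_rfl[OF f], of "- a" "- x"]
    by (simp add: lower_bound_rfl lift_add f rfl_def)
qed

lemma lower_bound_le_add:
  assumes f: "degree_one_lift f" and g: "degree_one_lift g" and le: "\<And>x. f x \<le> g x + e"
  shows "lower_bound f x \<le> lower_bound g x + e"
proof -
  have "upper_bound (rfl g) (- x) \<le> upper_bound (rfl f) (- x) + e"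
    by (rule upper_bound_le_add) (use le f g lift_rfl in \<open>auto simp: rfl_def algebra_simps\<close>)
  then show ?thesis by (simp add: lower_bound_rfl f g rfl_def)
qed

lemma deg_one_mono_upper: "degree_one_lift f \<Longrightarrow> deg_one_mono (upper_bound f)"
  by unfold_locales (auto simp: mono_upper_bound upper_bound_deg)

lemma deg_one_mono_lower: "degree_one_lift f \<Longrightarrow> deg_one_mono (lower_bound f)"
  by unfold_locales (auto simp: mono_lower_bound lower_bound_deg)

section \<open>Ends of locking intervals\<close>

text \<open>The number \<open>p\<close> is real, not natural, because the other end of the interval
  is the same supremum for the conjugate by \<open>x -> - x\<close>, with \<open>- p\<close> in
  place of \<open>p\<close>.\<close>

definition lock_end :: "(real \<Rightarrow> real) \<Rightarrow> nat \<Rightarrow> real \<Rightarrow> real" where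
  "lock_end g q p = Sup {a. \<exists>x. ((\<lambda>x. g x + a) ^^ q) x \<le> x + p}"

definition lock_start :: "(real \<Rightarrow> real) \<Rightarrow> nat \<Rightarrow> real \<Rightarrow> real" where
  "lock_start g q p = - lock_end (\<lambda>x. - g (- x)) q (- p)"

context deg_one_mono
begin

lemma add_deg_one_mono: "deg_one_mono (\<lambda>x. g x + a)"
  by unfold_locales (use mono deg in \<open>auto simp: mono_def\<close>)

lemma neg_deg_one_mono: "deg_one_mono (\<lambda>x. - g (- x))"
proof
  show "mono (\<lambda>x. - g (- x))" using mono by (auto simp: mono_def)
  show "- g (- (x + 1)) = - g (- x) + 1" for x using deg[of "- x - 1"] by simp
qed

lemma funpow_add_param:
  assumes "a \<le> a'" "n > 0"
  shows "((\<lambda>x. g x + a) ^^ n) x + (a' - a) \<le> ((\<lambda>x. g x + a') ^^ n) x"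
  using assms(2)
proof (cases n)
  case (Suc m)
  interpret A': deg_one_mono "\<lambda>x. g x + a'" by (rule add_deg_one_mono)
  have "((\<lambda>x. g x + a) ^^ m) x \<le> ((\<lambda>x. g x + a') ^^ m) x"
    by (rule funpow_le_funpow[OF A'.mono]) (use assms in auto)
  then have "g (((\<lambda>x. g x + a) ^^ m) x) \<le> g (((\<lambda>x. g x + a') ^^ m) x)" by (rule monoD[OF mono])
  then show ?thesis by (simp add: Suc)
qed simp

lemma continuous_funpow_param:
  assumes "continuous_on UNIV g"
  shows "continuous_on UNIV (\<lambda>(a, x). ((\<lambda>y. g y + a) ^^ n) x)"
proof (induction n)
  case 0
  show ?case by (simp add: case_prod_unfold continuous_on_snd continuous_on_id)
next
  case (Suc n)
  have "continuous_on UNIV (\<lambda>z. g (case z of (a, x) \<Rightarrow> ((\<lambda>y. g y + a) ^^ n) x))"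
    by (rule continuous_on_compose2[OF assms Suc]) simp
  then have "continuous_on UNIV (\<lambda>z. g (case z of (a, x) \<Rightarrow> ((\<lambda>y. g y + a) ^^ n) x) + fst z)"
    by (intro continuous_on_add continuous_on_fst continuous_on_id)
  then show ?case by (simp add: case_prod_unfold)
qed

text \<open>The displacement \<open>N a x\<close> is periodic in \<open>x\<close> and increases with
  \<open>a\<close> at least at unit rate. The admissible \<open>a\<close> hence form a half-line
  bounded above, and it is closed because one period of \<open>x\<close> is compact. At its end no
  displacement can be below \<open>p\<close>, since a slightly larger \<open>a\<close> would still
  be admissible.\<close>

lemma
  assumes cont: "continuous_on UNIV g" and q: "q > 0"
  shows le_lock_end_iff: "a \<le> lock_end g q p \<longleftrightarrow> (\<exists>x. ((\<lambda>x. g x + a) ^^ q) x \<le> x + p)" (is "?A a")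
    and lock_end_ge: "x + p \<le> ((\<lambda>x. g x + lock_end g q p) ^^ q) x" (is "?B x")
    and lock_end_touch: "\<exists>x. ((\<lambda>x. g x + lock_end g q p) ^^ q) x = x + p" (is ?C)
proof -
  define N where "N = (\<lambda>a x. ((\<lambda>x. g x + a) ^^ q) x - x)"
  define S where "S = {a. \<exists>x. N a x \<le> p}"
  have S: "lock_end g q p = Sup S" unfolding lock_end_def S_def N_def by (simp add: algebra_simps)
  have Nmono: "N a x + (a' - a) \<le> N a' x" if "a \<le> a'" for a a' x
    using funpow_add_param[OF that q, of x] by (simp add: N_def)
  have Nper: "N a (x + of_int m) = N a x" for a x m
  proof -
    interpret A: deg_one_mono "\<lambda>x. g x + a" by (rule add_deg_one_mono)
    show ?thesis by (simp add: N_def A.funpow_int)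
  qed
  have contN: "continuous_on UNIV (\<lambda>(a, x). N a x)"
    using continuous_funpow_param[OF cont, of q] unfolding N_def case_prod_unfold
    by (intro continuous_on_diff continuous_on_snd continuous_on_id) auto
  have unit: "\<exists>y\<in>{0..1}. N a y = N a x" for a x
    using Nper[of a x "- \<lfloor>x\<rfloor>"] by (intro bexI[of _ "x + of_int (- \<lfloor>x\<rfloor>)"]) (auto, linarith)
  have contN1: "continuous_on A (N a)" for A a
  proof -
    have "continuous_on A (\<lambda>x. (\<lambda>(a, x). N a x) (a, x))"
      by (rule continuous_on_compose2[OF contN]) (auto intro: continuous_intros)
    then show ?thesis by simp
  qed
  have contN2: "continuous_on A (\<lambda>a. N a x)" for A x
  proof -
    have "continuous_on A (\<lambda>a. (\<lambda>(a, x). N a x) (a, x))"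
      by (rule continuous_on_compose2[OF contN]) (auto intro: continuous_intros)
    then show ?thesis by simp
  qed
  obtain lo where lo: "\<And>x. N 0 x \<ge> lo"
  proof -
    obtain y where "y \<in> {0..1}" "\<And>x. x \<in> {0..1} \<Longrightarrow> N 0 y \<le> N 0 x"
      using continuous_attains_inf[of "{0..1::real}" "N 0"] contN1 by auto
    then show ?thesis using that[of "N 0 y"] unit by metis
  qed
  have down: "a \<in> S" if aS: "a' \<in> S" "a \<le> a'" for a a'
  proof -
    obtain x where "N a' x \<le> p" using aS by (auto simp: S_def)
    then have "N a x \<le> p" using Nmono[OF aS(2), of x] aS(2) by simp
    then show ?thesis by (auto simp: S_def)
  qed
  have bdd: "bdd_above S"
  proof (rule bdd_aboveI)
    fix a assume "a \<in> S"
    then obtain x where "N a x \<le> p" by (auto simp: S_def)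
    then show "a \<le> max 0 (p - lo)" using Nmono[of 0 a x] lo[of x] by (cases "a \<ge> 0") auto
  qed
  have "min 0 (p - N 0 0) \<in> S"
    using Nmono[of "min 0 (p - N 0 0)" 0 0] by (auto simp: S_def intro!: exI[of _ 0])
  then have ne: "S \<noteq> {}" by auto
  have SupS: "Sup S \<in> S"
  proof -
    \<comment> \<open>Over a bounded range of \<open>a\<close> the admissible pairs form a compact
      set; its projection is closed and contains all \<open>a\<close> just below the
      supremum.\<close>
    define T where "T = ({Sup S - 1..Sup S} \<times> {0..1}) \<inter> {z. (\<lambda>(a, x). N a x) z \<le> p}"
    have "closed {z. (\<lambda>(a, x). N a x) z \<le> p}"
      using contN by (intro closed_Collect_le continuous_on_const)
    then have "compact T" unfolding T_def by (intro compact_Int_closed compact_Times) auto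
    then have "compact (fst ` T)" by (intro compact_continuous_image continuous_on_fst continuous_on_id)
    then have cl: "closed (fst ` T)" by (rule compact_imp_closed)
    have sub: "{Sup S - 1..<Sup S} \<subseteq> fst ` T"
    proof
      fix a assume a: "a \<in> {Sup S - 1..<Sup S}"
      then obtain a' where "a' \<in> S" "a < a'" using less_cSup_iff[OF ne bdd, of a] by auto
      then have "a \<in> S" using down[of a' a] by simp
      then obtain x where "N a x \<le> p" by (auto simp: S_def)
      then obtain y where "y \<in> {0..1}" "N a y \<le> p" using unit[of a x] by auto
      then have "(a, y) \<in> T" using a by (auto simp: T_def)
      then show "a \<in> fst ` T" by force
    qed
    have "Sup S \<in> closure {Sup S - 1..<Sup S}" by simp
    also have "\<dots> \<subseteq> fst ` T" using cl sub by (rule closure_minimal[rotated])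
    finally show ?thesis by (auto simp: T_def S_def)
  qed
  show A: "?A a" for a
  proof -
    have "a \<le> Sup S \<longleftrightarrow> a \<in> S" using down[OF SupS] cSup_upper[OF _ bdd] by blast
    then show ?thesis unfolding S unfolding S_def N_def by (simp add: algebra_simps)
  qed
  show B: "?B x" for x
  proof (rule ccontr)
    assume "\<not> ?thesis"
    then have lt: "N (Sup S) x < p" unfolding S by (simp add: N_def)
    have "isCont (\<lambda>a. N a x) (Sup S)"
      using contN2[of UNIV] by (simp add: continuous_on_eq_continuous_at)
    then obtain d where d: "d > 0" "\<And>a. dist a (Sup S) < d \<Longrightarrow> dist (N a x) (N (Sup S) x) < p - N (Sup S) x"
      unfolding continuous_at_eps_delta using lt by (metis diff_gt_0_iff_gt)
    have "N (Sup S + d / 2) x < p" using d(2)[of "Sup S + d / 2"] d(1) by (auto simp: dist_real_def)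
    then have "N (Sup S + d / 2) x \<le> p" by simp
    then have "Sup S + d / 2 \<in> S" unfolding S_def by blast
    then show False using cSup_upper[OF _ bdd] d(1) by fastforce
  qed
  show ?C
  proof -
    obtain x where "N (Sup S) x \<le> p" using SupS by (auto simp: S_def)
    then have "((\<lambda>x. g x + lock_end g q p) ^^ q) x \<le> x + p" unfolding S by (simp add: N_def)
    then show ?thesis using B[of x] by (intro exI[of _ x]) simp
  qed
qed

lemma neg_funpow: "((\<lambda>x. - g (- x) + (- a)) ^^ n) x = - (((\<lambda>x. g x + a) ^^ n) (- x))"
  by (induction n) auto

lemma
  assumes cont: "continuous_on UNIV g" and q: "q > 0"
  shows lock_start_le_iff: "lock_start g q p \<le> a \<longleftrightarrow> (\<exists>x. ((\<lambda>x. g x + a) ^^ q) x \<ge> x + p)" (is ?A)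
    and lock_start_le: "((\<lambda>x. g x + lock_start g q p) ^^ q) x \<le> x + p" (is ?B)
    and lock_start_touch: "\<exists>x. ((\<lambda>x. g x + lock_start g q p) ^^ q) x = x + p" (is ?C)
proof -
  interpret R: deg_one_mono "\<lambda>x. - g (- x)" by (rule neg_deg_one_mono)
  have c: "continuous_on UNIV (\<lambda>x. - g (- x))"
    by (intro continuous_on_minus continuous_on_compose2[OF cont]) (auto intro: continuous_intros)
  have "lock_start g q p \<le> a \<longleftrightarrow> - a \<le> lock_end (\<lambda>x. - g (- x)) q (- p)"
    by (auto simp: lock_start_def)
  also have "\<dots> \<longleftrightarrow> (\<exists>x. - (((\<lambda>x. g x + a) ^^ q) (- x)) \<le> x + - p)"
    unfolding R.le_lock_end_iff[OF c q] neg_funpow ..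
  also have "\<dots> \<longleftrightarrow> (\<exists>x. - (((\<lambda>x. g x + a) ^^ q) x) \<le> - x + - p)"
    by (metis minus_minus)
  finally show ?A by (simp add: algebra_simps)
  have e: "lock_end (\<lambda>x. - g (- x)) q (- p) = - lock_start g q p" by (simp add: lock_start_def)
  show ?B using R.lock_end_ge[OF c q, of "- x" "- p"] unfolding e neg_funpow by simp
  obtain x where "((\<lambda>x. - g (- x) + - lock_start g q p) ^^ q) x = x + - p"
    using R.lock_end_touch[OF c q, of "- p"] unfolding e by blast
  then show ?C unfolding neg_funpow by (intro exI[of _ "- x"]) simp
qed

text \<open>Raising \<open>a\<close> by \<open>1\<close> adds \<open>1\<close> in each of the
  \<open>q\<close> steps. This later carries the unlocking of \<open>1/1\<close> over to
  \<open>0/1\<close>.\<close>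

lemma lock_end_shift:
  assumes cont: "continuous_on UNIV g" and q: "q > 0"
  shows "lock_end g q (p + real q) = lock_end g q p + 1"
proof -
  have shift: "((\<lambda>x. g x + (a + 1)) ^^ n) x = ((\<lambda>x. g x + a) ^^ n) x + real n" for a n x
  proof (induction n)
    case (Suc n)
    then show ?case using funpow_nat[of 1 _ n] by simp
  qed simp
  have "a \<le> lock_end g q p \<longleftrightarrow> a + 1 \<le> lock_end g q (p + real q)" for a
    unfolding le_lock_end_iff[OF assms] shift by (simp add: add.assoc[symmetric])
  from this[of "lock_end g q p"] this[of "lock_end g q (p + real q) - 1"] show ?thesis by simp
qed

lemma lock_start_shift:
  assumes cont: "continuous_on UNIV g" and q: "q > 0"
  shows "lock_start g q (p + real q) = lock_start g q p + 1"
proof -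
  interpret R: deg_one_mono "\<lambda>x. - g (- x)" by (rule neg_deg_one_mono)
  have c: "continuous_on UNIV (\<lambda>x. - g (- x))"
    by (intro continuous_on_minus continuous_on_compose2[OF cont]) (auto intro: continuous_intros)
  show ?thesis using R.lock_end_shift[OF c q, of "- p - real q"] by (simp add: lock_start_def)
qed

end

text \<open>A pointwise change of the map by at most \<open>e\<close> is compensated by a change of
  \<open>a\<close> by \<open>e\<close>. With both signs this makes the ends of the locking interval
  Lipschitz in the uniform norm.\<close>

lemma lock_end_perturb:
  assumes g: "deg_one_mono g" "continuous_on UNIV g" and h: "deg_one_mono h" "continuous_on UNIV h"
    and q: "q > 0" and le: "\<And>x. g x \<le> h x + e"
  shows "lock_end h q p - e \<le> lock_end g q p"
proof -
  obtain x where x: "((\<lambda>x. h x + lock_end h q p) ^^ q) x = x + p"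
    using deg_one_mono.lock_end_touch[OF h q] by blast
  have "((\<lambda>x. g x + (lock_end h q p - e)) ^^ q) x \<le> ((\<lambda>x. h x + lock_end h q p) ^^ q) x"
    by (rule funpow_le_funpow[OF deg_one_mono.mono[OF deg_one_mono.add_deg_one_mono[OF h(1)]]])
       (use le in \<open>auto simp: algebra_simps\<close>)
  then show ?thesis unfolding deg_one_mono.le_lock_end_iff[OF g q] using x by auto
qed

lemma lock_start_perturb:
  assumes g: "deg_one_mono g" "continuous_on UNIV g" and h: "deg_one_mono h" "continuous_on UNIV h"
    and q: "q > 0" and le: "\<And>x. h x \<le> g x + e"
  shows "lock_start g q p \<le> lock_start h q p + e"
proof -
  obtain x where x: "((\<lambda>x. h x + lock_start h q p) ^^ q) x = x + p"
    using deg_one_mono.lock_start_touch[OF h q] by blast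
  have "((\<lambda>x. h x + lock_start h q p) ^^ q) x \<le> ((\<lambda>x. g x + (lock_start h q p + e)) ^^ q) x"
    by (rule funpow_le_funpow[OF deg_one_mono.mono[OF deg_one_mono.add_deg_one_mono[OF g(1)]]])
       (use le in \<open>auto simp: algebra_simps\<close>)
  then show ?thesis unfolding deg_one_mono.lock_start_le_iff[OF g q] using x by auto
qed

section \<open>Rotation sets\<close>

text \<open>The supremum is attained strictly to the left of \<open>z\<close>, and \<open>f\<close>
  stays below it near \<open>z\<close>.\<close>

lemma upper_bound_locally_const:
  assumes f: "degree_one_lift f" and lt: "f z < upper_bound f z"
  shows "eventually (\<lambda>w. upper_bound f w = upper_bound f z) (nhds z)"
proof -
  obtain y where y: "y \<le> z" "upper_bound f z = f y" "\<And>v. v \<le> z \<Longrightarrow> f v \<le> f y"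
    using upper_bound_attained[OF f, of z] by metis
  have yz: "y < z" using y lt by (cases "y = z") auto
  have "open {w. f w < f y}" using lift_cont[OF f, of UNIV] by (intro open_Collect_less continuous_on_const)
  then obtain d where d: "d > 0" "ball z d \<subseteq> {w. f w < f y}"
    using lt y by (metis (no_types, lifting) mem_Collect_eq open_contains_ball)
  have "eventually (\<lambda>w. w \<in> ball z (min d (z - y))) (nhds z)"
    using d yz by (intro eventually_nhds_in_open) auto
  then show ?thesis
  proof eventually_elim
    case (elim w)
    have "upper_bound f w = f y"
    proof (rule upper_bound_eqI)
      show "y \<le> w" using elim by (auto simp: dist_real_def)
      fix v assume "v \<le> w"
      show "f v \<le> f y"
      proof (cases "v \<le> z")
        case False
        then have "v \<in> ball z d" using elim \<open>v \<le> w\<close> by (auto simp: dist_real_def)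
        then show ?thesis using d by (auto intro: less_imp_le)
      qed (use y in auto)
    qed
    then show ?case using y by simp
  qed
qed

text \<open>If \<open>f^k\<close> and \<open>G^k\<close> agreed nowhere, \<open>G^k\<close> would be locally constant.\<close>

lemma exists_common_orbit:
  assumes f: "degree_one_lift f"
  shows "\<exists>x. (f ^^ k) x = (upper_bound f ^^ k) x"
proof (rule ccontr)
  let ?G = "upper_bound f"
  interpret deg_one_mono ?G by (rule deg_one_mono_upper[OF f])
  assume no: "\<not> ?thesis"
  have "eventually (\<lambda>w. (?G ^^ k) x = (?G ^^ k) w) (at x within UNIV)" for x
  proof -
    obtain i where i: "i < k" "?G ((?G ^^ i) x) \<noteq> f ((?G ^^ i) x)"
    proof (rule ccontr)
      assume "\<not> thesis"
      then have "\<And>i. i < k \<Longrightarrow> ?G ((?G ^^ i) x) = f ((?G ^^ i) x)" using that by blast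
      then have "(f ^^ n) x = (?G ^^ n) x" if "n \<le> k" for n using that by (induction n) auto
      then show False using no by blast
    qed
    have "f ((?G ^^ i) x) < ?G ((?G ^^ i) x)"
      using i(2) upper_bound_ge[OF f, of "(?G ^^ i) x" "(?G ^^ i) x"] by simp
    from upper_bound_locally_const[OF f this]
    have ev: "eventually (\<lambda>w. ?G w = ?G ((?G ^^ i) x)) (nhds ((?G ^^ i) x))" .
    have "((?G ^^ i) \<longlongrightarrow> (?G ^^ i) x) (at x)"
      using continuous_funpow[OF continuous_upper_bound[OF f], of i]
      by (simp add: continuous_on_eq_continuous_at isCont_def)
    then have "eventually (\<lambda>w. ?G ((?G ^^ i) w) = ?G ((?G ^^ i) x)) (at x)"
      using ev by (auto simp: filterlim_iff)
    then show ?thesis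
    proof eventually_elim
      case (elim w)
      have k: "k = (k - Suc i) + Suc i" using i by simp
      have "(?G ^^ k) v = (?G ^^ (k - Suc i)) (?G ((?G ^^ i) v))" for v
        by (subst k, subst funpow_add) simp
      then show ?case using elim by simp
    qed
  qed
  then have "(?G ^^ k) 0 = (?G ^^ k) 1"
    using connected_local_const[of UNIV "0::real" 1 "?G ^^ k"] by auto
  then show False using funpow_nat[of k 0 1] by simp
qed

lemma linear_growth_limit:
  assumes "\<And>n. \<bar>u n - real n * c\<bar> \<le> B"
  shows "(\<lambda>n. (u n - z) / real n) \<longlonglongrightarrow> c"
proof -
  have "(\<lambda>n. (u n - z) / real n - c) \<longlonglongrightarrow> 0"
  proof (rule Lim_null_comparison)
    show "eventually (\<lambda>n. norm ((u n - z) / real n - c) \<le> (B + \<bar>z\<bar>) / real n) sequentially"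
      using eventually_gt_at_top[of 0]
    proof eventually_elim
      case (elim n)
      then have "(u n - z) / real n - c = (u n - real n * c - z) / real n" by (simp add: field_simps)
      moreover have "\<bar>u n - real n * c - z\<bar> \<le> B + \<bar>z\<bar>" using assms[of n] by linarith
      ultimately show ?case by (simp add: divide_right_mono)
    qed
    show "(\<lambda>n. (B + \<bar>z\<bar>) / real n) \<longlonglongrightarrow> 0" by (rule lim_const_over_n)
  qed
  then show ?thesis by (simp add: LIM_zero_iff)
qed

context deg_one_mono
begin

text \<open>The orbit of \<open>x\<close> advances by at most \<open>p\<close> in each block of
  \<open>q\<close> steps, and any other orbit stays below an integer translate of it. The remaining
  steps, fewer than \<open>q\<close>, cost only a constant.\<close>

lemma funpow_upper_growth:
  assumes x: "(g ^^ q) x \<le> x + of_int p" and q: "q > 0"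
  obtains B where "\<And>n. (g ^^ n) z \<le> real n * (of_int p / real q) + B"
proof -
  define M where "M = \<lceil>z - x\<rceil>"
  have k: "(g ^^ (k * q)) x \<le> x + of_int (int k * p)" for k
  proof (induction k)
    case (Suc k)
    have "(g ^^ (Suc k * q)) x = (g ^^ (k * q)) ((g ^^ q) x)"
      unfolding mult_Suc add.commute[of q "k * q"] funpow_add by simp
    also have "\<dots> \<le> (g ^^ (k * q)) (x + of_int p)" using x by (rule funpow_mono')
    also have "\<dots> \<le> x + of_int (int (Suc k) * p)" unfolding funpow_int using Suc by (simp add: algebra_simps)
    finally show ?case .
  qed simp
  define B where "B = Max ((\<lambda>r. (g ^^ r) x) ` {..<q})"
  have "(g ^^ n) z \<le> real n * (of_int p / real q) + (B + \<bar>of_int p\<bar> + of_int M)" for n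
  proof -
    define r k where "r = n mod q" and "k = n div q"
    have n: "n = r + k * q" and r: "r < q" using q by (simp_all add: r_def k_def)
    have "(g ^^ n) z \<le> (g ^^ n) (x + of_int M)"
      by (rule funpow_mono') (simp add: M_def, linarith)
    also have "\<dots> = (g ^^ r) ((g ^^ (k * q)) x) + of_int M" by (simp add: n funpow_add funpow_int)
    also have "(g ^^ r) ((g ^^ (k * q)) x) \<le> (g ^^ r) (x + of_int (int k * p))"
      using k[of k] by (rule funpow_mono')
    also have "\<dots> = (g ^^ r) x + of_int (int k * p)" by (rule funpow_int)
    also have "(g ^^ r) x \<le> B" unfolding B_def using r by (intro Max_ge) auto
    also have "of_int (int k * p) \<le> real n * (of_int p / real q) + \<bar>of_int p\<bar>"
    proof -
      have "real n * (of_int p / real q) = real r / real q * of_int p + of_int (int k * p)"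
        unfolding n using q by (simp add: field_simps)
      moreover have "\<bar>real r / real q * of_int p\<bar> \<le> 1 * \<bar>of_int p\<bar>"
        unfolding abs_mult using r by (intro mult_right_mono) auto
      ultimately show ?thesis by linarith
    qed
    finally show ?thesis by simp
  qed
  then show ?thesis using that by blast
qed

lemma funpow_lower_growth:
  assumes x: "(g ^^ q) x \<ge> x + of_int p" and q: "q > 0"
  obtains B where "\<And>n. (g ^^ n) z \<ge> real n * (of_int p / real q) + B"
proof -
  interpret R: deg_one_mono "\<lambda>x. - g (- x)" by (rule neg_deg_one_mono)
  have e: "((\<lambda>x. - g (- x)) ^^ n) x = - (g ^^ n) (- x)" for n x by (induction n) auto
  obtain B where B: "\<And>n. ((\<lambda>x. - g (- x)) ^^ n) (- z) \<le> real n * (of_int (- p) / real q) + B"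
    using R.funpow_upper_growth[of q "- x" "- p" "- z"] x q by (auto simp: e)
  have "(g ^^ n) z \<ge> real n * (of_int p / real q) + - B" for n using B[of n] by (simp add: e)
  then show ?thesis by (rule that)
qed

end

lemma Rot_eq_singletonI:
  assumes f: "degree_one_lift f" and q: "q > 0"
    and G: "(upper_bound f ^^ q) x \<le> x + real p" and H: "(lower_bound f ^^ q) y \<ge> y + real p"
  shows "Rot f = {real p / real q}"
proof -
  interpret G: deg_one_mono "upper_bound f" by (rule deg_one_mono_upper[OF f])
  interpret H: deg_one_mono "lower_bound f" by (rule deg_one_mono_lower[OF f])
  have lim: "(\<lambda>n. ((f ^^ n) z - z) / real n) \<longlonglongrightarrow> real p / real q" for z
  proof -
    obtain B1 where B1: "\<And>n. (upper_bound f ^^ n) z \<le> real n * (real p / real q) + B1"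
      using G.funpow_upper_growth[of q x "int p" z] G q by auto
    obtain B2 where B2: "\<And>n. (lower_bound f ^^ n) z \<ge> real n * (real p / real q) + B2"
      using H.funpow_lower_growth[of y "int p" q z] H q by auto
    show ?thesis
    proof (rule linear_growth_limit)
      fix n
      have "(f ^^ n) z \<le> (upper_bound f ^^ n) z"
        by (rule funpow_le_funpow[OF G.mono upper_bound_ge[OF f order_refl] order_refl])
      moreover have "(lower_bound f ^^ n) z \<le> (f ^^ n) z"
        by (rule funpow_le_funpow'[OF H.mono lower_bound_le[OF f order_refl] order_refl])
      ultimately show "\<bar>(f ^^ n) z - real n * (real p / real q)\<bar> \<le> max \<bar>B1\<bar> \<bar>B2\<bar>"
        using B1[of n] B2[of n] by linarith
    qed
  qed
  show ?thesis
  proof (intro set_eqI iffI)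
    fix \<rho> assume "\<rho> \<in> Rot f"
    then obtain z where "(\<lambda>n. ((f ^^ n) z - z) / real n) \<longlonglongrightarrow> \<rho>" by (auto simp: Rot_def)
    then show "\<rho> \<in> {real p / real q}" using LIMSEQ_unique[OF _ lim[of z]] by simp
  next
    fix \<rho> assume "\<rho> \<in> {real p / real q}"
    then show "\<rho> \<in> Rot f" using lim by (auto simp: Rot_def)
  qed
qed

lemma periodic_in_Rot:
  assumes f: "degree_one_lift f" and Q: "Q > 0" and v: "(f ^^ Q) v = v + real P"
  shows "real P / real Q \<in> Rot f"
proof -
  have deg: "(f ^^ n) (x + real m) = (f ^^ n) x + real m" for n x m
    using deg_one_funpow[of f n x "int m", OF lift_deg[OF f]] by simp
  have k: "(f ^^ (k * Q)) v = v + real (k * P)" for k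
  proof (induction k)
    case (Suc k)
    have "(f ^^ (Suc k * Q)) v = (f ^^ (k * Q)) ((f ^^ Q) v)"
      unfolding mult_Suc add.commute[of Q "k * Q"] funpow_add by simp
    then show ?case unfolding v deg using Suc by (simp add: algebra_simps)
  qed simp
  define B where "B = Max ((\<lambda>r. \<bar>(f ^^ r) v\<bar>) ` {..<Q})"
  have "(\<lambda>n. ((f ^^ n) v - v) / real n) \<longlonglongrightarrow> real P / real Q"
  proof (rule linear_growth_limit)
    fix n
    define r k where "r = n mod Q" and "k = n div Q"
    have n: "n = r + k * Q" and r: "r < Q" using Q by (simp_all add: r_def k_def)
    have "(f ^^ n) v = (f ^^ r) v + real (k * P)" unfolding n funpow_add using k[of k] deg[of r v "k * P"] by simp
    moreover have "real n * (real P / real Q) = real r * (real P / real Q) + real (k * P)"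
      unfolding n using Q by (simp add: field_simps)
    moreover have "\<bar>(f ^^ r) v\<bar> \<le> B" unfolding B_def using r by (intro Max_ge) auto
    moreover have "0 \<le> real r * (real P / real Q)" by simp
    moreover have "real r * (real P / real Q) \<le> real P"
    proof -
      have "real r * (real P / real Q) \<le> real Q * (real P / real Q)" using r by (intro mult_right_mono) auto
      then show ?thesis using Q by simp
    qed
    ultimately show "\<bar>(f ^^ n) v - real n * (real P / real Q)\<bar> \<le> B + real P" by linarith
  qed
  then show ?thesis by (auto simp: Rot_def)
qed

text \<open>Suppose \<open>G^q\<close> advanced every point by more than \<open>p\<close>. By
  compactness the excess is bounded below, so some \<open>G^Q\<close> advances every point by more
  than \<open>P\<close>, where \<open>P / Q > p / q\<close>. A common orbit transfers this to
  \<open>f^Q\<close> at one point. Then either \<open>f^Q\<close> advances every point by at least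
  \<open>P\<close>, or the intermediate value theorem yields a point that advances by exactly
  \<open>P\<close>; both contradict the rotation set \<open>{p / q}\<close>.\<close>

lemma upper_bound_of_Rot:
  assumes f: "degree_one_lift f" and q: "q > 0" and Rot: "Rot f = {real p / real q}"
  shows "\<exists>x. (upper_bound f ^^ q) x \<le> x + real p"
proof (rule ccontr)
  let ?G = "upper_bound f"
  interpret G: deg_one_mono ?G by (rule deg_one_mono_upper[OF f])
  assume "\<not> ?thesis"
  then have gt: "(?G ^^ q) x > x + real p" for x by (simp add: not_le)
  have cont: "continuous_on A (\<lambda>x. (?G ^^ q) x - x)" for A
    using continuous_on_subset[OF continuous_funpow[OF continuous_upper_bound[OF f], of q]]
    by (intro continuous_on_diff continuous_on_id) auto
  have "\<exists>y\<in>{0..1}. \<forall>x\<in>{0..1}. (?G ^^ q) y - y \<le> (?G ^^ q) x - x"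
    by (rule continuous_attains_inf[OF compact_Icc _ cont]) simp
  then obtain y where y: "\<And>x. x \<in> {0..1} \<Longrightarrow> (?G ^^ q) y - y \<le> (?G ^^ q) x - x" by blast
  define \<delta> where "\<delta> = (?G ^^ q) y - y - real p"
  have \<delta>: "\<delta> > 0" using gt[of y] by (simp add: \<delta>_def)
  have ge: "x + (real p + \<delta>) \<le> (?G ^^ q) x" for x
  proof -
    have "(?G ^^ q) (x + of_int (- \<lfloor>x\<rfloor>)) - (x + of_int (- \<lfloor>x\<rfloor>)) = (?G ^^ q) x - x"
      unfolding G.funpow_int by simp
    moreover have "x + of_int (- \<lfloor>x\<rfloor>) \<in> {0..1}" by (auto, linarith)
    ultimately show ?thesis using y[of "x + of_int (- \<lfloor>x\<rfloor>)"] by (simp add: \<delta>_def)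
  qed
  obtain N where N: "real N * \<delta> > 1" using reals_Archimedean3[OF \<delta>] by blast
  then have N0: "N > 0" by (cases N) auto
  define Q P where "Q = N * q" and "P = N * p + 1"
  have Q0: "Q > 0" using N0 q by (simp add: Q_def)
  have GP: "(?G ^^ Q) x > x + real P" for x
    using G.funpow_mult_ge[OF ge, of x N] N by (simp add: Q_def P_def algebra_simps)
  obtain a where a: "(f ^^ Q) a > a + real P" using exists_common_orbit[OF f, of Q] GP by metis
  have "\<exists>b. (f ^^ Q) b < b + real P"
  proof (rule ccontr)
    assume "\<not> ?thesis"
    then have ge: "(f ^^ Q) b \<ge> b + real P" for b by (simp add: not_less)
    have k: "(f ^^ (k * Q)) b \<ge> b + real (k * P)" for k b
    proof (induction k)
      case (Suc k)
      have "(f ^^ (Suc k * Q)) b = (f ^^ Q) ((f ^^ (k * Q)) b)" by (simp add: funpow_add)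
      then show ?case using ge[of "(f ^^ (k * Q)) b"] Suc by simp
    qed simp
    have "real p / real q \<in> Rot f" using Rot by simp
    then obtain z where "(\<lambda>n. ((f ^^ n) z - z) / real n) \<longlonglongrightarrow> real p / real q"
      by (auto simp: Rot_def)
    moreover have "strict_mono (\<lambda>k. k * Q)" using Q0 by (simp add: strict_mono_def)
    ultimately have "(\<lambda>k. ((f ^^ (k * Q)) z - z) / real (k * Q)) \<longlonglongrightarrow> real p / real q"
      using LIMSEQ_subseq_LIMSEQ[of "\<lambda>n. ((f ^^ n) z - z) / real n" _ "\<lambda>k. k * Q"] by (simp add: o_def)
    moreover have "((f ^^ (k * Q)) z - z) / real (k * Q) \<ge> real P / real Q" if "k \<ge> 1" for k
    proof -
      have "real P / real Q = real (k * P) / real (k * Q)" using that by simp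
      also have "\<dots> \<le> ((f ^^ (k * Q)) z - z) / real (k * Q)"
        using k[where k = k and b = z] by (intro divide_right_mono) auto
      finally show ?thesis .
    qed
    ultimately have "real P / real Q \<le> real p / real q"
      by (intro LIMSEQ_le_const) auto
    then show False using N0 q by (simp add: P_def Q_def field_simps)
  qed
  then obtain b where b: "(f ^^ Q) b < b + real P" by blast
  have "continuous_on UNIV (\<lambda>x. (f ^^ Q) x - x)"
    by (intro continuous_on_diff continuous_on_id continuous_funpow lift_cont[OF f])
  then obtain v where "(f ^^ Q) v - v = real P"
    by (rule IVT_unordered[of "\<lambda>x. (f ^^ Q) x - x" b "real P" a]) (use a b in \<open>auto intro: that\<close>)
  then have "real P / real Q \<in> Rot f" by (intro periodic_in_Rot[OF f Q0, of v]) simp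
  then have "real P / real Q = real p / real q" using Rot by simp
  then show False using N0 q by (simp add: P_def Q_def field_simps)
qed

lemma Rot_rfl:
  assumes f: "degree_one_lift f" and Rot: "Rot f = {\<rho>}" shows "Rot (rfl f) = {1 - \<rho>}"
proof -
  have sub: "1 - \<sigma> \<in> Rot (rfl f)" if f: "degree_one_lift f" and \<sigma>: "\<sigma> \<in> Rot f" for f \<sigma>
  proof -
    obtain z where z: "(\<lambda>n. ((f ^^ n) z - z) / real n) \<longlonglongrightarrow> \<sigma>" using \<sigma> by (auto simp: Rot_def)
    have "(\<lambda>n. 1 - ((f ^^ n) z - z) / real n) \<longlonglongrightarrow> 1 - \<sigma>"
      by (intro tendsto_diff tendsto_const z)
    moreover have "eventually (\<lambda>n. 1 - ((f ^^ n) z - z) / real n = ((rfl f ^^ n) (- z) - (- z)) / real n) sequentially"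
      using eventually_gt_at_top[of 0]
      by eventually_elim (simp add: rfl_funpow lift_deg[OF f] field_simps)
    ultimately have "(\<lambda>n. ((rfl f ^^ n) (- z) - (- z)) / real n) \<longlonglongrightarrow> 1 - \<sigma>"
      by (rule Lim_transform_eventually)
    then show ?thesis unfolding Rot_def by blast
  qed
  show ?thesis
  proof (intro set_eqI iffI)
    fix \<sigma> assume "\<sigma> \<in> Rot (rfl f)"
    then have "1 - \<sigma> \<in> Rot f" using sub[OF lift_rfl[OF f]] by simp
    then show "\<sigma> \<in> {1 - \<rho>}" using Rot by auto
  qed (use sub[OF f, of \<rho>] Rot in auto)
qed

lemma lower_bound_of_Rot:
  assumes f: "degree_one_lift f" and q: "q > 0" and pq: "p \<le> q" and Rot: "Rot f = {real p / real q}"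
  shows "\<exists>x. (lower_bound f ^^ q) x \<ge> x + real p"
proof -
  interpret H: deg_one_mono "lower_bound f" by (rule deg_one_mono_lower[OF f])
  have "Rot (rfl f) = {real (q - p) / real q}"
    using Rot_rfl[OF f Rot] q pq by (simp add: of_nat_diff field_simps)
  then obtain x where "(upper_bound (rfl f) ^^ q) x \<le> x + real (q - p)"
    using upper_bound_of_Rot[OF lift_rfl[OF f] q] by blast
  then show ?thesis
    unfolding upper_bound_rfl[OF f] rfl_funpow[of "lower_bound f", OF H.deg] using pq
    by (intro exI[of _ "- x"]) (simp add: of_nat_diff)
qed

lemma Rot_eq_iff:
  assumes f: "degree_one_lift f" and q: "q > 0" and pq: "p \<le> q"
  shows "Rot (\<lambda>x. f x + a) = {real p / real q} \<longleftrightarrow>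
    lock_start (lower_bound f) q (real p) \<le> a \<and> a \<le> lock_end (upper_bound f) q (real p)"
proof -
  have fa: "degree_one_lift (\<lambda>x. f x + a)" by (rule lift_add[OF f])
  have U: "upper_bound (\<lambda>x. f x + a) = (\<lambda>x. upper_bound f x + a)"
    and L: "lower_bound (\<lambda>x. f x + a) = (\<lambda>x. lower_bound f x + a)"
    using upper_bound_add[OF f] lower_bound_add[OF f] by auto
  interpret G: deg_one_mono "upper_bound f" by (rule deg_one_mono_upper[OF f])
  interpret H: deg_one_mono "lower_bound f" by (rule deg_one_mono_lower[OF f])
  show ?thesis
    unfolding G.le_lock_end_iff[OF continuous_upper_bound[OF f] q]
      H.lock_start_le_iff[OF continuous_lower_bound[OF f] q] U[symmetric] L[symmetric]
    using Rot_eq_singletonI[OF fa q] upper_bound_of_Rot[OF fa q] lower_bound_of_Rot[OF fa q pq] by blast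
qed

section \<open>Bimodal lifts\<close>

text \<open>\<open>Km\<close> and \<open>Cp\<close> are the points \<open>K\<^sup>-\<close> and \<open>C\<^sup>+\<close>.\<close>

locale bimodal =
  fixes f :: "real \<Rightarrow> real" and C K Km Cp :: real
  assumes lift: "degree_one_lift f"
    and order: "K - 1 < Km" "Km < C" "C < K" "K < Cp" "Cp < C + 1"
    and fKm: "f Km = f K" and fCp: "f Cp = f C"
    and dec: "\<And>x y. C \<le> x \<Longrightarrow> x < y \<Longrightarrow> y \<le> K \<Longrightarrow> f y < f x"
    and cr: "cr_expanding {K..C + 1} f"
begin

abbreviation "G \<equiv> upper_bound f"
abbreviation "H \<equiv> lower_bound f"

sublocale Gm: deg_one_mono G using deg_one_mono_upper[OF lift] .
sublocale Hm: deg_one_mono H using deg_one_mono_lower[OF lift] .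

lemma inc: "K \<le> x \<Longrightarrow> x < y \<Longrightarrow> y \<le> C + 1 \<Longrightarrow> f x < f y"
  using cr_expanding_mono[OF cr] by (auto simp: strict_mono_on_def)

lemma f_int: "f (x + of_int m) = f x + of_int m"
  by (rule lift_int[OF lift])

lemma f_nat: "f (x + real m) = f x + real m"
  using f_int[of x "int m"] by simp

lemma f_le_fC: assumes "z \<le> Cp" shows "f z \<le> f C"
proof -
  have main: "f z \<le> f C" if z: "K - 1 \<le> z" "z \<le> Cp" for z
  proof -
    consider "z < C" | "z = C" | "C < z" "z \<le> K" | "K < z" "z < Cp" | "z = Cp" using z by linarith
    then show ?thesis
    proof cases
      case 1
      then have "f (z + 1) < f (C + 1)" using z by (intro inc) auto
      then show ?thesis using f_nat[of z 1] f_nat[of C 1] by simp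
    next
      case 3 then show ?thesis using dec[of C z] by simp
    next
      case 4 then show ?thesis using inc[of z Cp] order fCp by simp
    qed (use fCp in auto)
  qed
  show ?thesis
  proof (cases "K - 1 \<le> z")
    case False
    then obtain s where s: "K - 1 < s" "s \<le> K" "f z \<le> f s"
      using lift_dominated[OF lift, of z K] by (smt (verit))
    then show ?thesis using main[of s] order by linarith
  qed (use main assms in auto)
qed

lemma G_flat: "C \<le> x \<Longrightarrow> x \<le> Cp \<Longrightarrow> G x = f C"
  by (rule upper_bound_eqI) (auto intro: f_le_fC)

lemma G_inc0: assumes "Cp \<le> x" "x \<le> C + 1" shows "G x = f x"
proof (rule upper_bound_eqI)
  fix z assume "z \<le> x"
  have Cpx: "f Cp \<le> f x" using assms inc[of Cp x] order by (cases "Cp = x") auto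
  show "f z \<le> f x"
  proof (cases "z \<le> Cp")
    case True then show ?thesis using f_le_fC[of z] fCp Cpx by simp
  next
    case False then show ?thesis using inc[of z x] order \<open>z \<le> x\<close> assms by (cases "z = x") auto
  qed
qed simp

lemma G_inc: assumes "Cp + real m \<le> x" "x \<le> C + 1 + real m" shows "G x = f x"
  using G_inc0[of "x - real m"] assms Gm.funpow_nat_diff[of 1 x m] f_int[of x "- int m"] by simp

text \<open>Maximum and minimum change places, and so do \<open>G\<close> and \<open>H\<close>;
  statements about one bound thus give those about the other.\<close>

lemma bimodal_rfl: "bimodal (rfl f) (- K) (- C) (- Cp) (- Km)"
proof
  show "degree_one_lift (rfl f)" by (rule lift_rfl[OF lift])
  show "rfl f y < rfl f x" if "- K \<le> x" "x < y" "y \<le> - C" for x y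
    using dec[of "- y" "- x"] that by (simp add: rfl_def)
  \<comment> \<open>Negation sends \<open>[- C, 1 - K]\<close> to \<open>[K - 1, C]\<close>; the
    added \<open>1\<close> brings this to the lap \<open>[K, C + 1]\<close> on which cross-ratios
    are controlled.\<close>
  have e: "rfl f z = 2 - f (1 - z)" for z using f_nat[of "- z" 1] by (simp add: rfl_def add.commute)
  have mem: "1 - z \<in> {K..C + 1}" if "z \<in> {- C..- K + 1}" for z using that by auto
  show "cr_expanding {- C..- K + 1} (rfl f)"
    unfolding cr_expanding_def
  proof (intro conjI ballI impI)
    show "strict_mono_on {- C..- K + 1} (rfl f)"
      unfolding strict_mono_on_def using inc by (auto simp: e)
    fix a b c d assume S: "a \<in> {- C..- K + 1}" "b \<in> {- C..- K + 1}" "c \<in> {- C..- K + 1}" "d \<in> {- C..- K + 1}"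
      and lt: "a < b" "b < c" "c < d"
    have "(1 - b - (1 - d)) * (1 - a - (1 - c)) * ((f (1 - c) - f (1 - d)) * (f (1 - a) - f (1 - b)))
       \<le> (f (1 - b) - f (1 - d)) * (f (1 - a) - f (1 - c)) * ((1 - c - (1 - d)) * (1 - a - (1 - b)))"
      using lt by (intro cr_expandingD[OF cr mem[OF S(4)] mem[OF S(3)] mem[OF S(2)] mem[OF S(1)]]) auto
    then show "(c - a) * (d - b) * ((rfl f b - rfl f a) * (rfl f d - rfl f c))
      \<le> (rfl f c - rfl f a) * (rfl f d - rfl f b) * ((b - a) * (d - c))"
      unfolding e by (simp add: mult.commute mult.left_commute)
  qed
qed (use order fKm fCp in \<open>auto simp: rfl_def\<close>)

lemma H_flat: assumes "Km \<le> x" "x \<le> K" shows "H x = f K"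
proof -
  interpret R: bimodal "rfl f" "- K" "- C" "- Cp" "- Km" by (rule bimodal_rfl)
  show ?thesis using R.G_flat[of "- x"] assms by (simp add: upper_bound_rfl[OF lift] rfl_def)
qed

lemma H_inc: assumes "K + real m \<le> x" "x \<le> Km + 1 + real m" shows "H x = f x"
proof -
  interpret R: bimodal "rfl f" "- K" "- C" "- Cp" "- Km" by (rule bimodal_rfl)
  have "upper_bound (rfl f) (- (x - real m) + 1) = rfl f (- (x - real m) + 1)"
    using R.G_inc0[of "- (x - real m) + 1"] assms by simp
  then have "H (x - real m - 1) = f (x - real m - 1)"
    by (simp add: upper_bound_rfl[OF lift] rfl_def add.commute algebra_simps)
  then show ?thesis
    using Hm.funpow_nat_diff[of 1 x "m + 1"] f_int[of x "- int (m + 1)"] by (simp add: algebra_simps)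
qed

lemma f_le_G: "f x \<le> G x" using upper_bound_ge[OF lift, of x x] by simp
lemma H_le_f: "H x \<le> f x" using lower_bound_le[OF lift, of x x] by simp

lemma H_le_G: "H x \<le> G x" using f_le_G H_le_f order_trans by blast

lemma funpow_f_le_G: "x \<le> y \<Longrightarrow> (f ^^ n) x \<le> (G ^^ n) y"
  by (rule funpow_le_funpow[OF Gm.mono f_le_G])
lemma funpow_H_le_f: "x \<le> y \<Longrightarrow> (H ^^ n) x \<le> (f ^^ n) y"
  by (rule funpow_le_funpow'[OF Hm.mono H_le_f])
lemma funpow_H_le_G: "x \<le> y \<Longrightarrow> (H ^^ n) x \<le> (G ^^ n) y"
  by (rule funpow_le_funpow[OF Gm.mono H_le_G])

lemma funpow_f_int: "(f ^^ n) (x + of_int m) = (f ^^ n) x + of_int m"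
  by (rule deg_one_funpow) (rule lift_deg[OF lift])

lemma funpow_f_nat: "(f ^^ n) (x + real m) = (f ^^ n) x + real m"
  using funpow_f_int[of n x "int m"] by simp

lemma funpow_eqI:
  assumes "\<And>i. i < n \<Longrightarrow> h ((h ^^ i) x) = f ((h ^^ i) x)"
  shows "(f ^^ n) x = (h ^^ n) x"
  using assms by (induction n) auto

lemma G_flat_funpow: "C \<le> x \<Longrightarrow> x \<le> Cp \<Longrightarrow> n > 0 \<Longrightarrow> (G ^^ n) x = (G ^^ n) Cp"
  using order by (cases n) (simp_all add: G_flat funpow_Suc_right del: funpow.simps(2))

lemma H_flat_funpow: "Km \<le> x \<Longrightarrow> x \<le> K \<Longrightarrow> n > 0 \<Longrightarrow> (H ^^ n) x = (H ^^ n) Km"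
  using order by (cases n) (simp_all add: H_flat funpow_Suc_right del: funpow.simps(2))

lemma cr_expanding_shift: "cr_expanding {K + of_int m..C + 1 + of_int m} f"
  unfolding cr_expanding_def
proof (intro conjI ballI impI)
  have e: "f z = f (z - of_int m) + of_int m" for z using f_int[of "z - of_int m" m] by simp
  have mem: "z - of_int m \<in> {K..C + 1}" if "z \<in> {K + of_int m..C + 1 + of_int m}" for z
    using that by auto
  show "strict_mono_on {K + of_int m..C + 1 + of_int m} f"
    unfolding strict_mono_on_def
  proof (intro allI impI)
    fix r s assume "r \<in> {K + of_int m..C + 1 + of_int m} \<and> s \<in> {K + of_int m..C + 1 + of_int m} \<and> r < s"
    then show "f r < f s" using inc[of "r - of_int m" "s - of_int m"] e[of r] e[of s] by auto
  qed
  fix a b c d assume S: "a \<in> {K + of_int m..C + 1 + of_int m}" "b \<in> {K + of_int m..C + 1 + of_int m}"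
      "c \<in> {K + of_int m..C + 1 + of_int m}" "d \<in> {K + of_int m..C + 1 + of_int m}"
    and lt: "a < b" "b < c" "c < d"
  show "(c - a) * (d - b) * ((f b - f a) * (f d - f c)) \<le> (f c - f a) * (f d - f b) * ((b - a) * (d - c))"
    using cr_expandingD[OF cr mem[OF S(1)] mem[OF S(2)] mem[OF S(3)] mem[OF S(4)]] lt
      e[of a] e[of b] e[of c] e[of d] by simp
qed

text \<open>Only the orbits of the two ends have to be watched. As long as the iterate is
  increasing, the image of the interval lies between the images of its ends, hence in one translate
  of the increasing lap.\<close>

lemma branch:
  assumes "\<And>i. i < n \<Longrightarrow> \<exists>m::int. K + of_int m \<le> (f ^^ i) \<alpha> \<and> (f ^^ i) \<beta> \<le> C + 1 + of_int m"
  shows "cr_expanding {\<alpha>..\<beta>} (f ^^ n)"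
  using assms
proof (induction n)
  case 0
  then show ?case using cr_expanding_id by (simp add: id_def)
next
  case (Suc n)
  have IH: "cr_expanding {\<alpha>..\<beta>} (f ^^ n)" using Suc by simp
  obtain m :: int where m: "K + of_int m \<le> (f ^^ n) \<alpha>" "(f ^^ n) \<beta> \<le> C + 1 + of_int m"
    using Suc.prems[of n] by auto
  have "(f ^^ n) ` {\<alpha>..\<beta>} \<subseteq> {K + of_int m..C + 1 + of_int m}"
  proof
    fix z assume "z \<in> (f ^^ n) ` {\<alpha>..\<beta>}"
    then obtain x where x: "x \<in> {\<alpha>..\<beta>}" "z = (f ^^ n) x" by auto
    have sm: "\<And>x y. x \<in> {\<alpha>..\<beta>} \<Longrightarrow> y \<in> {\<alpha>..\<beta>} \<Longrightarrow> x < y \<Longrightarrow> (f ^^ n) x < (f ^^ n) y"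
      using cr_expanding_mono[OF IH] by (simp add: strict_mono_on_def)
    have "(f ^^ n) \<alpha> \<le> z" using sm[of \<alpha> x] x by (cases "\<alpha> = x") auto
    moreover have "z \<le> (f ^^ n) \<beta>" using sm[of x \<beta>] x by (cases "\<beta> = x") auto
    ultimately show "z \<in> {K + of_int m..C + 1 + of_int m}" using m by simp
  qed
  from cr_expanding_compose[OF IH cr_expanding_shift this] show ?case by (simp add: o_def)
qed

lemma continuous_funpow_G: "continuous_on A (G ^^ n)"
  by (rule continuous_on_subset[OF continuous_funpow[OF continuous_upper_bound[OF lift]]]) simp

lemma continuous_funpow_H: "continuous_on A (H ^^ n)"
  by (rule continuous_on_subset[OF continuous_funpow[OF continuous_lower_bound[OF lift]]]) simp

end

text \<open>Read on an ordered periodic orbit: \<open>q2\<close> steps move the index back by one,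
  up to the integer \<open>p2\<close>, whereas \<open>q1\<close> steps move it forward by
  one.\<close>

lemma farey_complement:
  assumes "p * q1 = p1 * q + 1" "q = q1 + q2" "p = p1 + (p2 :: nat)" shows "q2 * p + 1 = p2 * q"
proof -
  have "p2 * q1 = p1 * q2 + 1" using assms by (simp add: algebra_simps)
  then show ?thesis unfolding assms by (simp add: algebra_simps)
qed

section \<open>Two configurations of periodic orbits that the cross-ratio pattern excludes\<close>

context bimodal
begin

text \<open>With \<open>x0 = G^q1 w - p1\<close> and \<open>y1 = H^q1 y - p1\<close>, the forbidden pattern for \<open>f^q\<close> occurs at
  \<open>K\<close>, \<open>y1\<close>, \<open>max x0 Cp\<close> and \<open>e\<close>, where \<open>e\<close> is a point to the right of \<open>x0\<close> with
  \<open>G^q2 e = C + p2\<close>.\<close>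

lemma no_early_right_neighbour:
  assumes farey: "p * q1 = p1 * q + 1" and q: "q = q1 + q2" and p: "p = p1 + p2"
    and HK: "(H ^^ q) Km \<le> Km + real p"
    and y: "(H ^^ q) y = y + real p" "y \<le> Km" "K < (H ^^ q1) y - real p1"
    and w: "(G ^^ q) w = w + real p" "w < C" "C \<le> (G ^^ q1) w - real p1"
    and y1: "(H ^^ q1) y - real p1 \<le> Cp"
      "(H ^^ q1) y - real p1 < max ((G ^^ q1) w - real p1) Cp"
  shows False
proof -
  interpret X: periodic_orbit G p q p1 q1 w by unfold_locales (use w farey in auto)
  interpret Y: periodic_orbit H p q p1 q1 y by unfold_locales (use y farey in auto)
  have x0: "(G ^^ q1) w - real p1 = X.W 1" using X.W_Suc[of 0] by simp
  have y1_eq: "(H ^^ q1) y - real p1 = Y.W 1" using Y.W_Suc[of 0] by simp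
  have y1K: "K < Y.W 1" and y1Cp: "Y.W 1 \<le> Cp" and y1c: "Y.W 1 < max (X.W 1) Cp"
    using y y1 by (simp_all add: x0 y1_eq)
  have wC: "C \<le> X.W 1" using w x0 by simp
  have Xq: "X.W q < C + 1" using X.W_add_q[of 0] w by simp
  have Yq: "Y.W q \<le> Km + 1" using Y.W_add_q[of 0] y by simp
  have q1: "q1 > 0" using farey by (cases q1) auto
  note q2p = farey_complement[OF farey q p]
  have q2q: "q2 < q" using q q1 by simp
  have p2pos: "p2 > 0" using q2p by (cases p2) auto
  have G2x: "(G ^^ q2) (X.W 1) = w + real p2"
  proof -
    have "1 + q2 * p = 0 + p2 * q" using q2p by simp
    then show ?thesis unfolding X.funpow_W using X.W_add_mult_q[of 0 p2] by simp
  qed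
  have G2x1: "(G ^^ q2) (X.W 2) = X.W 1 + real p2"
  proof -
    have "2 + q2 * p = 1 + p2 * q" using q2p by simp
    then show ?thesis unfolding X.funpow_W using X.W_add_mult_q[of 1 p2] by simp
  qed
  \<comment> \<open>\<open>G^q2\<close> moves indices back by one, so it sends \<open>X.W 1\<close>
    to a translate of \<open>w < C\<close>, and \<open>X.W 2\<close> to the same translate of
    \<open>X.W 1\<close>, which is at least \<open>C\<close>.\<close>
  obtain e where e: "X.W 1 \<le> e" "e \<le> X.W 2" "(G ^^ q2) e = C + real p2"
    using IVT'[of "G ^^ q2" "X.W 1" "C + real p2" "X.W 2"] G2x G2x1 w wC X.W_mono[of 1 2]
      continuous_funpow_G by auto
  have q_ge2: "q \<ge> 2" if "q2 > 0" using that q q1 by simp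
  \<comment> \<open>The degenerate case of an integer rotation number: the branch is
    \<open>f\<close> itself and \<open>e\<close> is the right end of the lap.\<close>
  have q2_0: "q = 1 \<and> p2 = 1 \<and> e = C + 1" if "q2 = 0"
    using that q2p e(3) by simp
  have eC1: "e \<le> C + 1"
    using q2_0 q_ge2 X.W_mono[of 2 q] e Xq by (cases "q2 = 0") auto
  have eCp: "Cp < e"
  proof (cases "q2 = 0")
    case True then show ?thesis using q2_0 order by simp
  next
    case False
    show ?thesis
    proof (rule ccontr)
      assume "\<not> Cp < e"
      then have le: "C \<le> e" "e \<le> Cp" "X.W 1 \<le> Cp" using e(1) wC by auto
      have "(G ^^ q2) e = (G ^^ q2) Cp" "(G ^^ q2) (X.W 1) = (G ^^ q2) Cp"
        by (rule G_flat_funpow; use le wC False in simp)+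
      then show False using e G2x w by simp
    qed
  qed
  have ex0: "X.W 1 < e"
    using e G2x w by (cases "X.W 1 = e") auto
  have X2: "X.W 2 > Cp"
  proof (rule ccontr)
    assume "\<not> ?thesis"
    then have "G (X.W 1) = f C" "G (X.W 2) = f C" using wC X.W_mono[of 1 2] by (auto intro!: G_flat)
    then show False using X.funpow_W[of 1 1] X.funpow_W[of 1 2] X.W_strict[of "1 + p" "2 + p"] by simp
  qed
  \<comment> \<open>The \<open>i\<close>-th image of \<open>e\<close> lies below the orbit point of
    index \<open>2 + j\<close>, up to \<open>m\<close>. Only \<open>i = q2\<close> gives
    \<open>j = q - 1\<close>, where this index exceeds \<open>q\<close>; at every other time
    \<open>2 + j\<close> is at most \<open>q\<close>.\<close>
  have upper: "(G ^^ i) e \<le> C + 1 + real m" if i: "i * p = j + m * q" "j < q" "i \<noteq> q2" "i < q" for i j m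
  proof -
    have "j + 1 \<noteq> q"
    proof
      assume "j + 1 = q"
      then have "i * p + 1 = (m + 1) * q" using i by simp
      then show False using X.index_unique(1)[OF _ q2p] i q2q by blast
    qed
    then have "2 + j \<le> q" using i by simp
    have "(G ^^ i) e \<le> (G ^^ i) (X.W 2)" using e by (intro Gm.funpow_mono')
    also have "\<dots> = X.W (2 + j) + real m"
      unfolding X.funpow_W using i X.W_add_mult_q[of "2 + j" m] by (simp add: add.assoc)
    also have "\<dots> \<le> X.W q + real m" using X.W_mono[OF \<open>2 + j \<le> q\<close>] by simp
    finally show ?thesis using Xq by simp
  qed
  have lower: "Y.W 1 + real m \<le> (H ^^ i) K" if i: "i * p = j + m * q" "1 \<le> j" for i j m
  proof -
    have "Y.W 1 + real m \<le> Y.W j + real m" using Y.W_mono i by simp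
    also have "\<dots> = Y.W (i * p)" using i Y.W_add_mult_q by simp
    also have "\<dots> = (H ^^ i) y" using Y.funpow_W[of i 0] by simp
    also have "\<dots> \<le> (H ^^ i) K" using y order by (intro Hm.funpow_mono') auto
    finally show ?thesis .
  qed
  have fG: "(f ^^ q2) e = (G ^^ q2) e"
  proof (rule funpow_eqI)
    fix i assume i: "i < q2"
    show "G ((G ^^ i) e) = f ((G ^^ i) e)"
    proof (cases "i = 0")
      case True then show ?thesis using G_inc0[of e] eCp eC1 by simp
    next
      case False
      then obtain j m where j: "i * p = j + m * q" "1 \<le> j" "j < q"
        using X.W_index[of i] i q2q by auto
      have "Cp + real m \<le> X.W (1 + j) + real m" using X2 X.W_mono[of 2 "1 + j"] j by simp
      also have "\<dots> = (G ^^ i) (X.W 1)"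
        unfolding X.funpow_W using j X.W_add_mult_q[of "1 + j" m] by (simp add: add.assoc)
      also have "\<dots> \<le> (G ^^ i) e" using e by (intro Gm.funpow_mono')
      finally show ?thesis using upper[OF j(1,3)] i q2q by (intro G_inc[of m]) auto
    qed
  qed
  have cr_e: "cr_expanding {K..e} (f ^^ q)"
  proof (rule branch)
    fix i assume i: "i < q"
    show "\<exists>m::int. K + of_int m \<le> (f ^^ i) K \<and> (f ^^ i) e \<le> C + 1 + of_int m"
    proof (cases "i = 0")
      case True then show ?thesis using eC1 by (intro exI[of _ 0]) simp
    next
      case False
      then obtain j m where j: "i * p = j + m * q" "1 \<le> j" "j < q"
        using X.W_index[of i] i by auto
      have "K + real m \<le> (f ^^ i) K"
        using lower[OF j(1,2)] y1K funpow_H_le_f[of K K i] by simp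
      moreover have "(f ^^ i) e \<le> C + 1 + real m"
      proof (cases "i = q2")
        case False
        then show ?thesis using upper[OF j(1,3) _ i] funpow_f_le_G[of e e i] by simp
      next
        case True
        \<comment> \<open>At the exceptional time the image of \<open>e\<close> is
          \<open>C + p2\<close>, which still belongs to the lap because \<open>p2\<close> is at most
          \<open>m + 1\<close>.\<close>
        have "j + m * q + 1 = p2 * q" using j True q2p by simp
        then have "p2 * q \<le> (m + 1) * q" using j by simp
        then have "p2 \<le> m + 1" using X.q_pos by (metis mult_le_cancel2)
        then show ?thesis using fG e True by simp
      qed
      ultimately show ?thesis by (intro exI[of _ "int m"]) simp
    qed
  qed
  have ce: "max (X.W 1) Cp < e" using ex0 eCp by simp
  have gK: "(f ^^ q) K < K + real p"
  proof -
    have "(f ^^ q) K = (H ^^ q) K"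
    proof (rule funpow_eqI)
      fix i assume i: "i < q"
      show "H ((H ^^ i) K) = f ((H ^^ i) K)"
      proof (cases "i = 0")
        case True then show ?thesis using H_inc[of 0 K] order by simp
      next
        case False
        then obtain j m where j: "i * p = j + m * q" "1 \<le> j" "j < q"
          using X.W_index[of i] i by auto
        have "(H ^^ i) K \<le> (H ^^ i) (Y.W 1)" using y1K by (intro Hm.funpow_mono') auto
        also have "\<dots> = Y.W (1 + j) + real m"
          unfolding Y.funpow_W using j Y.W_add_mult_q[of "1 + j" m] by (simp add: add.assoc)
        also have "\<dots> \<le> Km + 1 + real m" using Yq Y.W_mono[of "1 + j" q] j by simp
        finally show ?thesis using lower[OF j(1,2)] y1K by (intro H_inc[of m]) auto
      qed
    qed
    also have "\<dots> = (H ^^ q) Km" using order X.q_pos by (intro H_flat_funpow) auto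
    also have "\<dots> < K + real p" using HK order by simp
    finally show ?thesis .
  qed
  have gy: "(f ^^ q) (Y.W 1) \<ge> Y.W 1 + real p"
    using funpow_H_le_f[of "Y.W 1" "Y.W 1" q] Y.W_per[of 1] by simp
  have gc: "(f ^^ q) (max (X.W 1) Cp) \<le> max (X.W 1) Cp + real p"
  proof (cases "Cp \<le> X.W 1")
    case True
    then show ?thesis using funpow_f_le_G[of "X.W 1" "X.W 1" q] X.W_per[of 1] by (simp add: max_def)
  next
    case False
    then have "(G ^^ q) (X.W 1) = (G ^^ q) Cp" using wC X.q_pos by (intro G_flat_funpow) auto
    then show ?thesis using funpow_f_le_G[of Cp Cp q] X.W_per[of 1] False by (simp add: max_def)
  qed
  have ge: "(f ^^ q) e > e + real p"
  proof -
    \<comment> \<open>The orbit of \<open>e\<close> passes through a translate of \<open>C\<close>,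
      which has the same image as \<open>Cp\<close>. As \<open>Y.W 1\<close> is at most
      \<open>Cp\<close>, it ends at or beyond \<open>Y.W 2 + p\<close>. Moreover
      \<open>e < Y.W 2\<close>, because \<open>G^q2\<close> takes \<open>e\<close> to a translate of
      \<open>C\<close>, while \<open>H^q2\<close> takes \<open>Y.W 2\<close> to the same translate
      of \<open>Y.W 1 > K\<close>.\<close>
    have "Y.W 2 + real p = (H ^^ q1) (Y.W 1) + real p2" using Y.W_Suc[of 1] p by (simp add: numeral_2_eq_2)
    also have "\<dots> \<le> (f ^^ q1) Cp + real p2" using funpow_H_le_f[OF y1Cp] by simp
    also have "(f ^^ q1) Cp = (f ^^ q1) C"
      using q1 fCp by (cases q1) (simp_all add: funpow_Suc_right del: funpow.simps(2))
    also have "(f ^^ q1) C + real p2 = (f ^^ q1) (C + real p2)" by (simp add: funpow_f_nat)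
    also have "\<dots> = (f ^^ q) e" using fG e by (simp add: q funpow_add)
    finally have "Y.W 2 + real p \<le> (f ^^ q) e" .
    moreover have "e < Y.W 2"
    proof (rule ccontr)
      assume "\<not> ?thesis"
      then have "(H ^^ q2) (Y.W 2) \<le> (G ^^ q2) e" by (intro funpow_H_le_G) simp
      moreover have "(H ^^ q2) (Y.W 2) = Y.W 1 + real p2"
      proof -
        have "2 + q2 * p = 1 + p2 * q" using q2p by simp
        then show ?thesis unfolding Y.funpow_W using Y.W_add_mult_q[of 1 p2] by simp
      qed
      ultimately show False using e y1K order by simp
    qed
    ultimately show ?thesis by simp
  qed
  show False
    by (rule cr_expanding_no_pattern[OF cr_e _ _ _ _ y1K y1c ce gK gy gc ge]) (use y1K y1c ce in auto)
qed

text \<open>Here the pattern occurs at \<open>e\<close>, \<open>w + 1\<close>, \<open>Km + 1\<close> and \<open>C + 1\<close>, where \<open>e < w + 1\<close> satisfies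
  \<open>H^q1 e = K + p1 + 1\<close>.\<close>

lemma no_disjoint_orbit:
  assumes farey: "p * q1 = p1 * q + 1" and q: "q = q1 + q2" "q2 > 0" and p: "p = p1 + p2"
    and HK: "(H ^^ q) Km \<le> Km + real p" and GC: "(G ^^ q) Cp \<ge> Cp + real p"
    and w: "(G ^^ q) w = w + real p" "w < Km" "Cp \<le> (G ^^ q1) w - real p1"
  shows False
proof -
  interpret X: periodic_orbit G p q p1 q1 w by unfold_locales (use w farey in auto)
  have x0: "Cp \<le> X.W 1" using X.W_Suc[of 0] w by simp
  have Xq: "X.W q = w + 1" using X.W_add_q[of 0] by simp
  \<comment> \<open>Up to translation every orbit point has an index in \<open>1, ..., q\<close>,
    rather than \<open>0, ..., q - 1\<close>. These points lie between \<open>Cp\<close> and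
    \<open>Km + 1\<close>, where \<open>f\<close> coincides with both bounds.\<close>
  have HX: "H (X.W j) = G (X.W j)" for j
  proof -
    obtain i m where ij: "j + q = i + m * q" "1 \<le> i" "i \<le> q"
    proof (cases "j mod q = 0")
      case True
      then have "j + q = q + (j div q) * q" by (metis add.commute add_0 mod_div_decomp)
      then show ?thesis using that[of q] X.q_pos by auto
    next
      case False
      have "j + q = j mod q + (j div q + 1) * q" by simp
      then show ?thesis using that[of "j mod q" "j div q + 1"] False X.q_pos by (auto intro: less_imp_le)
    qed
    have W: "X.W j + 1 = X.W i + real m" using X.W_add_q[of j] ij X.W_add_mult_q[of i m] by simp
    have b: "Cp \<le> X.W i" "X.W i \<le> Km + 1" using X.W_mono[of 1 i] X.W_mono[of i q] ij x0 Xq w by auto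
    have "G (X.W i) = f (X.W i)" "H (X.W i) = f (X.W i)"
      using b order G_inc0[of "X.W i"] H_inc[of 0 "X.W i"] by auto
    then show ?thesis
      using Hm.funpow_nat[of 1 "X.W i" m] Gm.funpow_nat[of 1 "X.W i" m] Hm.deg[of "X.W j"] Gm.deg[of "X.W j"] W by simp
  qed
  have HGn: "(H ^^ n) w = (G ^^ n) w" for n
    by (induction n) (use X.funpow_W[of _ 0] HX in auto)
  interpret Y: periodic_orbit H p q p1 q1 w by unfold_locales (use w farey HGn in auto)
  have YX: "Y.W = X.W" by (simp add: fun_eq_iff X.W_def Y.W_def HGn)
  note funpow_HW = Y.funpow_W[unfolded YX]
  have q1: "q1 > 0" using farey by (cases q1) auto
  have q1q: "q1 < q" using q by simp
  have q2: "q \<ge> 2" using q q1 by simp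
  have HX1: "(H ^^ q1) (X.W (q - 1)) = w + 1 + real p1"
    using Y.W_Suc[of "q - 1"] Xq X.q_pos by (simp add: YX)
  have HX2: "(H ^^ q1) (X.W q) = X.W 1 + 1 + real p1"
    using Y.W_Suc[of q] X.W_add_q[of 1] by (simp add: YX)
  obtain e where e: "X.W (q - 1) \<le> e" "e \<le> X.W q" "(H ^^ q1) e = K + real p1 + 1"
    using IVT'[of "H ^^ q1" "X.W (q - 1)" "K + real p1 + 1" "X.W q"] HX1 HX2 w x0 order X.W_mono[of "q - 1" q]
      continuous_funpow_H by auto
  have "1 \<le> q - 1" using q2 by arith
  then have eK: "K \<le> e" using e(1) X.W_mono[of 1 "q - 1"] x0 order by linarith
  have ew: "e < w + 1" using e HX2 x0 order Xq by (cases "e = w + 1") auto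
  have shift: "X.W (q + j + m * q) = X.W j + real (m + 1)" for j m
    using X.W_add_mult_q[of "q + j" m] X.W_add_q[of j] by (simp add: add.commute)
  have low_e: "K + real (m + 1) \<le> (H ^^ i) e" if i: "i * p = j + m * q" "1 \<le> j" "j < q" "i < q" for i j m
  proof (cases "j = 1")
    case True
    \<comment> \<open>Residue \<open>1\<close> occurs only at time \<open>q1\<close>, which is when
      \<open>e\<close> sits at the left end of a lap.\<close>
    have "q1 * p + (q - 1) = (p1 + 1) * q" using farey X.q_pos by (simp add: mult.commute)
    moreover have "i * p + (q - 1) = (m + 1) * q" using i True X.q_pos by simp
    ultimately have "i = q1" "m + 1 = p1 + 1" using X.index_unique i q1q by blast+
    then show ?thesis using e by simp
  next
    case False
    have "1 \<le> j - 1" using False i by arith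
    then have "K + real (m + 1) \<le> X.W (j - 1) + real (m + 1)"
      using x0 order X.W_mono[of 1 "j - 1"] by linarith
    also have "\<dots> = (H ^^ i) (X.W (q - 1))"
    proof -
      have "q - 1 + i * p = q + (j - 1) + m * q" using i X.q_pos by simp
      then show ?thesis unfolding funpow_HW using shift by simp
    qed
    also have "\<dots> \<le> (H ^^ i) e" using e by (intro Hm.funpow_mono')
    finally show ?thesis .
  qed
  have GXq: "(G ^^ i) (X.W q) = X.W j + real (m + 1)" if "i * p = j + m * q" for i j m
    unfolding X.funpow_W using shift that by (simp add: add.assoc)
  have HXq: "(H ^^ i) (X.W q) = X.W j + real (m + 1)" if "i * p = j + m * q" for i j m
    unfolding funpow_HW using shift that by (simp add: add.assoc)
  have GXq1: "(G ^^ i) (X.W (q + 1)) = X.W (j + 1) + real (m + 1)" if "i * p = j + m * q" for i j m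
    unfolding X.funpow_W using shift[of "j + 1" m] that by (simp add: ac_simps)
  have HXq1: "(H ^^ i) (X.W (q + 1)) = X.W (j + 1) + real (m + 1)" if "i * p = j + m * q" for i j m
    unfolding funpow_HW using shift[of "j + 1" m] that by (simp add: ac_simps)
  have Xq1: "X.W (q + 1) = X.W 1 + 1" using X.W_add_q[of 1] by simp
  have upC: "(G ^^ i) (C + 1) \<le> C + 1 + real (m + 1)" if i: "i * p = j + m * q" "j < q" for i j m
  proof -
    have "(G ^^ i) (C + 1) \<le> (G ^^ i) (X.W (q + 1))"
      using x0 order Xq1 by (intro Gm.funpow_mono') simp
    also have "\<dots> = X.W (j + 1) + real (m + 1)" using GXq1 i by simp
    also have "\<dots> \<le> X.W q + real (m + 1)" using X.W_mono[of "j + 1" q] i by simp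
    finally show ?thesis using Xq w order by simp
  qed
  have cr_e: "cr_expanding {e..C + 1} (f ^^ q)"
  proof (rule branch)
    fix i assume i: "i < q"
    show "\<exists>m::int. K + of_int m \<le> (f ^^ i) e \<and> (f ^^ i) (C + 1) \<le> C + 1 + of_int m"
    proof (cases "i = 0")
      case True then show ?thesis using eK by (intro exI[of _ 0]) simp
    next
      case False
      then obtain j m where j: "i * p = j + m * q" "1 \<le> j" "j < q"
        using X.W_index[of i] i by auto
      show ?thesis
        using low_e[OF j i] upC[OF j(1,3)] funpow_H_le_f[of e e i] funpow_f_le_G[of "C + 1" "C + 1" i]
        by (intro exI[of _ "int (m + 1)"]) simp
    qed
  qed
  have ge: "(f ^^ q) e < e + real p"
  proof -
    have "(f ^^ q) e = (H ^^ q) e"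
    proof (rule funpow_eqI)
      fix i assume i: "i < q"
      show "H ((H ^^ i) e) = f ((H ^^ i) e)"
      proof (cases "i = 0")
        case True then show ?thesis using H_inc[of 0 e] eK ew w by simp
      next
        case False
        then obtain j m where j: "i * p = j + m * q" "1 \<le> j" "j < q"
          using X.W_index[of i] i by auto
        have "(H ^^ i) e \<le> (H ^^ i) (X.W q)" using e by (intro Hm.funpow_mono')
        also have "\<dots> \<le> X.W q + real (m + 1)" using HXq[OF j(1)] X.W_mono[of j q] j by simp
        finally show ?thesis using low_e[OF j i] w Xq by (intro H_inc[of "m + 1"]) auto
      qed
    qed
    \<comment> \<open>Otherwise apply \<open>H^q1\<close>, which commutes with \<open>H^q\<close>
      and takes \<open>e\<close> to a translate of \<open>K\<close>. This would give
      \<open>H^q K\<close> at least \<open>K + p\<close>, although \<open>K\<close> shares its image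
      with \<open>Km\<close> and \<open>H^q Km\<close> is at most \<open>Km + p\<close>.\<close>
    moreover have "(H ^^ q) e < e + real p"
    proof (rule ccontr)
      assume "\<not> ?thesis"
      then have "(H ^^ q1) (e + real p) \<le> (H ^^ q1) ((H ^^ q) e)" by (intro Hm.funpow_mono') simp
      also have "\<dots> = (H ^^ q) ((H ^^ q1) e)" by (metis add.commute comp_apply funpow_add)
      also have "\<dots> = (H ^^ q) K + real (p1 + 1)" using Hm.funpow_nat[of q K "p1 + 1"] e by (simp add: ac_simps)
      also have "(H ^^ q) K = (H ^^ q) Km" using order X.q_pos by (intro H_flat_funpow) auto
      finally have "K + real p1 + 1 + real p \<le> Km + real p + real (p1 + 1)"
        using HK e by (simp add: Hm.funpow_nat)
      then show False using order by simp
    qed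
    ultimately show ?thesis by simp
  qed
  have gw: "(f ^^ q) (w + 1) \<ge> w + 1 + real p"
    using funpow_H_le_f[of "w + 1" "w + 1" q] Y.W_per[of q] by (simp add: YX Xq)
  have gm: "(f ^^ q) (Km + 1) \<le> Km + 1 + real p"
  proof -
    have "(f ^^ q) (Km + 1) = (H ^^ q) (Km + 1)"
    proof (rule funpow_eqI)
      fix i assume i: "i < q"
      show "H ((H ^^ i) (Km + 1)) = f ((H ^^ i) (Km + 1))"
      proof (cases "i = 0")
        case True then show ?thesis using H_inc[of 0 "Km + 1"] order by simp
      next
        case False
        then obtain j m where j: "i * p = j + m * q" "1 \<le> j" "j < q"
          using X.W_index[of i] i by auto
        have "K + real (m + 1) \<le> X.W j + real (m + 1)" using x0 order X.W_mono[of 1 j] j by simp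
        also have "\<dots> \<le> (H ^^ i) (Km + 1)"
          using HXq[OF j(1)] Hm.funpow_mono'[of "X.W q" "Km + 1" i] Xq w by simp
        finally have 1: "K + real (m + 1) \<le> (H ^^ i) (Km + 1)" .
        have "(H ^^ i) (Km + 1) \<le> (H ^^ i) (X.W (q + 1))"
          using Xq1 x0 order by (intro Hm.funpow_mono') simp
        also have "\<dots> \<le> X.W q + real (m + 1)" using HXq1[OF j(1)] X.W_mono[of "j + 1" q] j by simp
        finally show ?thesis using 1 Xq w by (intro H_inc[of "m + 1"]) auto
      qed
    qed
    then show ?thesis using HK Hm.funpow_nat[of q Km 1] by simp
  qed
  have gc: "(f ^^ q) (C + 1) > C + 1 + real p"
  proof -
    have "(f ^^ q) (C + 1) = (G ^^ q) (C + 1)"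
    proof (rule funpow_eqI)
      fix i assume i: "i < q"
      show "G ((G ^^ i) (C + 1)) = f ((G ^^ i) (C + 1))"
      proof (cases "i = 0")
        case True then show ?thesis using G_inc0[of "C + 1"] order by simp
      next
        case False
        then obtain j m where j: "i * p = j + m * q" "1 \<le> j" "j < q"
          using X.W_index[of i] i by auto
        have "Cp + real (m + 1) \<le> X.W j + real (m + 1)" using x0 X.W_mono[of 1 j] j by simp
        also have "\<dots> \<le> (G ^^ i) (C + 1)"
          using GXq[OF j(1)] Gm.funpow_mono'[of "X.W q" "C + 1" i] Xq w order by simp
        finally show ?thesis using upC[OF j(1,3)] by (intro G_inc[of "m + 1"]) auto
      qed
    qed
    also have "\<dots> = (G ^^ q) Cp + 1"
      using G_flat_funpow[of C q] Gm.funpow_nat[of q C 1] X.q_pos order by simp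
    finally show ?thesis using GC order by simp
  qed
  show False
    by (rule cr_expanding_no_pattern[OF cr_e _ _ _ _ _ _ _ ge gw gm gc]) (use ew w order in auto)
qed

end

lemma (in bimodal) bimodal_add: "bimodal (\<lambda>x. f x + t) C K Km Cp"
proof
  show "cr_expanding {K..C + 1} (\<lambda>x. f x + t)"
    using cr unfolding cr_expanding_def strict_mono_on_def by simp
qed (use lift_add[OF lift] order fKm fCp dec in auto)

section \<open>Orbits where the locking interval is a single point, and the unlocked
  children\<close>

context bimodal
begin

text \<open>No orbit point lies in \<open>(Km, K]\<close>, since \<open>H^q\<close> sends all of
  \<open>[Km, K]\<close> to a single point that is at most \<open>Km + p\<close>. The last orbit
  point below \<open>K\<close> is therefore already at or below \<open>Km\<close>.\<close>

lemma H_orbit_window: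
  assumes "(H ^^ q) z = z + real p" "p * q1 = p1 * q + 1" and HK: "(H ^^ q) Km \<le> Km + real p"
  obtains y where "(H ^^ q) y = y + real p" "y \<le> Km" "K < (H ^^ q1) y - real p1"
proof -
  obtain y where y: "(H ^^ q) y = y + real p" "y < K" "K \<le> (H ^^ q1) y - real p1"
    using Hm.orbit_window[OF assms(1,2), of K] by auto
  interpret Y: periodic_orbit H p q p1 q1 y by unfold_locales (use y assms in auto)
  have avoid: "Y.W j \<le> Km" if "Y.W j \<le> K" for j
  proof (rule ccontr)
    assume "\<not> ?thesis"
    then have "(H ^^ q) (Y.W j) = (H ^^ q) Km" using that Y.q_pos by (intro H_flat_funpow) auto
    then show False using Y.W_per[of j] HK \<open>\<not> Y.W j \<le> Km\<close> by simp
  qed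
  have "\<not> Y.W 1 \<le> K" using avoid[of 1] y order Y.W_Suc[of 0] by auto
  then show ?thesis using that[of y] y avoid[of 0] Y.W_Suc[of 0] by simp
qed

lemma G_orbit_window:
  assumes "(G ^^ q) z = z + real p" "p * q1 = p1 * q + 1"
  obtains w where "(G ^^ q) w = w + real p" "w < C" "C \<le> (G ^^ q1) w - real p1"
  using Gm.orbit_window[OF assms, of C] by auto

text \<open>For \<open>q2 > 0\<close>, excluding the disjoint orbit gives \<open>w\<close> at or
  above \<open>Km\<close>, and the mirrored exclusion gives \<open>y1\<close> at or below
  \<open>Cp\<close>. Points of \<open>[C, Cp)\<close> share the \<open>G^q\<close>-image of
  \<open>Cp\<close>, so none is periodic and \<open>x0\<close> is at or above \<open>Cp\<close>.
  Comparison of orbits puts \<open>H^q1 K - p1\<close> between \<open>y1\<close> and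
  \<open>x0\<close>. An orbit with \<open>y1 < max x0 Cp\<close> is excluded as well, so
  \<open>y1\<close>, \<open>Cp\<close> and \<open>x0\<close> all coincide.\<close>

lemma adjacent_at_end:
  assumes farey: "p * q1 = p1 * q + 1" and q: "q = q1 + q2" and p: "p = p1 + p2"
    and le: "q2 > 0 \<Longrightarrow> p1 \<le> q1 \<and> p2 \<le> q2"
    and G: "\<And>x. (G ^^ q) x \<ge> x + real p" "\<exists>x. (G ^^ q) x = x + real p"
    and H: "\<And>x. (H ^^ q) x \<le> x + real p" "\<exists>x. (H ^^ q) x = x + real p"
  shows "(H ^^ q1) K \<le> Cp + real p1"
proof (cases "q2 = 0")
  case True
  have q1: "q = 1" "q1 = 1" "p = p1 + 1"
  proof -
    have "(p1 + p2) * q1 = p1 * q1 + 1" using farey q p True by simp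
    then have "p2 * q1 = 1" by (simp add: algebra_simps)
    then show "q = 1" "q1 = 1" "p = p1 + 1" using q p True by auto
  qed
  \<comment> \<open>For an integer rotation number the pattern appears in \<open>f\<close> itself,
    at \<open>K < Cp < Km + 1 < C + 1\<close>.\<close>
  show ?thesis
  proof (rule ccontr)
    assume "\<not> ?thesis"
    then have gt: "f K > Cp + real p1" using q1 H_flat[of K] order by simp
    have HK: "H Km = f K" using H_flat[of Km] order by simp
    have lt: "Cp < Km + 1" using gt H(1)[of Km] q1 HK by simp
    have "f K < K + real p" using H(1)[of Km] q1 HK order by simp
    moreover have fCp': "f Cp \<ge> Cp + real p" using G(1)[of Cp] q1 G_inc0[of Cp] order by simp
    moreover have "f (Km + 1) \<le> Km + 1 + real p" using H(1)[of Km] q1 HK f_nat[of Km 1] fKm by simp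
    moreover have "f (C + 1) > C + 1 + real p" using fCp' fCp f_nat[of C 1] order by simp
    ultimately show False
      using cr_expanding_no_pattern[OF cr, of K Cp "Km + 1" "C + 1" "real p"] lt order by auto
  qed
next
  case False
  then have q2: "q2 > 0" by simp
  have q1: "q1 > 0" using farey by (cases q1) auto
  obtain y where y: "(H ^^ q) y = y + real p" "y \<le> Km" "K < (H ^^ q1) y - real p1"
    using H(2) H_orbit_window[OF _ farey H(1)] by metis
  obtain w where w: "(G ^^ q) w = w + real p" "w < C" "C \<le> (G ^^ q1) w - real p1"
    using G(2) G_orbit_window[OF _ farey] by metis
  define x0 where "x0 = (G ^^ q1) w - real p1"
  define y1 where "y1 = (H ^^ q1) y - real p1"
  interpret X: periodic_orbit G p q p1 q1 w by unfold_locales (use w farey in auto)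
  interpret Y: periodic_orbit H p q p1 q1 y by unfold_locales (use y farey in auto)
  have x0_per: "(G ^^ q) x0 = x0 + real p" using X.W_per[of 1] X.W_Suc[of 0] by (simp add: x0_def)
  have y1_per: "(H ^^ q) y1 = y1 + real p" using Y.W_per[of 1] Y.W_Suc[of 0] by (simp add: y1_def)
  have x0Cp: "Cp \<le> x0"
  proof (rule ccontr)
    assume "\<not> ?thesis"
    then have "(G ^^ q) x0 = (G ^^ q) Cp" using w X.q_pos by (intro G_flat_funpow) (auto simp: x0_def)
    then show False using x0_per G(1)[of Cp] \<open>\<not> Cp \<le> x0\<close> by simp
  qed
  have wKm: "Km \<le> w"
  proof (rule ccontr)
    assume "\<not> ?thesis"
    then show False
      using no_disjoint_orbit[OF farey q q2 p H(1) G(1) w(1)] x0Cp by (simp add: x0_def)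
  qed
  have "(H ^^ q1) K = (H ^^ q1) Km" using order q1 by (intro H_flat_funpow) auto
  then have aK: "(H ^^ q1) K - real p1 \<le> x0" "y1 \<le> (H ^^ q1) K - real p1"
    using funpow_H_le_G[OF wKm, of q1] Hm.funpow_mono'[OF y(2), of q1] by (simp_all add: x0_def y1_def)
  have y1Cp: "y1 \<le> Cp"
  proof (rule ccontr)
    assume gt: "\<not> ?thesis"
    \<comment> \<open>Under the reflection the right parent becomes the left parent, and
      \<open>- y1\<close> takes the role of \<open>w\<close>.\<close>
    interpret R: bimodal "rfl f" "- K" "- C" "- Cp" "- Km" by (rule bimodal_rfl)
    note q2p = farey_complement[OF farey q p]
    have GR: "(R.G ^^ n) x = real n - (H ^^ n) (- x)" for n x
      unfolding upper_bound_rfl[OF lift] by (rule rfl_funpow) (rule Hm.deg)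
    have HR: "(R.H ^^ n) x = real n - (G ^^ n) (- x)" for n x
      unfolding lower_bound_rfl'[OF lift] by (rule rfl_funpow) (rule Gm.deg)
    have pq: "p \<le> q" "p1 \<le> q1" "p2 \<le> q2" using le q2 p q by auto
    have "int ((q - p) * q2) = int ((q2 - p2) * q + 1)"
    proof -
      have "int q2 * int p + 1 = int p2 * int q" using q2p by (metis of_nat_1 of_nat_add of_nat_mult)
      then show ?thesis using pq by (simp add: of_nat_diff algebra_simps)
    qed
    then have f1: "(q - p) * q2 = (q2 - p2) * q + 1" by linarith
    have y0: "(H ^^ q2) y1 - real p2 = y"
    proof -
      have "1 + q2 * p = 0 + p2 * q" using q2p by simp
      then have "(H ^^ q2) (Y.W 1) = y + real p2" unfolding Y.funpow_W using Y.W_add_mult_q[of 0 p2] by simp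
      then show ?thesis using Y.W_Suc[of 0] by (simp add: y1_def)
    qed
    show False
    proof (rule R.no_disjoint_orbit[of "q - p" q2 "q2 - p2" q q1 "q1 - p1" "- y1"])
      show "(R.H ^^ q) (- Cp) \<le> - Cp + real (q - p)" using G(1)[of Cp] pq by (simp add: HR of_nat_diff)
      show "(R.G ^^ q) (- Km) \<ge> - Km + real (q - p)" using H(1)[of Km] pq by (simp add: GR of_nat_diff)
      show "(R.G ^^ q) (- y1) = - y1 + real (q - p)" using y1_per pq by (simp add: GR of_nat_diff)
      show "- Km \<le> (R.G ^^ q2) (- y1) - real (q2 - p2)" using y0 y pq by (simp add: GR of_nat_diff)
    qed (use f1 q p pq q1 gt in auto)
  qed
  have "\<not> y1 < max x0 Cp"
    using no_early_right_neighbour[OF farey q p H(1) y w] y1Cp by (auto simp: x0_def y1_def)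
  then show ?thesis using y1Cp aK by linarith
qed

text \<open>The left child has the same left parent \<open>p1 / q1\<close>, so its orbits are
  ordered by the same number \<open>q1\<close> of steps, and the bound on \<open>H^q1 K\<close> can
  be compared directly after the change of \<open>a\<close> by \<open>t\<close>.\<close>

lemma left_child_unlocked:
  assumes farey: "p * q1 = p1 * q + 1" and q: "q = q1 + q2" and p: "p = p1 + p2"
    and le: "q2 > 0 \<Longrightarrow> p1 \<le> q1 \<and> p2 \<le> q2"
    and G: "\<And>x. (G ^^ q) x \<ge> x + real p" "\<exists>x. (G ^^ q) x = x + real p"
    and H: "\<And>x. (H ^^ q) x \<le> x + real p" "\<exists>x. (H ^^ q) x = x + real p"
    and H': "\<And>x. ((\<lambda>x. H x + t) ^^ (q + q1)) x \<le> x + real (p + p1)"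
      "((\<lambda>x. H x + t) ^^ (q + q1)) y = y + real (p + p1)"
    and G': "((\<lambda>x. G x + t) ^^ (q + q1)) x \<le> x + real (p + p1)"
  shows False
proof -
  interpret T: bimodal "\<lambda>x. f x + t" C K Km Cp by (rule bimodal_add)
  have GT: "T.G = (\<lambda>x. G x + t)" and HT: "T.H = (\<lambda>x. H x + t)"
    using upper_bound_add[OF lift] lower_bound_add[OF lift] by auto
  note H'T = H'[folded HT] and G'T = G'[folded GT]
  have q1: "q1 > 0" using farey by (cases q1) auto
  \<comment> \<open>For \<open>t \<ge> 0\<close> the map \<open>G + t\<close> advances at a rate of
    at least \<open>p / q\<close>, but the left child is a smaller fraction. The two rates are
    compared over \<open>(q + q1) * q\<close> iterates.\<close>
  have t: "t < 0"
  proof (rule ccontr)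
    assume "\<not> ?thesis"
    then have "(T.G ^^ q) z \<ge> z + real p" for z
      using funpow_le_funpow[OF T.Gm.mono, of G z z q] G(1)[of z] by (simp add: GT)
    then have "x + real (q + q1) * real p \<le> (T.G ^^ ((q + q1) * q)) x"
      by (rule T.Gm.funpow_mult_ge)
    moreover have "(T.G ^^ (n * (q + q1))) x \<le> x + real n * real (p + p1)" for n
    proof (induction n)
      case (Suc n)
      have "(T.G ^^ (Suc n * (q + q1))) x = (T.G ^^ (n * (q + q1))) ((T.G ^^ (q + q1)) x)"
        unfolding mult_Suc add.commute[of "q + q1" "n * (q + q1)"] funpow_add by simp
      also have "\<dots> \<le> (T.G ^^ (n * (q + q1))) (x + real (p + p1))"
        using G'T by (intro T.Gm.funpow_mono')
      also have "\<dots> \<le> x + real (Suc n) * real (p + p1)"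
        unfolding T.Gm.funpow_nat using Suc by (simp add: algebra_simps)
      finally show ?case .
    qed simp
    from this[of q] have "(T.G ^^ ((q + q1) * q)) x \<le> x + real q * real (p + p1)"
      by (simp only: mult.commute)
    ultimately have "real (q + q1) * real p \<le> real q * real (p + p1)" by linarith
    then have "(q + q1) * p \<le> q * (p + p1)" by (simp only: of_nat_mult[symmetric] of_nat_le_iff)
    then have "p * q1 \<le> p1 * q" by (simp add: add_mult_distrib add_mult_distrib2 mult.commute)
    then show False using farey by simp
  qed
  have farey': "(p + p1) * q1 = p1 * (q + q1) + 1" using farey by (simp add: algebra_simps)
  obtain z where z: "(T.H ^^ (q + q1)) z = z + real (p + p1)" "z \<le> Km" "K < (T.H ^^ q1) z - real p1"
    using T.H_orbit_window[OF H'T(2) farey' H'T(1)] by metis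
  have "\<exists>v. (T.G ^^ (q + q1)) v = v + real (p + p1)"
  proof -
    have c: "continuous_on UNIV (\<lambda>v. (T.G ^^ (q + q1)) v - v)"
      by (intro continuous_on_diff T.continuous_funpow_G continuous_on_id)
    have "(T.G ^^ (q + q1)) y - y \<ge> real (p + p1)"
      using H'T(2) T.funpow_H_le_G[of y y "q + q1"] by simp
    moreover have "(T.G ^^ (q + q1)) x - x \<le> real (p + p1)" using G'T by simp
    ultimately obtain v where "(T.G ^^ (q + q1)) v - v = real (p + p1)"
      using IVT_unordered[OF c] by metis
    then have "(T.G ^^ (q + q1)) v = v + real (p + p1)" by linarith
    then show ?thesis by (rule exI)
  qed
  then obtain w where w: "(T.G ^^ (q + q1)) w = w + real (p + p1)" "w < C" "C \<le> (T.G ^^ q1) w - real p1"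
    using T.G_orbit_window[OF _ farey'] by metis
  have drop: "(T.H ^^ n) K \<le> (H ^^ n) K + t" if "n > 0" for n
    using that
  proof (cases n)
    case (Suc m)
    have "(T.H ^^ m) K \<le> (H ^^ m) K"
      using funpow_le_funpow[OF Hm.mono, of T.H K K m] t by (simp add: HT)
    then have "H ((T.H ^^ m) K) \<le> H ((H ^^ m) K)" by (rule monoD[OF Hm.mono])
    then show ?thesis unfolding Suc by (simp add: HT)
  qed simp
  have "(T.H ^^ q1) z \<le> (T.H ^^ q1) K" using z order by (intro T.Hm.funpow_mono') simp
  also have "\<dots> \<le> (H ^^ q1) K + t" by (rule drop[OF q1])
  also have "\<dots> < Cp + real p1" using adjacent_at_end[OF farey q p le G H] t by simp
  finally have "(T.H ^^ q1) z - real p1 < Cp" by simp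
  then show False
    using T.no_early_right_neighbour[OF farey' _ _ H'T(1) z w, of q p]
    by (auto simp: add.commute less_max_iff_disj)
qed

text \<open>A gap above \<open>1\<close> puts \<open>Km + 1\<close> to the left of
  \<open>Cp\<close>. The image \<open>z + 1\<close> of a window point \<open>z \<le> Km\<close> is
  then an early right neighbour in the case \<open>q = q1 = 1\<close>. This is the source of a
  finite height for the roots.\<close>

lemma root_unlocked:
  assumes gap: "f C > f K + 1"
    and H: "\<And>x. H x \<le> x + 1" "H y = y + 1" and G: "G x \<le> x + 1"
  shows False
proof -
  have "f (Km + 1) < f Cp" using gap fKm fCp f_nat[of Km 1] by simp
  then have "\<not> Cp \<le> Km + 1" using inc[of Cp "Km + 1"] order by (cases "Cp = Km + 1") auto
  then have lt: "Km + 1 < Cp" by simp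
  have farey: "1 * 1 = 0 * 1 + (1::nat)" by simp
  obtain z where z: "(H ^^ 1) z = z + real 1" "z \<le> Km" "K < (H ^^ 1) z - real 0"
    using H_orbit_window[of 1 y 1 1 0] H by auto
  have "\<exists>v. G v = v + 1"
  proof -
    have c: "continuous_on UNIV (\<lambda>v. G v - v)"
      by (intro continuous_on_diff continuous_upper_bound[OF lift] continuous_on_id)
    have "G y - y \<ge> 1" using H(2) H_le_G[of y] by simp
    moreover have "G x - x \<le> 1" using G by simp
    ultimately obtain v where "G v - v = 1" using IVT_unordered[OF c] by metis
    then have "G v = v + 1" by linarith
    then show ?thesis by (rule exI)
  qed
  then obtain w where w: "(G ^^ 1) w = w + real 1" "w < C" "C \<le> (G ^^ 1) w - real 0"
    using G_orbit_window[of 1 _ 1 1 0] by auto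
  show False
    using no_early_right_neighbour[of 1 1 0 1 0 1, OF _ _ _ _ z w] H(1)[of Km] lt z
    by (auto simp: less_max_iff_disj)
qed

end

context bimodal
begin

text \<open>The reflection makes \<open>(q2 - p2) / q2\<close> the left parent of
  \<open>(q - p) / q\<close>; the inequalities in \<open>le\<close> make these differences of
  natural numbers behave as differences of integers.\<close>

lemma right_child_unlocked:
  assumes farey: "p2 * q = p * q2 + 1" and le: "p \<le> q" "p2 \<le> q2" "q2 \<le> q" "q2 - p2 \<le> q - p"
      "q2 < q \<Longrightarrow> p2 \<le> p"
    and G: "\<And>x. (G ^^ q) x \<ge> x + real p" "\<exists>x. (G ^^ q) x = x + real p"
    and H: "\<And>x. (H ^^ q) x \<le> x + real p" "\<exists>x. (H ^^ q) x = x + real p"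
    and G': "\<And>x. ((\<lambda>x. G x + t) ^^ (q + q2)) x \<ge> x + real (p + p2)"
      "((\<lambda>x. G x + t) ^^ (q + q2)) y = y + real (p + p2)"
    and H': "((\<lambda>x. H x + t) ^^ (q + q2)) x \<ge> x + real (p + p2)"
  shows False
proof -
  interpret R: bimodal "rfl f" "- K" "- C" "- Cp" "- Km" by (rule bimodal_rfl)
  have GR: "(R.G ^^ n) x = real n - (H ^^ n) (- x)" for n x
    unfolding upper_bound_rfl[OF lift] by (rule rfl_funpow) (rule Hm.deg)
  have HR: "(R.H ^^ n) x = real n - (G ^^ n) (- x)" for n x
    unfolding lower_bound_rfl'[OF lift] by (rule rfl_funpow) (rule Gm.deg)
  have GT: "((\<lambda>x. R.G x + - t) ^^ n) x = real n - ((\<lambda>x. H x + t) ^^ n) (- x)" for n x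
  proof -
    have "(\<lambda>x. R.G x + - t) = rfl (\<lambda>x. H x + t)"
      unfolding upper_bound_rfl[OF lift] by (auto simp: rfl_def)
    then show ?thesis
      using rfl_funpow[of "\<lambda>x. H x + t" n x, OF deg_one_mono.deg[OF Hm.add_deg_one_mono]] by simp
  qed
  have HT: "((\<lambda>x. R.H x + - t) ^^ n) x = real n - ((\<lambda>x. G x + t) ^^ n) (- x)" for n x
  proof -
    have "(\<lambda>x. R.H x + - t) = rfl (\<lambda>x. G x + t)"
      unfolding lower_bound_rfl'[OF lift] by (auto simp: rfl_def)
    then show ?thesis
      using rfl_funpow[of "\<lambda>x. G x + t" n x, OF deg_one_mono.deg[OF Gm.add_deg_one_mono]] by simp
  qed
  have "int ((q - p) * q2) = int ((q2 - p2) * q + 1)"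
  proof -
    have "int p2 * int q = int p * int q2 + 1" using farey by (metis of_nat_1 of_nat_add of_nat_mult)
    then show ?thesis using le by (simp add: of_nat_diff algebra_simps)
  qed
  then have f1: "(q - p) * q2 = (q2 - p2) * q + 1" by linarith
  have sums: "real ((q - p) + (q2 - p2)) = real (q + q2) - real (p + p2)" using le by (simp add: of_nat_diff)
  show False
  proof (rule R.left_child_unlocked[of "q - p" q2 "q2 - p2" q "q - q2" "(q - p) - (q2 - p2)" "- t" "- y" "- x"])
    show "0 < q - q2 \<Longrightarrow> q2 - p2 \<le> q2 \<and> q - p - (q2 - p2) \<le> q - q2" using le by auto
    show "(R.G ^^ q) z \<ge> z + real (q - p)" for z using H(1)[of "- z"] le by (simp add: GR of_nat_diff)
    show "(R.H ^^ q) z \<le> z + real (q - p)" for z using G(1)[of "- z"] le by (simp add: HR of_nat_diff)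
    obtain u where "(H ^^ q) u = u + real p" using H(2) by blast
    then show "\<exists>z. (R.G ^^ q) z = z + real (q - p)"
      using le by (intro exI[of _ "- u"]) (simp add: GR of_nat_diff)
    obtain v where "(G ^^ q) v = v + real p" using G(2) by blast
    then show "\<exists>z. (R.H ^^ q) z = z + real (q - p)"
      using le by (intro exI[of _ "- v"]) (simp add: HR of_nat_diff)
    show "((\<lambda>x. R.H x + - t) ^^ (q + q2)) z \<le> z + real ((q - p) + (q2 - p2))" for z
      using G'(1)[of "- z"] unfolding HT sums by linarith
    show "((\<lambda>x. R.H x + - t) ^^ (q + q2)) (- y) = - y + real ((q - p) + (q2 - p2))"
      using G'(2) unfolding HT sums by simp
    show "((\<lambda>x. R.G x + - t) ^^ (q + q2)) (- x) \<le> - x + real ((q - p) + (q2 - p2))"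
      using H' unfolding GT sums by simp
  qed (use f1 le in auto)
qed

text \<open>Used to convert \<open>Delta > 1\<close> into a vertical gap \<open>f C - f K\<close>
  above \<open>1\<close>.\<close>

lemma bounds_gap: "G x - H x \<le> f C - f K"
proof -
  define m where "m = \<lfloor>x - C\<rfloor>"
  define z where "z = x - of_int m"
  have z: "C \<le> z" "z \<le> C + 1" unfolding z_def m_def by linarith+
  have e: "G x - H x = G z - H z"
    using Gm.funpow_int[of 1 z m] Hm.funpow_int[of 1 z m] by (simp add: z_def)
  have HC: "H C = f K" using H_flat[of C] order by simp
  have pos: "f K \<le> f C" using dec[of C K] order by simp
  show ?thesis
  proof (cases "z \<le> Cp")
    case True
    then show ?thesis using e G_flat[of z] z monoD[OF Hm.mono, of C z] HC by simp
  next
    case F: False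
    show ?thesis
    proof (cases "z \<le> Km + 1")
      case True
      then show ?thesis using e F z G_inc0[of z] H_inc[of 0 z] order pos by simp
    next
      case False
      have "H z = f K + 1" using H_flat[of "z - 1"] Hm.funpow_int[of 1 "z - 1" 1] False z order by simp
      moreover have "G z \<le> f C + 1"
        using monoD[OF Gm.mono, of z "C + 1"] z Gm.deg[of C] G_flat[of C] order by simp
      ultimately show ?thesis using e by simp
    qed
  qed
qed

lemma not_inj: "\<not> inj f"
proof
  assume "inj f"
  then have "Cp = C" using fCp by (rule injD)
  then show False using order by simp
qed

end

section \<open>Class B maps with two turning points are bimodal\<close>

lemma continuous_sign_const:
  fixes g :: "real \<Rightarrow> real"
  assumes c: "continuous_on UNIV g" and nz: "\<And>z. a < z \<Longrightarrow> z < b \<Longrightarrow> g z \<noteq> 0"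
    and x: "a < x" "x < b" "g x > 0" and y: "a < y" "y < b"
  shows "g y > 0"
proof (rule ccontr)
  assume "\<not> ?thesis"
  then have gy: "g y \<le> 0" by simp
  have "\<exists>z. a < z \<and> z < b \<and> g z = 0"
  proof (cases "x \<le> y")
    case True
    then obtain z where "x \<le> z" "z \<le> y" "g z = 0"
      using IVT2'[of g y 0 x] gy x continuous_on_subset[OF c] by auto
    then show ?thesis using x y by (intro exI[of _ z]) auto
  next
    case False
    then obtain z where "y \<le> z" "z \<le> x" "g z = 0"
      using IVT'[of g y 0 x] gy x continuous_on_subset[OF c] by auto
    then show ?thesis using x y by (intro exI[of _ z]) auto
  qed
  then show False using nz by blast
qed

text \<open>The derivative has no zero inside \<open>(C, K)\<close> and \<open>(K, C + 1)\<close>,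
  so one mean value next to each turning point fixes its sign there. As \<open>f K < f C\<close> and
  \<open>f\<close> gains \<open>1\<close> over a period, \<open>Km\<close> and \<open>Cp\<close>
  come from the intermediate value theorem.\<close>

lemma bimodal_of_class_B:
  assumes B: "class_B f" and N: "normalised_two_turning_points f"
  obtains C K Km Cp where "bimodal f C K Km Cp"
proof -
  obtain C K where CK: "critical_points f = {C, K}" "turning_max f C" "turning_min f K"
    "0 \<le> C" "C < K" "K < 1"
    using N unfolding normalised_two_turning_points_def by blast
  have lift: "degree_one_lift f" and C3: "C3 f" using B by (auto simp: class_B_def)
  have card: "card (critical_points f) = 2" using CK by simp
  then have neg: "\<And>x. deriv f x \<noteq> 0 \<Longrightarrow> Schwarzian f x < 0" using B by (auto simp: class_B_def)
  have diff: "(deriv ^^ k) f differentiable at x" if "k < 3" for k x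
    using C3 that unfolding C3_def by (metis differentiable_on_def UNIV_I)
  have D1: "(f has_real_derivative deriv f x) (at x)" for x
    using diff[of 0 x] by (simp add: DERIV_deriv_iff_real_differentiable)
  have D2: "(deriv f has_real_derivative (deriv ^^ 2) f x) (at x)" for x
    using diff[of 1 x] by (simp add: DERIV_deriv_iff_real_differentiable numeral_2_eq_2)
  have D3: "((deriv ^^ 2) f has_real_derivative (deriv ^^ 3) f x) (at x)" for x
    using diff[of 2 x] by (simp add: DERIV_deriv_iff_real_differentiable numeral_2_eq_2 numeral_3_eq_3)
  have cont1: "continuous_on UNIV (deriv f)"
    using D2 by (meson DERIV_isCont continuous_at_imp_continuous_on)
  have per: "deriv f (x + of_int m) = deriv f x" for x m
  proof -
    have "((\<lambda>x. f (x + of_int m)) has_real_derivative deriv f (x + of_int m)) (at x)"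
      using D1[of "x + of_int m"] by (simp add: DERIV_shift)
    then have "((\<lambda>x. f x + of_int m) has_real_derivative deriv f (x + of_int m)) (at x)"
      by (simp only: lift_int[OF lift])
    moreover have "((\<lambda>x. f x + of_int m) has_real_derivative deriv f x) (at x)"
      using D1[of x] by (auto intro!: derivative_eq_intros)
    ultimately show ?thesis by (rule DERIV_unique)
  qed
  have nz: "deriv f x \<noteq> 0" if "0 \<le> x" "x < 1" "x \<noteq> C" "x \<noteq> K" for x
    using that CK(1) by (auto simp: critical_points_def)
  have nz1: "deriv f x \<noteq> 0" if "C < x" "x < K" for x using nz that CK by auto
  have nz2: "deriv f x \<noteq> 0" if "K < x" "x < C + 1" for x
  proof (cases "x < 1")
    case True then show ?thesis using nz[of x] that CK by auto
  next
    case False then show ?thesis using nz[of "x - 1"] per[of "x - 1" 1] that CK by auto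
  qed
  have s1: "deriv f x < 0" if x: "C < x" "x < K" for x
  proof -
    obtain e where e: "e > 0" "strict_antimono_on {C..C + e} f" using CK(2) by (auto simp: turning_max_def)
    define y where "y = min (C + e) ((C + K) / 2)"
    have y: "C < y" "y < K" "y \<le> C + e" using e CK by (auto simp: y_def min_def)
    obtain z where z: "C < z" "z < y" "f y - f C = (y - C) * deriv f z"
      using MVT2[of C y f "deriv f"] D1 y by auto
    have "f y < f C" using e(2) y by (auto simp: monotone_on_def)
    then have "deriv f z < 0" using z y by (metis diff_gt_0_iff_gt diff_less_0_iff_less mult_less_0_iff not_less_iff_gr_or_eq)
    then have "- deriv f x > 0"
      using continuous_sign_const[of "\<lambda>x. - deriv f x" C K z x] cont1 nz1 z y x
      by (auto intro: continuous_on_minus)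
    then show ?thesis by simp
  qed
  have s2: "deriv f x > 0" if x: "K < x" "x < C + 1" for x
  proof -
    obtain e where e: "e > 0" "strict_mono_on {K..K + e} f" using CK(3) by (auto simp: turning_min_def)
    define y where "y = min (K + e) ((K + C + 1) / 2)"
    have y: "K < y" "y < C + 1" "y \<le> K + e" using e CK by (auto simp: y_def min_def)
    obtain z where z: "K < z" "z < y" "f y - f K = (y - K) * deriv f z"
      using MVT2[of K y f "deriv f"] D1 y by auto
    have "f K < f y" using e(2) y by (auto simp: monotone_on_def)
    then have "deriv f z > 0" using z y by (metis diff_gt_0_iff_gt zero_less_mult_pos)
    then show ?thesis
      using continuous_sign_const[of "deriv f" K "C + 1" z x] cont1 nz2 z y x by auto
  qed
  have dec: "f y < f x" if "C \<le> x" "x < y" "y \<le> K" for x y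
    by (rule DERIV_neg_imp_decreasing_open[OF that(2)])
       (use D1 s1 that lift_cont[OF lift] in \<open>auto intro!: exI\<close>)
  have cr: "cr_expanding {K..C + 1} f"
  proof (rule cr_expanding_of_Schwarzian[OF lift_cont[OF lift] D1 D2 D3])
    show "deriv f z > 0" if "z \<in> {K<..<C + 1}" for z using s2 that by auto
    show "(deriv ^^ 3) f z / deriv f z - 3 / 2 * ((deriv ^^ 2) f z / deriv f z)\<^sup>2 \<le> 0"
      if "z \<in> {K<..<C + 1}" for z
      using neg[of z] nz2[of z] that by (auto simp: Schwarzian_def)
  qed
  have fCK: "f K < f C" using dec[of C K] CK by simp
  obtain Cp where Cp: "K \<le> Cp" "Cp \<le> C + 1" "f Cp = f C"
    using IVT'[of f K "f C" "C + 1"] fCK lift_deg[OF lift, of C] lift_cont[OF lift] CK by auto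
  have "Cp \<noteq> K" "Cp \<noteq> C + 1" using Cp fCK lift_deg[OF lift, of C] by auto
  moreover obtain Km where Km: "K - 1 \<le> Km" "Km \<le> C" "f Km = f K"
    using IVT'[of f "K - 1" "f K" C] fCK lift_deg[OF lift, of "K - 1"] lift_cont[OF lift] CK by auto
  moreover have "Km \<noteq> K - 1" "Km \<noteq> C" using Km fCK lift_deg[OF lift, of "K - 1"] by auto
  ultimately have "bimodal f C K Km Cp"
    by unfold_locales (use lift CK Cp dec cr in auto)
  then show ?thesis by (rule that)
qed

section \<open>Components of the region between two curves\<close>

text \<open>The height \<open>h\<close> is the infimum of the levels above \<open>c\<close> with an
  empty interval. Such levels accumulate at \<open>h\<close> from above, so no connected part of
  \<open>S\<close> that meets level \<open>c\<close> passes \<open>h\<close>, even if intervals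
  become nonempty again higher up.\<close>

lemma component_between_curves:
  fixes L U :: "real \<Rightarrow> real" and c b1 :: real
  assumes L: "continuous_on UNIV L" and U: "continuous_on UNIV U"
    and le: "\<And>b. b \<le> c \<Longrightarrow> L b \<le> U b" and lt: "L c < U c"
    and b1: "c < b1" "U b1 < L b1"
  defines "S \<equiv> {(a, b). L b \<le> a \<and> a \<le> U b}"
  obtains h where "c < h" "L h = U h" "\<forall>b\<le>h. L b \<le> U b"
    "(THE T. T \<in> components S \<and> {(a, b) \<in> S. b \<le> c} \<subseteq> T) = {(a, b) \<in> S. b \<le> h}"
    "(GREATEST b. \<exists>a. (a, b) \<in> {(a, b) \<in> S. b \<le> h}) = h"
proof -
  define A where "A = {b. c \<le> b \<and> U b < L b}"
  define h where "h = Inf A"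
  have ne: "A \<noteq> {}" using b1 by (auto simp: A_def intro!: exI[of _ b1])
  have bdd: "bdd_below A" by (rule bdd_belowI[of _ c]) (simp add: A_def)
  have hc: "c \<le> h" unfolding h_def using ne by (intro cInf_greatest) (auto simp: A_def)
  have below: "L b \<le> U b" if "b < h" for b
  proof (cases "b \<le> c")
    case False
    have "b \<notin> A" using cInf_lower[OF _ bdd, of b] that by (auto simp: h_def)
    then show ?thesis using False by (simp add: A_def)
  qed (rule le)
  have contD: "continuous_on UNIV (\<lambda>b. U b - L b)" using L U by (intro continuous_on_diff)
  have cl: "closed {b. 0 \<le> U b - L b}" using contD by (intro closed_Collect_le continuous_on_const)
  have hle: "L h \<le> U h"
  proof -
    have "h \<in> closure {..<h}" by simp
    also have "\<dots> \<subseteq> {b. 0 \<le> U b - L b}" by (rule closure_minimal[OF _ cl]) (use below in auto)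
    finally show ?thesis by simp
  qed
  have hge: "U h \<le> L h"
  proof (rule ccontr)
    assume n: "\<not> ?thesis"
    have "open {b. 0 < U b - L b}" using contD by (intro open_Collect_less continuous_on_const)
    then obtain d where d: "d > 0" "ball h d \<subseteq> {b. 0 < U b - L b}"
      using n by (metis (no_types, lifting) diff_gt_0_iff_gt mem_Collect_eq not_le open_contains_ball)
    obtain b where b: "b \<in> A" "b < h + d" using cInf_less_iff[of A "h + d"] ne bdd d by (auto simp: h_def)
    have "h \<le> b" using cInf_lower[OF b(1) bdd] by (simp add: h_def)
    then have "b \<in> ball h d" using b by (auto simp: dist_real_def)
    then show False using d b by (auto simp: A_def)
  qed
  have heq: "L h = U h" using hle hge by simp
  then have hc': "c < h" using hc lt by (cases "c = h") auto
  have LU: "L b \<le> U b" if "b \<le> h" for b using that below hle by (cases "b = h") auto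
  have above: "\<exists>t. h < t \<and> t < b \<and> U t < L t" if hb: "h < b" for b
  proof -
    obtain t where t: "t \<in> A" "t < b" using cInf_less_iff[OF ne bdd, of b] hb by (auto simp: h_def)
    have "h \<le> t" using cInf_lower[OF t(1) bdd] by (simp add: h_def)
    moreover have "t \<noteq> h" using t heq by (auto simp: A_def)
    ultimately show ?thesis using t by (auto simp: A_def intro!: exI[of _ t])
  qed
  define T where "T = {(a, b) \<in> S. b \<le> h}"
  have conn: "connected T"
  proof -
    \<comment> \<open>Linear interpolation between the two curves makes the region the continuous
      image of a convex strip.\<close>
    have "T = (\<lambda>(b, s). (L b + s * (U b - L b), b)) ` ({..h} \<times> {0..1})"
    proof (intro set_eqI iffI)
      fix z assume "z \<in> T"
      then obtain a b where z: "z = (a, b)" "L b \<le> a" "a \<le> U b" "b \<le> h" by (auto simp: T_def S_def)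
      show "z \<in> (\<lambda>(b, s). (L b + s * (U b - L b), b)) ` ({..h} \<times> {0..1})"
      proof (cases "U b = L b")
        case True
        then show ?thesis using z by (intro image_eqI[of _ _ "(b, 0)"]) auto
      next
        case False
        then have "U b - L b > 0" using z by simp
        then show ?thesis using z by (intro image_eqI[of _ _ "(b, (a - L b) / (U b - L b))"]) auto
      qed
    next
      fix z assume "z \<in> (\<lambda>(b, s). (L b + s * (U b - L b), b)) ` ({..h} \<times> {0..1})"
      then obtain w where w: "w \<in> {..h} \<times> {0..1}" "z = (\<lambda>(b, s). (L b + s * (U b - L b), b)) w" by blast
      obtain b s where "w = (b, s)" by (cases w)
      with w have z: "z = (L b + s * (U b - L b), b)" "b \<le> h" "0 \<le> s" "s \<le> 1" by auto
      have "s * (U b - L b) \<le> 1 * (U b - L b)" using z LU[of b] by (intro mult_right_mono) auto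
      moreover have "0 \<le> s * (U b - L b)" using z LU[of b] by simp
      ultimately show "z \<in> T" using z by (auto simp: T_def S_def)
    qed
    moreover have conn2: "connected ({..h} \<times> {0..1::real})"
      by (intro connected_Times convex_connected convex_real_interval)
    moreover have cont2: "continuous_on ({..h} \<times> {0..1::real}) (\<lambda>(b, s). (L b + s * (U b - L b), b))"
    proof -
      have "continuous_on ({..h} \<times> {0..1::real}) (\<lambda>z. L (fst z))" "continuous_on ({..h} \<times> {0..1::real}) (\<lambda>z. U (fst z))"
        by (rule continuous_on_compose2[OF L continuous_on_fst[OF continuous_on_id]]
            continuous_on_compose2[OF U continuous_on_fst[OF continuous_on_id]]; simp)+
      then show ?thesis unfolding case_prod_unfold
        by (intro continuous_on_Pair continuous_on_add continuous_on_mult continuous_on_diff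
            continuous_on_fst continuous_on_snd continuous_on_id)
    qed
    ultimately show ?thesis using connected_continuous_image[OF cont2 conn2] by simp
  qed
  have TS: "T \<subseteq> S" by (auto simp: T_def)
  have pc: "(L c, c) \<in> T" using lt hc by (auto simp: T_def S_def)
  have maxi: "T' \<subseteq> T" if T': "connected T'" "T' \<subseteq> S" "(L c, c) \<in> T'" for T'
  proof
    fix z assume z: "z \<in> T'"
    show "z \<in> T"
    proof (rule ccontr)
      assume "z \<notin> T"
      then have "h < snd z" using z T' by (auto simp: T_def case_prod_unfold)
      then obtain t where t: "h < t" "t < snd z" "U t < L t" using above by blast
      have "connected (snd ` T')" using T'(1) by (intro connected_continuous_image continuous_on_snd continuous_on_id)
      moreover have "c \<in> snd ` T'" using T'(3) by force
      moreover have "snd z \<in> snd ` T'" using z by simp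
      ultimately have "t \<in> snd ` T'" using t hc unfolding connected_iff_interval by (meson less_imp_le order_trans)
      then show False using T'(2) t by (auto simp: S_def)
    qed
  qed
  have Tcomp: "T \<in> components S"
    unfolding in_components_maximal
  proof (intro conjI allI impI)
    fix d assume d: "d \<noteq> {} \<and> T \<subseteq> d \<and> d \<subseteq> S \<and> connected d"
    then have "d \<subseteq> T" using maxi[of d] pc by auto
    then show "d = T" using d by auto
  qed (use pc TS conn in auto)
  have the: "(THE T. T \<in> components S \<and> {(a, b) \<in> S. b \<le> c} \<subseteq> T) = T"
  proof (rule the_equality)
    show "T \<in> components S \<and> {(a, b) \<in> S. b \<le> c} \<subseteq> T" using Tcomp hc by (auto simp: T_def)
    fix T' assume T': "T' \<in> components S \<and> {(a, b) \<in> S. b \<le> c} \<subseteq> T'"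
    have "(L c, c) \<in> T'" using T' lt by (auto simp: S_def)
    then show "T' = T" using components_nonoverlap[of T' S T] T' Tcomp pc by auto
  qed
  have great: "(GREATEST b. \<exists>a. (a, b) \<in> T) = h"
    by (rule Greatest_equality) (use hle in \<open>auto simp: T_def S_def\<close>)
  show ?thesis
  proof (rule that[OF hc' heq])
    show "\<forall>b\<le>h. L b \<le> U b" using LU by blast
    show "(THE T. T \<in> components S \<and> {(a, b) \<in> S. b \<le> c} \<subseteq> T) = {(a, b) \<in> S. b \<le> h}"
      using the by (simp add: T_def)
    show "(GREATEST b. \<exists>a. (a, b) \<in> {(a, b) \<in> S. b \<le> h}) = h" using great by (simp add: T_def)
  qed
qed

section \<open>Hausdorff distance of the monotone bounds\<close>

lemma closed_graph:
  fixes g :: "real \<Rightarrow> real"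
  assumes "continuous_on UNIV g" shows "closed (graph_of g)"
proof -
  have "graph_of g = {z. snd z = g (fst z)}" by (auto simp: graph_of_def)
  moreover have "closed {z::real \<times> real. snd z = g (fst z)}"
    by (intro closed_Collect_eq continuous_on_snd continuous_on_id continuous_on_compose2[OF assms] continuous_on_fst) auto
  ultimately show ?thesis by simp
qed

lemma infdist_graph_le:
  fixes g h :: "real \<Rightarrow> real"
  assumes "\<And>x. \<bar>g x - h x\<bar> \<le> M" and z: "z \<in> graph_of g"
  shows "infdist z (graph_of h) \<le> M"
proof -
  obtain x where x: "z = (x, g x)" using z by (auto simp: graph_of_def)
  have "(x, h x) \<in> graph_of h" by (auto simp: graph_of_def)
  then have "infdist z (graph_of h) \<le> dist z (x, h x)" by (rule infdist_le)
  also have "\<dots> = \<bar>g x - h x\<bar>" by (simp add: x dist_Pair_Pair dist_real_def)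
  finally show ?thesis using assms(1)[of x] by simp
qed

lemma graph_of_nonempty: "graph_of g \<noteq> {}"
  by (auto simp: graph_of_def)

lemma lower_le_upper: "degree_one_lift f \<Longrightarrow> lower_bound f x \<le> upper_bound f x"
  using lower_bound_le[of f x x] upper_bound_ge[of f x x] by simp

lemma Delta_le:
  assumes f: "degree_one_lift f" and M: "\<And>x. upper_bound f x - lower_bound f x \<le> M"
  shows "Delta f \<le> M"
proof -
  have abs: "\<bar>lower_bound f x - upper_bound f x\<bar> \<le> M" "\<bar>upper_bound f x - lower_bound f x\<bar> \<le> M" for x
    using M[of x] lower_le_upper[OF f, of x] by simp_all
  show ?thesis unfolding Delta_def hausdorff_distance_def
    by (intro max.boundedI cSUP_least graph_of_nonempty infdist_graph_le[OF abs(1)] infdist_graph_le[OF abs(2)])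
qed

lemma bounds_bounded:
  assumes f: "degree_one_lift f"
  obtains M where "\<And>x. upper_bound f x - lower_bound f x \<le> M"
proof -
  interpret G: deg_one_mono "upper_bound f" by (rule deg_one_mono_upper[OF f])
  interpret H: deg_one_mono "lower_bound f" by (rule deg_one_mono_lower[OF f])
  have "\<exists>y\<in>{0..1}. \<forall>x\<in>{0..1}. upper_bound f x - lower_bound f x \<le> upper_bound f y - lower_bound f y"
    by (rule continuous_attains_sup[OF compact_Icc])
       (auto intro!: continuous_on_diff continuous_upper_bound[OF f] continuous_lower_bound[OF f])
  then obtain y where y: "\<And>x. x \<in> {0..1} \<Longrightarrow> upper_bound f x - lower_bound f x \<le> upper_bound f y - lower_bound f y"
    by blast
  have "upper_bound f x - lower_bound f x \<le> upper_bound f y - lower_bound f y" for x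
  proof -
    have "x + of_int (- \<lfloor>x\<rfloor>) \<in> {0..1}" by (auto, linarith)
    from y[OF this] show ?thesis
      using G.funpow_int[of 1 x "- \<lfloor>x\<rfloor>"] H.funpow_int[of 1 x "- \<lfloor>x\<rfloor>"] by simp
  qed
  then show ?thesis by (rule that)
qed

lemma Delta_bounds:
  assumes f: "degree_one_lift f"
  shows "infdist (x, lower_bound f x) (graph_of (upper_bound f)) \<le> Delta f"
proof -
  obtain M where M: "\<And>x. upper_bound f x - lower_bound f x \<le> M" using bounds_bounded[OF f] by blast
  have abs: "\<bar>lower_bound f x - upper_bound f x\<bar> \<le> M" for x
    using M[of x] lower_le_upper[OF f, of x] by simp
  have "bdd_above ((\<lambda>z. infdist z (graph_of (upper_bound f))) ` graph_of (lower_bound f))"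
    by (rule bdd_aboveI2[of _ _ M]) (rule infdist_graph_le[OF abs])
  then have "infdist (x, lower_bound f x) (graph_of (upper_bound f))
      \<le> (SUP z\<in>graph_of (lower_bound f). infdist z (graph_of (upper_bound f)))"
    by (intro cSUP_upper) (auto simp: graph_of_def)
  then show ?thesis unfolding Delta_def hausdorff_distance_def by simp
qed

lemma Delta_nonneg: "degree_one_lift f \<Longrightarrow> 0 \<le> Delta f"
  using Delta_bounds[of f 0] infdist_nonneg order_trans by blast

text \<open>The graph of the continuous upper bound is closed, so distance \<open>0\<close> places
  the graph of the lower bound on it; \<open>f\<close> is then squeezed between two equal monotone
  maps.\<close>

lemma Delta_eq_0_iff:
  assumes f: "degree_one_lift f" shows "Delta f = 0 \<longleftrightarrow> mono f"
proof
  assume 0: "Delta f = 0"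
  have "lower_bound f x = upper_bound f x" for x
  proof -
    have "infdist (x, lower_bound f x) (graph_of (upper_bound f)) = 0"
      using Delta_bounds[OF f, of x] 0 infdist_nonneg[of "(x, lower_bound f x)" "graph_of (upper_bound f)"] by simp
    then have "(x, lower_bound f x) \<in> graph_of (upper_bound f)"
      using in_closed_iff_infdist_zero[OF closed_graph[OF continuous_upper_bound[OF f]] graph_of_nonempty] by blast
    then show ?thesis by (auto simp: graph_of_def)
  qed
  note eq = this
  have "f x = upper_bound f x" for x
    using lower_bound_le[OF f, of x x] upper_bound_ge[OF f, of x x] eq[of x] by simp
  then have "f = upper_bound f" by (rule ext)
  then show "mono f" using mono_upper_bound[OF f] by simp
next
  assume "mono f"
  then have "upper_bound f x - lower_bound f x \<le> 0" for x by (simp add: upper_bound_mono lower_bound_mono)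
  then show "Delta f = 0" using Delta_le[OF f, of 0] Delta_nonneg[OF f] by simp
qed

text \<open>A monotone map that takes equal values at two points is constant between them, against
  piecewise strict monotonicity. Surjectivity is the intermediate value theorem for a map of degree
  one.\<close>

lemma bij_of_mono:
  assumes f: "degree_one_lift f" and mono: "mono f" and pm: "piecewise_strictly_monotone f"
  shows "bij f"
proof (rule bijI)
  have sm: "f x < f y" if xy: "x < y" for x y
  proof (rule ccontr)
    assume "\<not> ?thesis"
    then have eq: "f z = f x" if "z \<in> {x..y}" for z
      using monoD[OF mono, of x z] monoD[OF mono, of z y] that by auto
    obtain S where S: "finite S" "\<And>c d. c < d \<Longrightarrow> {c<..<d} \<subseteq> {x..y} - S \<Longrightarrow>
        strict_mono_on {c..d} f \<or> strict_antimono_on {c..d} f"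
      using pm unfolding piecewise_strictly_monotone_def by (metis (no_types))
    \<comment> \<open>\<open>d\<close> is the first exceptional point after \<open>x\<close>, capped
      at \<open>y\<close>, so that \<open>{x<..<d}\<close> avoids \<open>S\<close>.\<close>
    define d where "d = Min (insert y {s \<in> S. x < s})"
    have d: "x < d" "d \<le> y" unfolding d_def using S(1) xy by auto
    have "{x<..<d} \<subseteq> {x..y} - S"
    proof
      fix z assume z: "z \<in> {x<..<d}"
      have "z \<notin> S"
      proof
        assume "z \<in> S"
        then have "d \<le> z" unfolding d_def using S(1) z by (intro Min_le) auto
        then show False using z by simp
      qed
      then show "z \<in> {x..y} - S" using z d by auto
    qed
    from S(2)[OF d(1) this] have "f x \<noteq> f d"
      using d(1) monotone_onD[of "{x..d}" "(<)" "(<)" f x d] monotone_onD[of "{x..d}" "(<)" "(>)" f x d] by auto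
    then show False using eq[of d] d by simp
  qed
  then show "inj f" by (intro linorder_injI) (metis less_irrefl)
  show "surj f"
    unfolding surj_def
  proof (rule allI)
    fix y
    have "f (0 + of_int (\<lfloor>y - f 0\<rfloor>)) \<le> y" "y \<le> f (0 + of_int (\<lfloor>y - f 0\<rfloor> + 1))"
      unfolding lift_int[OF f] by linarith+
    from IVT_unordered[OF lift_cont[OF f] this] obtain v where "f v = y" .
    then show "\<exists>x. y = f x" by (intro exI[of _ v]) simp
  qed
qed

section \<open>Families in Class N\<close>

locale family_N =
  fixes F :: "real \<Rightarrow> real \<Rightarrow> real \<Rightarrow> real"
  assumes N: "class_N F"
begin

abbreviation f where "f \<equiv> F 0"

lemma N_class_B: "\<forall>a b. class_B (F a b)"
  and N_uniform: "\<forall>a b. uniform_limit UNIV (\<lambda>(a', b'). F a' b') (F a b) (at (a, b))"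
  and N_translate: "\<forall>a b x. F a b x = F 0 b x + a"
  and N_mono: "mono (\<lambda>b. Delta (F 0 b))"
  and N_zero: "\<exists>b. Delta (F 0 b) = 0"
  and N_one: "\<exists>b. Delta (F 0 b) > 1"
  and N_origin: "normalised_origin F"
  using N unfolding class_N_def by - (elim conjE, assumption)+

lemma class_B: "class_B (F a b)"
  by (rule N_class_B[THEN spec, THEN spec])

lemma translate: "F a b = (\<lambda>x. f b x + a)"
  by (rule ext) (rule N_translate[THEN spec, THEN spec, THEN spec])

lemma lift: "degree_one_lift (f b)"
  using class_B by (auto simp: class_B_def)

lemma uniformly_close:
  assumes "e > 0" shows "eventually (\<lambda>b'. \<forall>x. \<bar>f b' x - f b x\<bar> < e) (nhds b)"
proof -
  have "uniform_limit UNIV (\<lambda>(a', b'). F a' b') (f b) (at (0, b))"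
    by (rule N_uniform[THEN spec, THEN spec])
  then have ev: "eventually (\<lambda>z. \<forall>x. dist ((case z of (a', b') \<Rightarrow> F a' b') x) (f b x) < e) (at (0, b))"
    using assms by (auto simp: uniform_limit_iff)
  \<comment> \<open>The two-parameter limit is restricted to the line \<open>a = 0\<close>. The
    punctured neighbourhood can be filled in afterwards, since the distance at \<open>b\<close>
    itself is \<open>0\<close>.\<close>
  have "filterlim (\<lambda>b'. (0::real, b')) (at (0, b)) (at b)"
    unfolding filterlim_at
  proof (intro conjI)
    show "((\<lambda>b'. (0, b')) \<longlongrightarrow> (0, b)) (at b)" by (intro tendsto_intros)
    show "eventually (\<lambda>b'. (0, b') \<in> UNIV \<and> (0, b') \<noteq> (0, b)) (at b)"
      by (simp add: eventually_at_filter)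
  qed
  then have "eventually (\<lambda>b'. \<forall>x. dist (f b' x) (f b x) < e) (at b)"
    using ev by (auto simp: filterlim_iff)
  then show ?thesis using assms by (auto simp: eventually_at_filter dist_real_def elim: eventually_mono)
qed

abbreviation L where "L q p b \<equiv> lock_start (lower_bound (f b)) q (real p)"
abbreviation U where "U q p b \<equiv> lock_end (upper_bound (f b)) q (real p)"

lemma continuous_of_perturb:
  assumes key: "\<And>s t e. (\<And>x. \<bar>f s x - f t x\<bar> < e) \<Longrightarrow> \<phi> s \<le> \<phi> t + (e::real)"
  shows "continuous_on UNIV \<phi>"
proof (rule continuous_at_imp_continuous_on, rule ballI)
  fix b
  show "isCont \<phi> b"
    unfolding isCont_def tendsto_iff
  proof (intro allI impI)
    fix e :: real assume "e > 0"
    then have "eventually (\<lambda>b'. \<forall>x. \<bar>f b' x - f b x\<bar> < e / 2) (at b)"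
      using uniformly_close[of "e / 2" b] by (simp add: eventually_at_filter eventually_mono)
    then show "eventually (\<lambda>b'. dist (\<phi> b') (\<phi> b) < e) (at b)"
    proof eventually_elim
      case (elim b')
      have "\<And>x. \<bar>f b x - f b' x\<bar> < e / 2" using elim by (simp add: abs_minus_commute)
      then show ?case using key[of b' b "e / 2"] key[of b b' "e / 2"] elim \<open>e > 0\<close>
        by (auto simp: dist_real_def)
    qed
  qed
qed

lemma continuous_U: assumes q: "q > 0" shows "continuous_on UNIV (U q p)"
proof (rule continuous_of_perturb)
  fix s t e assume st: "\<And>x. \<bar>f s x - f t x\<bar> < e"
  have "upper_bound (f t) x \<le> upper_bound (f s) x + e" for x
    by (rule upper_bound_le_add[OF lift lift]) (use st in \<open>smt (verit)\<close>)
  from lock_end_perturb[OF deg_one_mono_upper[OF lift] continuous_upper_bound[OF lift]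
      deg_one_mono_upper[OF lift] continuous_upper_bound[OF lift] q this]
  show "U q p s \<le> U q p t + e" by (simp add: diff_le_eq)
qed

lemma continuous_L: assumes q: "q > 0" shows "continuous_on UNIV (L q p)"
proof (rule continuous_of_perturb)
  fix s t e assume st: "\<And>x. \<bar>f s x - f t x\<bar> < e"
  have "lower_bound (f t) x \<le> lower_bound (f s) x + e" for x
    by (rule lower_bound_le_add[OF lift lift]) (use st in \<open>smt (verit)\<close>)
  from lock_start_perturb[OF deg_one_mono_lower[OF lift] continuous_lower_bound[OF lift]
      deg_one_mono_lower[OF lift] continuous_lower_bound[OF lift] q this]
  show "L q p s \<le> L q p t + e" .
qed

lemma Lock_eq:
  assumes "q > 0" "p \<le> q"
  shows "Lock F (real p / real q) = {(a, b). L q p b \<le> a \<and> a \<le> U q p b}"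
proof -
  have "Rot (F a b) = {real p / real q} \<longleftrightarrow> L q p b \<le> a \<and> a \<le> U q p b" for a b
    unfolding translate[of a b] by (rule Rot_eq_iff[OF lift assms])
  then show ?thesis unfolding Lock_def by simp
qed

abbreviation bc where "bc \<equiv> critical_height F"

text \<open>\<open>Delta\<close> vanishes exactly for monotone lifts, and monotonicity passes to
  uniform limits. Hence the zero set contains its supremum, and the GREATEST in
  \<open>critical_height\<close> is attained.\<close>

lemma Delta_zero_set: "Delta (f b) = 0 \<longleftrightarrow> b \<le> bc"
proof -
  define Z where "Z = {b. Delta (f b) = 0}"
  have mono: "mono (\<lambda>b. Delta (f b))" by (rule N_mono)
  obtain b0 b1 where b0: "Delta (f b0) = 0" and b1: "Delta (f b1) > 1"
    using N_zero N_one by blast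
  have ne: "Z \<noteq> {}" using b0 by (auto simp: Z_def)
  have down: "t \<in> Z" if "s \<in> Z" "t \<le> s" for s t
    using monoD[OF mono that(2)] that(1) Delta_nonneg[OF lift, of t] by (simp add: Z_def)
  have bdd: "bdd_above Z"
  proof (rule bdd_aboveI[of _ b1])
    fix b assume "b \<in> Z"
    then show "b \<le> b1" using monoD[OF mono, of b1 b] b1 by (cases "b \<le> b1") (auto simp: Z_def)
  qed
  have "mono (f (Sup Z))"
  proof (rule monoI)
    fix x y :: real assume xy: "x \<le> y"
    show "f (Sup Z) x \<le> f (Sup Z) y"
    proof (rule field_le_epsilon)
      fix e :: real assume e: "e > 0"
      then obtain d where d: "d > 0" "\<And>b'. dist b' (Sup Z) < d \<Longrightarrow> \<forall>x. \<bar>f b' x - f (Sup Z) x\<bar> < e / 2"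
        using uniformly_close[of "e / 2" "Sup Z"] unfolding eventually_nhds_metric by auto
      obtain b where b: "b \<in> Z" "Sup Z - d < b" using less_cSup_iff[OF ne bdd, of "Sup Z - d"] d by auto
      have "b \<le> Sup Z" by (rule cSup_upper[OF b(1) bdd])
      then have cl: "\<bar>f b z - f (Sup Z) z\<bar> < e / 2" for z using d(2)[of b] b by (auto simp: dist_real_def)
      have "f b x \<le> f b y"
        using b(1) xy Delta_eq_0_iff[OF lift, of b] by (auto simp: Z_def dest: monoD)
      then show "f (Sup Z) x \<le> f (Sup Z) y + e" using cl[of x] cl[of y] by linarith
    qed
  qed
  then have SZ: "Sup Z \<in> Z" using Delta_eq_0_iff[OF lift] by (simp add: Z_def)
  have "bc = Sup Z" unfolding critical_height_def
    by (rule Greatest_equality) (use SZ cSup_upper[OF _ bdd] in \<open>auto simp: Z_def\<close>)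
  moreover have "b \<in> Z \<longleftrightarrow> b \<le> Sup Z" using down[OF SZ] cSup_upper[OF _ bdd] by blast
  ultimately show ?thesis by (simp add: Z_def)
qed

lemma mono_f: "b \<le> bc \<Longrightarrow> mono (f b)"
  using Delta_zero_set Delta_eq_0_iff[OF lift] by blast

lemma bimodal_f:
  assumes "bc < b" obtains C K Km Cp where "bimodal (f b) C K Km Cp"
proof -
  have "normalised_two_turning_points (f b)" using N_origin assms by (auto simp: normalised_origin_def)
  then show ?thesis using bimodal_of_class_B[OF class_B] that by blast
qed

text \<open>Turns the invertible parameters in \<open>Lock_I\<close> into the part of the region
  with \<open>b \<le> bc\<close>, the form in which its component was determined.\<close>

lemma bij_iff: "bij (F a b) \<longleftrightarrow> b \<le> bc"
proof
  assume "b \<le> bc"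
  then have "mono (F a b)" using mono_f[of b] unfolding translate[of a b] by (auto simp: mono_def)
  moreover have "degree_one_lift (F a b)" "piecewise_strictly_monotone (F a b)"
    using class_B[of a b] by (auto simp: class_B_def)
  ultimately show "bij (F a b)" by (intro bij_of_mono)
next
  assume bij: "bij (F a b)"
  show "b \<le> bc"
  proof (rule ccontr)
    assume "\<not> ?thesis"
    then have "bc < b" by simp
    then obtain C K Km Cp where "bimodal (f b) C K Km Cp" by (rule bimodal_f)
    then interpret bimodal "f b" C K Km Cp .
    have "inj (\<lambda>x. f b x + a)" using bij unfolding translate[of a b] by (rule bij_is_inj)
    then have "inj (f b)" by (auto simp: inj_def)
    then show False using not_inj by simp
  qed
qed

text \<open>Up to the critical line both bounds are \<open>f\<close> itself. For any
  \<open>a\<close> some displacement is at most \<open>p\<close> or at least \<open>p\<close>, so no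
  \<open>a\<close> can lie above the right end and below the left one.\<close>

lemma L_le_U: assumes b: "b \<le> bc" and q: "q > 0" shows "L q p b \<le> U q p b"
proof (rule ccontr)
  assume n: "\<not> ?thesis"
  define a where "a = (L q p b + U q p b) / 2"
  have a: "U q p b < a" "a < L q p b" using n by (auto simp: a_def)
  have e: "upper_bound (f b) = f b" "lower_bound (f b) = f b"
    using mono_f[OF b] by (auto intro: upper_bound_mono lower_bound_mono)
  have d: "deg_one_mono (f b)" using deg_one_mono_upper[OF lift, of b] e by simp
  have "\<not> a \<le> lock_end (f b) q (real p)" "\<not> lock_start (f b) q (real p) \<le> a" using a unfolding e by auto
  then show False
    unfolding deg_one_mono.le_lock_end_iff[OF d lift_cont[OF lift] q]
      deg_one_mono.lock_start_le_iff[OF d lift_cont[OF lift] q]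
    by (meson linear)
qed

text \<open>Equality would make the \<open>q\<close>-th iterate the translation by \<open>p\<close>,
  with derivative \<open>1\<close> everywhere; at the critical point the chain rule gives
  \<open>0\<close>.\<close>

lemma L_less_U: assumes q: "q > 0" shows "L q p bc < U q p bc"
proof (rule ccontr)
  assume "\<not> ?thesis"
  then have eq: "L q p bc = U q p bc" using L_le_U[OF order_refl q, of p] by simp
  define a where "a = U q p bc"
  define g where "g = (\<lambda>x. f bc x + a)"
  have e: "upper_bound (f bc) = f bc" "lower_bound (f bc) = f bc"
    using mono_f[of bc] by (auto intro: upper_bound_mono lower_bound_mono)
  have d: "deg_one_mono (f bc)" using deg_one_mono_upper[OF lift, of bc] e by simp
  have gq: "(g ^^ q) x = x + real p" for x
    using deg_one_mono.lock_end_ge[OF d lift_cont[OF lift] q, of x p]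
      deg_one_mono.lock_start_le[OF d lift_cont[OF lift] q, of p x] eq
    unfolding e a_def g_def by simp
  obtain c where c: "deriv (f bc) c = 0"
    using N_origin unfolding normalised_origin_def critical_points_def by blast
  have diff: "f bc differentiable at x" for x
    using class_B[of 0 bc] unfolding class_B_def C3_def
    by (metis differentiable_on_def UNIV_I funpow_0 zero_less_numeral)
  have Dg: "(g has_real_derivative deriv (f bc) x) (at x)" for x
    using diff[of x] unfolding g_def DERIV_deriv_iff_real_differentiable[symmetric]
    by (auto intro!: derivative_eq_intros)
  have "\<exists>D. ((g ^^ n) has_real_derivative D) (at x)" for n x
  proof (induction n)
    case 0 then show ?case by (auto simp: id_def intro!: exI[of _ 1])
  next
    case (Suc n)
    then obtain D where "((g ^^ n) has_real_derivative D) (at x)" by blast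
    from DERIV_chain[OF Dg this] show ?case unfolding funpow.simps(2) by blast
  qed
  then obtain D where D: "((g ^^ (q - 1)) has_real_derivative D) (at (g c))" by blast
  have "((g ^^ (q - 1)) \<circ> g has_real_derivative D * deriv (f bc) c) (at c)"
    by (rule DERIV_chain[OF D Dg])
  moreover have "(g ^^ (q - 1)) \<circ> g = (\<lambda>x. x + real p)"
    using gq q by (cases q) (auto simp: fun_eq_iff funpow_swap1)
  ultimately have "((\<lambda>x. x + real p) has_real_derivative 0) (at c)" using c by simp
  moreover have "((\<lambda>x. x + real p) has_real_derivative 1) (at c)" by (auto intro!: derivative_eq_intros)
  ultimately show False using DERIV_unique by fastforce
qed

section \<open>Existence and comparison of reduced heights\<close>

lemma root_unlocked_somewhere:
  obtains b1 where "bc < b1" "U 1 1 b1 < L 1 1 b1"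
proof -
  obtain b where b: "Delta (f b) > 1" using N_one by blast
  have bcb: "bc < b" using Delta_zero_set[of b] b by simp
  then obtain C K Km Cp where "bimodal (f b) C K Km Cp" by (rule bimodal_f)
  then interpret bimodal "f b" C K Km Cp .
  have gap: "f b C > f b K + 1"
  proof (rule ccontr)
    assume "\<not> ?thesis"
    then have "G x - H x \<le> 1" for x using bounds_gap[of x] by simp
    then show False using Delta_le[OF lift, of 1] b by simp
  qed
  have "U 1 1 b < L 1 1 b"
  proof (rule ccontr)
    assume "\<not> ?thesis"
    then have le: "L 1 1 b \<le> U 1 1 b" by simp
    define a where "a = L 1 1 b"
    interpret T: bimodal "\<lambda>x. f b x + a" C K Km Cp by (rule bimodal_add)
    have GT: "T.G x = G x + a" and HT: "T.H x = H x + a" for x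
      using upper_bound_add[OF lift] lower_bound_add[OF lift] by auto
    obtain y where "H y + a = y + 1"
      using Hm.lock_start_touch[OF continuous_lower_bound[OF lift], of 1 1] by (auto simp: a_def)
    moreover obtain x where "G x + a \<le> x + 1"
      using le Gm.le_lock_end_iff[OF continuous_upper_bound[OF lift], of 1 a 1] by (auto simp: a_def)
    moreover have "H z + a \<le> z + 1" for z
      using Hm.lock_start_le[OF continuous_lower_bound[OF lift], of 1 1 z] by (auto simp: a_def)
    ultimately show False using T.root_unlocked[of y x] gap by (simp add: GT HT)
  qed
  then show ?thesis using that bcb by blast
qed

lemma root_zero_unlocked_somewhere:
  obtains b1 where "bc < b1" "U 1 0 b1 < L 1 0 b1"
proof -
  obtain b where b: "bc < b" "U 1 1 b < L 1 1 b" by (rule root_unlocked_somewhere)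
  have "U 1 1 b = U 1 0 b + 1"
    using deg_one_mono.lock_end_shift[OF deg_one_mono_upper[OF lift[of b]] continuous_upper_bound[OF lift], of 1 0] by simp
  moreover have "L 1 1 b = L 1 0 b + 1"
    using deg_one_mono.lock_start_shift[OF deg_one_mono_lower[OF lift[of b]] continuous_lower_bound[OF lift], of 1 0] by simp
  ultimately show ?thesis using that b by simp
qed

text \<open>Without an empty interval above the critical line, the GREATEST in
  \<open>reduced_height\<close> would range over unbounded heights.\<close>

definition bounded_lock where
  "bounded_lock q p \<longleftrightarrow> (\<exists>b1 > bc. U q p b1 < L q p b1)"

lemma height_exists:
  assumes "q > 0" "p \<le> q" "bounded_lock q p"
  obtains h where "bc < h" "L q p h = U q p h" "reduced_height F (real p / real q) = h"
    "\<forall>b\<le>h. L q p b \<le> U q p b"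
proof -
  obtain b1 where b1: "bc < b1" "U q p b1 < L q p b1" using assms by (auto simp: bounded_lock_def)
  obtain h where h: "bc < h" "L q p h = U q p h" "\<forall>b\<le>h. L q p b \<le> U q p b"
    "(THE T. T \<in> components {(a, b). L q p b \<le> a \<and> a \<le> U q p b} \<and>
      {(a, b) \<in> {(a, b). L q p b \<le> a \<and> a \<le> U q p b}. b \<le> bc} \<subseteq> T) =
      {(a, b) \<in> {(a, b). L q p b \<le> a \<and> a \<le> U q p b}. b \<le> h}"
    "(GREATEST b. \<exists>a. (a, b) \<in> {(a, b) \<in> {(a, b). L q p b \<le> a \<and> a \<le> U q p b}. b \<le> h}) = h"
    by (rule component_between_curves[OF continuous_L[OF assms(1)] continuous_U[OF assms(1)]
          L_le_U[OF _ assms(1)] L_less_U[OF assms(1)] b1])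
  have "Lock_I F (real p / real q) = {(a, b) \<in> {(a, b). L q p b \<le> a \<and> a \<le> U q p b}. b \<le> h}"
    unfolding Lock_I_def bij_iff Lock_eq[OF assms(1,2)] by (rule h(4))
  then have "reduced_height F (real p / real q) = h"
    unfolding reduced_height_def using h(5) by simp
  then show ?thesis using that h by blast
qed

text \<open>The child's interval is nonempty at all levels up to the child's height, but empty at
  the parent's height. The same emptiness guarantees that the child has a height.\<close>

lemma height_less:
  assumes q: "q > 0" "p \<le> q" "bounded_lock q p" and q': "q' > 0" "p' \<le> q'"
    and child: "\<And>b. bc < b \<Longrightarrow> L q p b = U q p b \<Longrightarrow> U q' p' b < L q' p' b"
  shows "bounded_lock q' p'" "reduced_height F (real p' / real q') < reduced_height F (real p / real q)"
proof -
  obtain h where h: "bc < h" "L q p h = U q p h" "reduced_height F (real p / real q) = h"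
    "\<forall>b\<le>h. L q p b \<le> U q p b"
    by (rule height_exists[OF q])
  have lt: "U q' p' h < L q' p' h" by (rule child[OF h(1,2)])
  then show b: "bounded_lock q' p'" using h(1) by (auto simp: bounded_lock_def)
  obtain h' where h': "bc < h'" "L q' p' h' = U q' p' h'" "reduced_height F (real p' / real q') = h'"
    "\<forall>b\<le>h'. L q' p' b \<le> U q' p' b"
    by (rule height_exists[OF q' b])
  show "reduced_height F (real p' / real q') < reduced_height F (real p / real q)"
    using h'(4) lt h(3) h'(3) by (cases "h \<le> h'") auto
qed

lemma left_child:
  assumes q: "q > 0" and farey: "p * q1 = p1 * q + 1"
    and le: "p1 \<le> p" "q1 \<le> q" "q1 < q \<Longrightarrow> p1 \<le> q1 \<and> p - p1 \<le> q - q1"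
    and b: "bc < b" and eq: "L q p b = U q p b"
  shows "U (q + q1) (p + p1) b < L (q + q1) (p + p1) b"
proof (rule ccontr)
  assume "\<not> ?thesis"
  then have child: "L (q + q1) (p + p1) b \<le> U (q + q1) (p + p1) b" by simp
  define a0 where "a0 = U q p b"
  \<comment> \<open>The left end of the child's interval is chosen, because there
    \<open>H + a1\<close> satisfies the required upper bound at every point and attains it.\<close>
  define a1 where "a1 = L (q + q1) (p + p1) b"
  obtain C K Km Cp where "bimodal (f b) C K Km Cp" by (rule bimodal_f[OF b])
  then interpret bimodal "f b" C K Km Cp .
  interpret T: bimodal "\<lambda>x. f b x + a0" C K Km Cp by (rule bimodal_add)
  have GT: "T.G = (\<lambda>x. G x + a0)" and HT: "T.H = (\<lambda>x. H x + a0)"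
    using upper_bound_add[OF lift] lower_bound_add[OF lift] by auto
  note cG = continuous_upper_bound[OF lift] and cH = continuous_lower_bound[OF lift]
  have q': "q + q1 > 0" using q by simp
  obtain x where x: "((\<lambda>x. G x + a1) ^^ (q + q1)) x \<le> x + real (p + p1)"
    using child Gm.le_lock_end_iff[OF cG q', of a1 "real (p + p1)"] by (auto simp: a1_def)
  obtain y where y: "((\<lambda>x. H x + a1) ^^ (q + q1)) y = y + real (p + p1)"
    using Hm.lock_start_touch[OF cH q', of "real (p + p1)"] unfolding a1_def by blast
  show False
  proof (rule T.left_child_unlocked[OF farey, of "q - q1" "p - p1" "a1 - a0" y x])
    show "x + real p \<le> (T.G ^^ q) x" for x
      unfolding GT unfolding a0_def by (rule Gm.lock_end_ge[OF cG q])
    show "\<exists>x. (T.G ^^ q) x = x + real p"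
      unfolding GT unfolding a0_def by (rule Gm.lock_end_touch[OF cG q])
    show "(T.H ^^ q) x \<le> x + real p" for x
      unfolding HT unfolding a0_def eq[symmetric] by (rule Hm.lock_start_le[OF cH q])
    show "\<exists>x. (T.H ^^ q) x = x + real p"
      unfolding HT unfolding a0_def eq[symmetric] by (rule Hm.lock_start_touch[OF cH q])
    show "((\<lambda>x. T.H x + (a1 - a0)) ^^ (q + q1)) x \<le> x + real (p + p1)" for x
      using Hm.lock_start_le[OF cH q', of "real (p + p1)" x] by (simp add: HT a1_def)
    show "((\<lambda>x. T.H x + (a1 - a0)) ^^ (q + q1)) y = y + real (p + p1)"
      using y by (simp add: HT)
    show "((\<lambda>x. T.G x + (a1 - a0)) ^^ (q + q1)) x \<le> x + real (p + p1)"
      using x by (simp add: GT)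
  qed (use le in auto)
qed

lemma right_child:
  assumes q: "q > 0" and farey: "p2 * q = p * q2 + 1"
    and le: "p \<le> q" "p2 \<le> q2" "q2 \<le> q" "q2 - p2 \<le> q - p" "q2 < q \<Longrightarrow> p2 \<le> p"
    and b: "bc < b" and eq: "L q p b = U q p b"
  shows "U (q + q2) (p + p2) b < L (q + q2) (p + p2) b"
proof (rule ccontr)
  assume "\<not> ?thesis"
  then have child: "L (q + q2) (p + p2) b \<le> U (q + q2) (p + p2) b" by simp
  define a0 where "a0 = U q p b"
  \<comment> \<open>After the reflection the right end takes the place of the left end.\<close>
  define a1 where "a1 = U (q + q2) (p + p2) b"
  obtain C K Km Cp where "bimodal (f b) C K Km Cp" by (rule bimodal_f[OF b])
  then interpret bimodal "f b" C K Km Cp .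
  interpret T: bimodal "\<lambda>x. f b x + a0" C K Km Cp by (rule bimodal_add)
  have GT: "T.G = (\<lambda>x. G x + a0)" and HT: "T.H = (\<lambda>x. H x + a0)"
    using upper_bound_add[OF lift] lower_bound_add[OF lift] by auto
  note cG = continuous_upper_bound[OF lift] and cH = continuous_lower_bound[OF lift]
  have q': "q + q2 > 0" using q by simp
  obtain x where x: "((\<lambda>x. H x + a1) ^^ (q + q2)) x \<ge> x + real (p + p2)"
    using child Hm.lock_start_le_iff[OF cH q', of "real (p + p2)" a1] by (auto simp: a1_def)
  obtain y where y: "((\<lambda>x. G x + a1) ^^ (q + q2)) y = y + real (p + p2)"
    using Gm.lock_end_touch[OF cG q', of "real (p + p2)"] unfolding a1_def by blast
  show False
  proof (rule T.right_child_unlocked[OF farey le, of "a1 - a0" y x])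
    show "x + real p \<le> (T.G ^^ q) x" for x
      unfolding GT unfolding a0_def by (rule Gm.lock_end_ge[OF cG q])
    show "\<exists>x. (T.G ^^ q) x = x + real p"
      unfolding GT unfolding a0_def by (rule Gm.lock_end_touch[OF cG q])
    show "(T.H ^^ q) x \<le> x + real p" for x
      unfolding HT unfolding a0_def eq[symmetric] by (rule Hm.lock_start_le[OF cH q])
    show "\<exists>x. (T.H ^^ q) x = x + real p"
      unfolding HT unfolding a0_def eq[symmetric] by (rule Hm.lock_start_touch[OF cH q])
    show "((\<lambda>x. T.G x + (a1 - a0)) ^^ (q + q2)) x \<ge> x + real (p + p2)" for x
      using Gm.lock_end_ge[OF cG q', of x "real (p + p2)"] by (simp add: GT a1_def)
    show "((\<lambda>x. T.G x + (a1 - a0)) ^^ (q + q2)) y = y + real (p + p2)"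
      using y by (simp add: GT)
    show "((\<lambda>x. T.H x + (a1 - a0)) ^^ (q + q2)) x \<ge> x + real (p + p2)"
      using x by (simp add: HT)
  qed
qed

end

section \<open>The Farey tree\<close>

lemma quotient_of_props:
  assumes "quotient_of r = (p, q)"
  shows "q > 0" "coprime p q" "r = of_int p / of_int q" "r = Fract p q"
  using assms quotient_of_denom_pos[of r p q] quotient_of_coprime[of r p q] quotient_of_div[of r p q]
  by (auto simp: Fract_of_int_quotient)

lemma quotient_of_FractI:
  assumes "coprime p q" "q > 0" shows "quotient_of (Fract p q) = (p, q)"
  using assms by (simp add: quotient_of_Fract)

lemma quotient_of_eqD: "quotient_of r = quotient_of s \<Longrightarrow> r = s"
  by (metis quotient_of_props(4) surj_pair)

lemma coprime_of_unimodular: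
  fixes a b c d :: int
  assumes "a * d = c * b + 1" shows "coprime a b"
proof (rule coprimeI)
  fix e assume "e dvd a" "e dvd b"
  then have "e dvd a * d - c * b" by simp
  then show "is_unit e" using assms by simp
qed

lemma unit_interval_quotient:
  assumes "quotient_of r = (p, q)" shows "r \<in> {0..1} \<longleftrightarrow> 0 \<le> p \<and> p \<le> q"
proof -
  have "r = of_int p / of_int q" "(0::rat) < of_int q" using quotient_of_props(1,3)[OF assms] by simp_all
  then show ?thesis by (simp add: zero_le_divide_iff divide_le_eq)
qed

lemma less_iff_quotient:
  assumes "quotient_of r = (p1, q1)" "quotient_of s = (p2, q2)"
  shows "r < s \<longleftrightarrow> p1 * q2 < p2 * q1"
  using assms by (simp add: rat_less_code mult.commute)

lemma farey_parentsE:
  assumes "farey_parents x r s"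
  obtains p1 q1 p2 q2 where "quotient_of r = (p1, q1)" "quotient_of s = (p2, q2)"
    "quotient_of x = (p1 + p2, q1 + q2)" "p2 * q1 = p1 * q2 + 1"
    "0 \<le> p1" "p1 \<le> q1" "0 \<le> p2" "p2 \<le> q2" "0 < q1" "0 < q2"
proof -
  obtain p1 q1 where r: "quotient_of r = (p1, q1)" by fastforce
  obtain p2 q2 where s: "quotient_of s = (p2, q2)" by fastforce
  note R = quotient_of_props[OF r] and S = quotient_of_props[OF s]
  have rs: "r \<in> {0..1}" "s \<in> {0..1}" "r < s" "\<bar>p1 * q2 - p2 * q1\<bar> = 1" "x = Fract (p1 + p2) (q1 + q2)"
    using assms r s by (auto simp: farey_parents_def farey_neighbors_def farey_sum_def)
  have lt: "p1 * q2 < p2 * q1" using rs(3) less_iff_quotient[OF r s] by simp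
  then have u: "p2 * q1 = p1 * q2 + 1" using rs(4) by linarith
  have "(p1 + p2) * q1 = p1 * (q1 + q2) + 1" using u by (simp add: algebra_simps)
  then have "coprime (p1 + p2) (q1 + q2)" by (rule coprime_of_unimodular)
  then have "quotient_of x = (p1 + p2, q1 + q2)" using R S rs(5) by (simp add: quotient_of_FractI)
  then show ?thesis
    using that[OF r s _ u] R(1) S(1) rs(1,2) unit_interval_quotient[OF r] unit_interval_quotient[OF s] by blast
qed

lemma farey_parentsI:
  assumes "quotient_of r = (p1, q1)" "quotient_of s = (p2, q2)" "p2 * q1 = p1 * q2 + 1"
    and "0 \<le> p1" "p1 \<le> q1" "0 \<le> p2" "p2 \<le> q2" and x: "x = Fract (p1 + p2) (q1 + q2)"
  shows "farey_parents x r s"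
proof -
  note R = quotient_of_props[OF assms(1)] and S = quotient_of_props[OF assms(2)]
  have "r < s" using less_iff_quotient[OF assms(1,2)] assms(3) by simp
  then show ?thesis
    using assms unit_interval_quotient[OF assms(1)] unit_interval_quotient[OF assms(2)]
    by (auto simp: farey_parents_def farey_neighbors_def farey_sum_def)
qed

text \<open>\<open>q1\<close> is an inverse of the numerator \<open>P\<close> modulo the denominator
  \<open>Q\<close> and lies strictly between \<open>0\<close> and \<open>Q\<close>. This determines
  it, and with it the other three numbers.\<close>

lemma farey_parents_unique:
  assumes "farey_parents x r s" "farey_parents x r' s'" shows "r = r'" "s = s'"
proof -
  obtain p1 q1 p2 q2 where a: "quotient_of r = (p1, q1)" "quotient_of s = (p2, q2)"
    "quotient_of x = (p1 + p2, q1 + q2)" "p2 * q1 = p1 * q2 + 1" "0 < q1" "0 < q2"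
    using farey_parentsE[OF assms(1)] by metis
  obtain p1' q1' p2' q2' where b: "quotient_of r' = (p1', q1')" "quotient_of s' = (p2', q2')"
    "quotient_of x = (p1' + p2', q1' + q2')" "p2' * q1' = p1' * q2' + 1" "0 < q1'" "0 < q2'"
    using farey_parentsE[OF assms(2)] by metis
  define P Q where "P = p1 + p2" and "Q = q1 + q2"
  have PQ: "P = p1' + p2'" "Q = q1' + q2'" using a(3) b(3) by (auto simp: P_def Q_def)
  have 1: "P * q1 = p1 * Q + 1" using a(4) by (simp add: P_def Q_def algebra_simps)
  have 2: "P * q1' = p1' * Q + 1" using b(4) unfolding PQ by (simp add: algebra_simps)
  have "P * (q1 - q1') = (p1 - p1') * Q" using 1 2 by (simp add: algebra_simps)
  then have "Q dvd P * (q1 - q1')" by simp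
  moreover have "coprime Q P" using coprime_of_unimodular[OF 1] by (simp add: coprime_commute)
  ultimately have "Q dvd q1 - q1'" by (simp add: coprime_dvd_mult_right_iff)
  moreover have "\<bar>q1 - q1'\<bar> < Q" using a b PQ by (auto simp: Q_def)
  ultimately have q: "q1 = q1'" using dvd_imp_le_int[of "q1 - q1'" Q] by (cases "q1 = q1'") auto
  have "p1 * Q = p1' * Q" using 1 2 unfolding q by linarith
  then have p: "p1 = p1'" using a by (auto simp: Q_def)
  have "p2 = p2'" "q2 = q2'" using PQ p q by (simp_all add: P_def Q_def)
  then show "r = r'" "s = s'" using a b p q by (auto intro: quotient_of_eqD)
qed

lemma farey_parents_not_root: "farey_parents x r s \<Longrightarrow> x \<noteq> 0 \<and> x \<noteq> 1"
proof -
  assume "farey_parents x r s"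
  then obtain p1 q1 p2 q2 where a: "quotient_of x = (p1 + p2, q1 + q2)" "p2 * q1 = p1 * q2 + 1"
    "0 \<le> p1" "0 \<le> p2" "0 < q1" "0 < q2"
    using farey_parentsE[of x r s] by metis
  have "0 \<le> p1 * q2" using a by (intro mult_nonneg_nonneg) auto
  then have "p2 * q1 \<noteq> 0" using a(2) by linarith
  then have "p2 \<noteq> 0" by auto
  then show ?thesis using a by auto
qed

text \<open>Passes to natural numbers and collects the inequalities that the dynamical lemmas ask of
  a left parent. At the root \<open>1/1\<close> one has \<open>q1 = q\<close>, so the guarded
  inequalities are vacuous.\<close>

lemma left_parentE:
  assumes "left_parent x r"
  obtains p q p1 q1 :: nat where "quotient_of x = (int p, int q)" "quotient_of r = (int p1, int q1)"
    "p * q1 = p1 * q + 1" "p1 \<le> p" "q1 \<le> q" "q1 < q \<longrightarrow> p1 \<le> q1 \<and> p - p1 \<le> q - q1" "q > 0" "p \<le> q"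
    "p1 \<le> q1" "q1 > 0"
  using assms unfolding left_parent_def
proof (elim disjE exE)
  fix s assume "farey_parents x r s"
  then obtain p1 q1 p2 q2 where a: "quotient_of r = (p1, q1)" "quotient_of x = (p1 + p2, q1 + q2)"
    "p2 * q1 = p1 * q2 + 1" "0 \<le> p1" "p1 \<le> q1" "0 \<le> p2" "p2 \<le> q2" "0 < q1" "0 < q2"
    using farey_parentsE[of x r s] by metis
  have n: "p1 = int (nat p1)" "q1 = int (nat q1)" "p2 = int (nat p2)" "q2 = int (nat q2)" using a by auto
  have "int (nat p2 * nat q1) = int (nat p1 * nat q2 + 1)" using a n by simp
  then have u: "nat p2 * nat q1 = nat p1 * nat q2 + 1" by linarith
  show ?thesis
  proof (rule that[of "nat p1 + nat p2" "nat q1 + nat q2" "nat p1" "nat q1"])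
    show "(nat p1 + nat p2) * nat q1 = nat p1 * (nat q1 + nat q2) + 1" using u by (simp add: algebra_simps)
  qed (use a in auto)
next
  assume "x = 1 \<and> r = 0"
  then show ?thesis by (intro that[of 1 1 0 1]) auto
qed

lemma right_parentE:
  assumes "right_parent x s"
  obtains p q p2 q2 :: nat where "quotient_of x = (int p, int q)" "quotient_of s = (int p2, int q2)"
    "p2 * q = p * q2 + 1" "p \<le> q" "p2 \<le> q2" "q2 \<le> q" "q2 - p2 \<le> q - p" "q2 < q \<longrightarrow> p2 \<le> p" "q > 0" "q2 > 0"
  using assms unfolding right_parent_def
proof (elim disjE exE)
  fix r assume "farey_parents x r s"
  then obtain p1 q1 p2 q2 where a: "quotient_of s = (p2, q2)" "quotient_of x = (p1 + p2, q1 + q2)"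
    "p2 * q1 = p1 * q2 + 1" "0 \<le> p1" "p1 \<le> q1" "0 \<le> p2" "p2 \<le> q2" "0 < q1" "0 < q2"
    using farey_parentsE[of x r s] by metis
  have n: "p1 = int (nat p1)" "q1 = int (nat q1)" "p2 = int (nat p2)" "q2 = int (nat q2)" using a by auto
  have "int (nat p2 * nat q1) = int (nat p1 * nat q2 + 1)" using a n by simp
  then have u: "nat p2 * nat q1 = nat p1 * nat q2 + 1" by linarith
  show ?thesis
  proof (rule that[of "nat p1 + nat p2" "nat q1 + nat q2" "nat p2" "nat q2"])
    show "nat p2 * (nat q1 + nat q2) = (nat p1 + nat p2) * nat q2 + 1" using u by (simp add: algebra_simps)
    show "nat q2 - nat p2 \<le> nat q1 + nat q2 - (nat p1 + nat p2)" using a by linarith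
  qed (use a in auto)
next
  assume "x = 0 \<and> s = 1"
  then show ?thesis by (intro that[of 0 1 1 1]) auto
qed

lemma farey_sum_commute: "farey_sum r s = farey_sum s r"
  by (simp add: farey_sum_def case_prod_unfold Let_def add.commute)

text \<open>Records which of the two parents is the predecessor in the tree: the one whose
  denominator is not the smaller. This is the key to uniqueness of levels.\<close>

lemma first_child_parents:
  assumes "z \<in> first_children x"
  obtains l u where "farey_parents z l u"
    "x = u \<and> snd (quotient_of l) \<le> snd (quotient_of u) \<or> x = l \<and> snd (quotient_of u) \<le> snd (quotient_of l)"
  using assms unfolding first_children_def
proof (elim UnE CollectE exE conjE)
  fix r assume z: "z = farey_sum x r" and "left_parent x r"
  obtain p q p1 q1 :: nat where a: "quotient_of x = (int p, int q)" "quotient_of r = (int p1, int q1)"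
    "p * q1 = p1 * q + 1" "q1 \<le> q" "p \<le> q" "p1 \<le> q1"
    using left_parentE[OF \<open>left_parent x r\<close>] by metis
  have "farey_parents z r x"
  proof (rule farey_parentsI[OF a(2,1)])
    have "int (p * q1) = int (p1 * q + 1)" using a(3) by simp
    then show "int p * int q1 = int p1 * int q + 1" by simp
    show "z = Fract (int p1 + int p) (int q1 + int q)"
      unfolding z farey_sum_commute[of x r] by (simp add: farey_sum_def a)
  qed (use a in auto)
  then show ?thesis using that a by auto
next
  fix s assume z: "z = farey_sum x s" and "right_parent x s"
  obtain p q p2 q2 :: nat where a: "quotient_of x = (int p, int q)" "quotient_of s = (int p2, int q2)"
    "p2 * q = p * q2 + 1" "p \<le> q" "p2 \<le> q2" "q2 \<le> q"
    using right_parentE[OF \<open>right_parent x s\<close>] by metis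
  have "farey_parents z x s"
  proof (rule farey_parentsI[OF a(1,2)])
    have "int (p2 * q) = int (p * q2 + 1)" using a(3) by simp
    then show "int p2 * int q = int p * int q2 + 1" by simp
    show "z = Fract (int p + int p2) (int q + int q2)" unfolding z by (simp add: farey_sum_def a)
  qed (use a in auto)
  then show ?thesis using that a by auto
qed

lemma first_child_not_root: "z \<in> first_children x \<Longrightarrow> z \<noteq> 0 \<and> z \<noteq> 1"
  using first_child_parents farey_parents_not_root by metis

text \<open>Two distinct predecessors would be the two parents, with equal denominators, which
  unimodularity allows only for \<open>0/1\<close> and \<open>1/1\<close>.\<close>

lemma first_child_unique:
  assumes "z \<in> first_children x" "z \<in> first_children y"
  shows "x = y \<or> x \<in> {0, 1} \<and> y \<in> {0, 1}"
proof (cases "x = y")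
  case False
  obtain l u where 1: "farey_parents z l u"
    "x = u \<and> snd (quotient_of l) \<le> snd (quotient_of u) \<or> x = l \<and> snd (quotient_of u) \<le> snd (quotient_of l)"
    using first_child_parents[OF assms(1)] by blast
  obtain l' u' where 2: "farey_parents z l' u'"
    "y = u' \<and> snd (quotient_of l') \<le> snd (quotient_of u') \<or> y = l' \<and> snd (quotient_of u') \<le> snd (quotient_of l')"
    using first_child_parents[OF assms(2)] by blast
  have lu: "l' = l" "u' = u" using farey_parents_unique[OF 2(1) 1(1)] by auto
  obtain p1 q1 p2 q2 where a: "quotient_of l = (p1, q1)" "quotient_of u = (p2, q2)"
    "p2 * q1 = p1 * q2 + 1" "0 \<le> p1" "p1 \<le> q1" "p2 \<le> q2" "0 < q1" "0 < q2"
    using farey_parentsE[OF 1(1)] by metis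
  have "q1 = q2" using 1(2) 2(2) False a unfolding lu by auto
  then have "q1 * (p2 - p1) = 1" using a by (simp add: algebra_simps)
  then have "q1 = 1" "p2 - p1 = 1" using a by (auto simp: zmult_eq_1_iff)
  then have "q1 = 1" "q2 = 1" "p1 = 0" "p2 = 1" using a \<open>q1 = q2\<close> by auto
  then have "l = 0" "u = 1" using a quotient_of_props(3)[OF a(1)] quotient_of_props(3)[OF a(2)] by auto
  then show ?thesis using 1(2) 2(2) unfolding lu by auto
qed simp

text \<open>The only vertex with two predecessors is \<open>1/2\<close>, and both of them are at
  level \<open>0\<close>.\<close>

lemma farey_level_unique: "x \<in> farey_level_set m \<Longrightarrow> x \<in> farey_level_set n \<Longrightarrow> m = n"
proof (induction m arbitrary: n x)
  case 0
  then show ?case using first_child_not_root by (cases n) auto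
next
  case (Suc m)
  then obtain y where y: "y \<in> farey_level_set m" "x \<in> first_children y" by auto
  have "n \<noteq> 0" using Suc.prems(2) first_child_not_root[OF y(2)] by (cases n) auto
  then obtain k where n: "n = Suc k" by (cases n) auto
  then obtain w where w: "w \<in> farey_level_set k" "x \<in> first_children w" using Suc.prems(2) by auto
  show ?case
  proof (cases "y = w")
    case True then show ?thesis using Suc.IH[OF y(1)] w n by simp
  next
    case False
    then have "y \<in> farey_level_set 0" "w \<in> farey_level_set 0" using first_child_unique[OF y(2) w(2)] by auto
    have "m = 0"
      using Suc.IH[OF y(1)] \<open>y \<in> farey_level_set 0\<close> by blast
    moreover have "k = 0" using w(1) \<open>w \<in> farey_level_set 0\<close> first_child_not_root by (cases k) auto
    ultimately show ?thesis using n by simp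
  qed
qed

lemma farey_level_eq: "x \<in> farey_level_set n \<Longrightarrow> farey_level x = n"
  unfolding farey_level_def using farey_level_unique by blast

lemma farey_parents_exist:
  assumes "quotient_of x = (P, Q)" "0 \<le> P" "P \<le> Q" "Q \<ge> 2"
  obtains l u where "farey_parents x l u"
proof -
  have cop: "coprime P Q" using quotient_of_props[OF assms(1)] by simp
  then obtain s t where st: "P * s + Q * t = 1" using bezout_int[of P Q] by (auto simp: mult.commute)
  \<comment> \<open>A Bezout coefficient is an inverse of \<open>P\<close> modulo \<open>Q\<close>;
    reduced to \<open>[0, Q)\<close> it is the denominator of the left parent, and \<open>p1\<close>
    is what \<open>P * q1 = p1 * Q + 1\<close> then forces.\<close>
  define q1 where "q1 = s mod Q"
  define p1 where "p1 = - t - P * (s div Q)"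
  have u: "P * q1 = p1 * Q + 1"
  proof -
    have q1: "s - Q * (s div Q) = q1" by (simp add: q1_def minus_mult_div_eq_mod)
    have "P * (s - Q * (s div Q)) = (- t - P * (s div Q)) * Q + 1" using st by (simp add: algebra_simps)
    then show ?thesis unfolding q1 p1_def .
  qed
  have q1: "0 \<le> q1" "q1 < Q" using assms by (auto simp: q1_def)
  have P: "0 < P"
  proof (rule ccontr)
    assume "\<not> ?thesis"
    then have "P = 0" using assms by simp
    then show False using cop assms by simp
  qed
  have q10: "q1 \<noteq> 0"
  proof
    assume "q1 = 0"
    then have "Q * (- p1) = 1" using u by (simp add: mult.commute)
    then have "Q dvd 1" by (metis dvd_triv_left)
    then show False using assms by simp
  qed
  have PQ: "P < Q"
  proof (rule ccontr)
    assume "\<not> ?thesis"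
    then have "P = Q" using assms by simp
    then show False using cop assms by simp
  qed
  define p2 q2 where "p2 = P - p1" and "q2 = Q - q1"
  have u2: "p2 * q1 = p1 * q2 + 1" using u by (simp add: p2_def q2_def algebra_simps)
  have p1: "0 \<le> p1"
  proof -
    have "P * q1 > 0" using P q1 q10 by simp
    then have "p1 * Q \<ge> 0" using u by linarith
    then show ?thesis using assms by (simp add: zero_le_mult_iff)
  qed
  have p1q1: "p1 \<le> q1"
  proof -
    have "p1 * Q < Q * q1" using u mult_right_mono[of P Q q1] PQ q1 by linarith
    then show ?thesis using assms by (simp add: mult.commute)
  qed
  have "p1 * Q < P * Q"
  proof -
    have "p1 * Q < P * q1" using u by simp
    also have "\<dots> \<le> P * Q" using P q1 by simp
    finally show ?thesis .
  qed
  then have p2: "0 \<le> p2" using assms by (simp add: p2_def)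
  have p2q2: "p2 \<le> q2"
  proof -
    have e: "(Q - P) * q1 + 1 = (q1 - p1) * Q" using u by (simp add: algebra_simps)
    have "(Q - P) * q1 + 1 \<le> (Q - P) * Q"
    proof -
      have "(Q - P) * q1 < (Q - P) * Q" using PQ q1 by simp
      then show ?thesis by linarith
    qed
    then have "(q1 - p1) * Q \<le> (Q - P) * Q" using e by simp
    then have "q1 - p1 \<le> Q - P" using assms by simp
    then show ?thesis by (simp add: p2_def q2_def)
  qed
  have "p1 * (- Q) = (- P) * q1 + 1" using u by simp
  then have "coprime p1 q1" by (rule coprime_of_unimodular)
  moreover have "coprime p2 q2" using coprime_of_unimodular[OF u2] .
  ultimately have "farey_parents x (Fract p1 q1) (Fract p2 q2)"
    using q1 q10 p1 p1q1 p2 p2q2 u2 quotient_of_props[OF assms(1)]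
    by (intro farey_parentsI[of _ p1 q1 _ p2 q2]) (auto simp: quotient_of_FractI q2_def p2_def)
  then show ?thesis by (rule that)
qed

text \<open>Descent on the denominator. The parent of \<open>x\<close> with the larger denominator
  is its predecessor: subtracting the other parent from it, numerators and denominators separately,
  gives its own missing parent. Equal denominators occur only for \<open>0/1\<close> and
  \<open>1/1\<close>.\<close>

lemma farey_level_exists: "x \<in> {0..1} \<Longrightarrow> \<exists>n. x \<in> farey_level_set n"
proof (induction "nat (snd (quotient_of x))" arbitrary: x rule: less_induct)
  case less
  obtain P Q where x: "quotient_of x = (P, Q)" by fastforce
  have PQ: "0 \<le> P" "P \<le> Q" "0 < Q" using less.prems unit_interval_quotient[OF x] quotient_of_props[OF x] by auto
  show ?case
  proof (cases "Q = 1")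
    case True
    then have "x = 0 \<or> x = 1" using quotient_of_props(3)[OF x] PQ by (cases "P = 0") auto
    then show ?thesis by (intro exI[of _ 0]) auto
  next
    case False
    then have "Q \<ge> 2" using PQ by simp
    then obtain l u where lu: "farey_parents x l u" using farey_parents_exist[OF x PQ(1,2)] by blast
    obtain p1 q1 p2 q2 where a: "quotient_of l = (p1, q1)" "quotient_of u = (p2, q2)"
      "quotient_of x = (p1 + p2, q1 + q2)" "p2 * q1 = p1 * q2 + 1"
      "0 \<le> p1" "p1 \<le> q1" "0 \<le> p2" "p2 \<le> q2" "0 < q1" "0 < q2"
      by (rule farey_parentsE[OF lu])
    have xs: "x = farey_sum l u" using lu by (simp add: farey_parents_def)
    have dl: "nat (snd (quotient_of l)) < nat (snd (quotient_of x))" and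
      du: "nat (snd (quotient_of u)) < nat (snd (quotient_of x))" using a by auto
    have l01: "l \<in> {0..1}" and u01: "u \<in> {0..1}" using lu by (auto simp: farey_parents_def)
    have "\<exists>y. (y = l \<or> y = u) \<and> x \<in> first_children y"
    proof (cases q1 q2 rule: linorder_cases)
      case equal
      then have "q1 * (p2 - p1) = 1" using a by (simp add: algebra_simps)
      then have "q1 = 1" "p2 - p1 = 1" using a by (auto simp: zmult_eq_1_iff)
      then have "q1 = 1" "q2 = 1" "p1 = 0" "p2 = 1" using a equal by auto
      then have "l = 0" "u = 1" using quotient_of_props(3)[OF a(1)] quotient_of_props(3)[OF a(2)] by auto
      then have "x \<in> first_children l"
        unfolding first_children_def right_parent_def using xs by blast
      then show ?thesis by blast
    next
      case less
      have p12: "p1 \<le> p2"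
      proof (rule ccontr)
        assume "\<not> ?thesis"
        then have "p2 * q1 \<le> p1 * q1" using a by (intro mult_right_mono) auto
        also have "\<dots> \<le> p1 * q2" using a less by (intro mult_left_mono) auto
        finally show False using a by simp
      qed
      have d: "p2 - p1 \<le> q2 - q1"
      proof (rule ccontr)
        assume n: "\<not> ?thesis"
        have e: "(q1 - p1) * q2 = (q2 - p2) * q1 + 1" using a by (simp add: algebra_simps)
        have "q2 - p2 \<le> q1 - p1 - 1" using n by simp
        then have "(q2 - p2) * q1 \<le> (q1 - p1 - 1) * q1" using a by (intro mult_right_mono) auto
        moreover have "(q1 - p1) * (q1 + 1) \<le> (q1 - p1) * q2" using a less by (intro mult_left_mono) auto
        ultimately have "(q1 - p1) * (q1 + 1) \<le> (q1 - p1 - 1) * q1 + 1" using e by linarith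
        then have "q1 - p1 + q1 \<le> 1" by (simp add: algebra_simps)
        then have "q1 = 1" "p1 = q1" using a by auto
        then show False using e a by auto
      qed
      have u: "(p2 - p1) * q1 = p1 * (q2 - q1) + 1" using a by (simp add: algebra_simps)
      have qs: "quotient_of (Fract (p2 - p1) (q2 - q1)) = (p2 - p1, q2 - q1)"
        using coprime_of_unimodular[OF u] less by (simp add: quotient_of_FractI)
      have "farey_parents u l (Fract (p2 - p1) (q2 - q1))"
        using farey_parentsI[OF a(1) qs u a(5,6) _ d] p12 quotient_of_props(4)[OF a(2)] by simp
      then have "x \<in> first_children u"
        unfolding first_children_def left_parent_def using xs farey_sum_commute[of l u] by blast
      then show ?thesis by blast
    next
      case greater
      have p21: "p2 \<le> p1"
      proof (rule ccontr)
        assume "\<not> ?thesis"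
        then have "(p1 + 1) * q1 \<le> p2 * q1" using a by (intro mult_right_mono) auto
        moreover have "p1 * (q2 + 1) \<le> p1 * q1" using a greater by (intro mult_left_mono) auto
        ultimately have "p1 + q1 \<le> 1" using a by (simp add: algebra_simps)
        then show False using a greater by simp
      qed
      have d: "p1 - p2 \<le> q1 - q2"
      proof (rule ccontr)
        assume n: "\<not> ?thesis"
        have e: "(q1 - p1) * q2 = (q2 - p2) * q1 + 1" using a by (simp add: algebra_simps)
        have "(q1 - p1) * q2 \<le> (q2 - p2) * q2" using n a by (intro mult_right_mono) auto
        also have "\<dots> \<le> (q2 - p2) * q1" using a greater by (intro mult_left_mono) auto
        finally show False using e by simp
      qed
      have u: "p2 * (q1 - q2) = (p1 - p2) * q2 + 1" using a by (simp add: algebra_simps)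
      have qs: "quotient_of (Fract (p1 - p2) (q1 - q2)) = (p1 - p2, q1 - q2)"
      proof -
        have "(p1 - p2) * (- q2) = (- p2) * (q1 - q2) + 1" using u by (simp add: algebra_simps)
        then have "coprime (p1 - p2) (q1 - q2)" by (rule coprime_of_unimodular)
        then show ?thesis using greater by (simp add: quotient_of_FractI)
      qed
      have "farey_parents l (Fract (p1 - p2) (q1 - q2)) u"
        using farey_parentsI[OF qs a(2) u _ d a(7,8)] p21 quotient_of_props(4)[OF a(1)] by simp
      then have "x \<in> first_children l"
        unfolding first_children_def right_parent_def using xs by blast
      then show ?thesis by blast
    qed
    then obtain y where y: "y = l \<or> y = u" "x \<in> first_children y" by blast
    then obtain n where "y \<in> farey_level_set n" using less.hyps[OF dl l01] less.hyps[OF du u01] by blast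
    then have "x \<in> farey_level_set (Suc n)" using y by auto
    then show ?thesis by blast
  qed
qed

text \<open>If \<open>x\<close> were the child, its level would be one more than that of
  \<open>y\<close>.\<close>

lemma farey_edge_child:
  assumes e: "farey_edge x y" and le: "farey_level x \<le> farey_level y"
  shows "y \<in> first_children x"
proof (rule ccontr)
  assume "\<not> ?thesis"
  then have "x \<in> first_children y" using e by (auto simp: farey_edge_def)
  moreover obtain n where n: "y \<in> farey_level_set n" using e farey_level_exists by (auto simp: farey_edge_def)
  ultimately have "x \<in> farey_level_set (Suc n)" by auto
  then show False using le farey_level_eq[OF n] farey_level_eq[of x "Suc n"] by simp
qed

section \<open>Reduced heights along paths in the tree\<close>

context family_N
begin

definition bounded_lock_at :: "rat \<Rightarrow> bool" where
  "bounded_lock_at x \<longleftrightarrow> (\<exists>p q. q > 0 \<and> p \<le> q \<and> quotient_of x = (int p, int q) \<and> bounded_lock q p)"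

lemma of_rat_quotient: "quotient_of x = (int p, int q) \<Longrightarrow> (of_rat x :: real) = real p / real q"
  using quotient_of_props(3)[of x "int p" "int q"] by (simp add: of_rat_divide)

lemma bounded_lock_child:
  assumes bounded_lock_at: "bounded_lock_at x" and z: "z \<in> first_children x"
  shows "bounded_lock_at z \<and> reduced_height F (of_rat z) < reduced_height F (of_rat x)"
proof -
  obtain p q where pq: "q > 0" "p \<le> q" "quotient_of x = (int p, int q)" "bounded_lock q p"
    using bounded_lock_at by (auto simp: bounded_lock_at_def)
  have "\<exists>p' q'. q' > 0 \<and> p' \<le> q' \<and> quotient_of z = (int p', int q') \<and>
      (\<forall>b>bc. L q p b = U q p b \<longrightarrow> U q' p' b < L q' p' b)"
    using z unfolding first_children_def
  proof (elim UnE CollectE exE conjE)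
    fix r assume zr: "z = farey_sum x r" and "left_parent x r"
    from this(2) obtain p0 q0 p1 q1 where a: "quotient_of x = (int p0, int q0)" "quotient_of r = (int p1, int q1)"
      "p0 * q1 = p1 * q0 + 1" "p1 \<le> p0" "q1 \<le> q0" "q1 < q0 \<longrightarrow> p1 \<le> q1 \<and> p0 - p1 \<le> q0 - q1" "q0 > 0" "p0 \<le> q0"
      "p1 \<le> q1" "q1 > 0"
      by (rule left_parentE)
    have e: "p0 = p" "q0 = q" using a(1) pq(3) by auto
    note a' = a[unfolded e]
    have uni: "(int p + int p1) * int q1 = int p1 * (int q + int q1) + 1"
    proof -
      have "int (p * q1) = int (p1 * q + 1)" using a'(3) by simp
      then show ?thesis by (simp add: algebra_simps)
    qed
    have "quotient_of (Fract (int p + int p1) (int q + int q1)) = (int p + int p1, int q + int q1)"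
      using pq by (intro quotient_of_FractI coprime_of_unimodular[OF uni]) auto
    then have "quotient_of z = (int (p + p1), int (q + q1))"
      using a' by (simp add: zr farey_sum_def)
    moreover have "U (q + q1) (p + p1) b < L (q + q1) (p + p1) b" if "bc < b" "L q p b = U q p b" for b
      using a'(6) by (intro left_child[OF pq(1) a'(3-5) _ that]) simp
    moreover have "q + q1 > 0" "p + p1 \<le> q + q1" using pq(1,2) a'(9) by simp_all
    ultimately show ?thesis by blast
  next
    fix s assume zs: "z = farey_sum x s" and "right_parent x s"
    from this(2) obtain p0 q0 p2 q2 where a: "quotient_of x = (int p0, int q0)" "quotient_of s = (int p2, int q2)"
      "p2 * q0 = p0 * q2 + 1" "p0 \<le> q0" "p2 \<le> q2" "q2 \<le> q0" "q2 - p2 \<le> q0 - p0" "q2 < q0 \<longrightarrow> p2 \<le> p0" "q0 > 0" "q2 > 0"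
      by (rule right_parentE)
    have e: "p0 = p" "q0 = q" using a(1) pq(3) by auto
    note a' = a[unfolded e]
    \<comment> \<open>The signs bring the relation with a right neighbour into the form
      \<open>a * d = c * b + 1\<close> from which coprimality is read off.\<close>
    have uni: "(int p + int p2) * (- int q2) = (- int p2) * (int q + int q2) + 1"
    proof -
      have "int (p2 * q) = int (p * q2 + 1)" using a'(3) by simp
      then show ?thesis by (simp add: algebra_simps)
    qed
    have "quotient_of (Fract (int p + int p2) (int q + int q2)) = (int p + int p2, int q + int q2)"
      using pq by (intro quotient_of_FractI coprime_of_unimodular[OF uni]) auto
    then have "quotient_of z = (int (p + p2), int (q + q2))"
      using a' by (simp add: zs farey_sum_def)
    moreover have "U (q + q2) (p + p2) b < L (q + q2) (p + p2) b" if "bc < b" "L q p b = U q p b" for b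
      using a'(8) by (intro right_child[OF pq(1) a'(3-7) _ that]) simp
    moreover have "q + q2 > 0" "p + p2 \<le> q + q2" using pq(1,2) a'(5) by simp_all
    ultimately show ?thesis by blast
  qed
  then obtain p' q' where z': "q' > 0" "p' \<le> q'" "quotient_of z = (int p', int q')"
    "\<And>b. bc < b \<Longrightarrow> L q p b = U q p b \<Longrightarrow> U q' p' b < L q' p' b" by blast
  show ?thesis
    unfolding of_rat_quotient[OF z'(3)] of_rat_quotient[OF pq(3)] bounded_lock_at_def
    using height_less[OF pq(1,2,4) z'(1,2,4)] z'(1-3) by blast
qed

lemma bounded_lock_root: "bounded_lock_at 0" "bounded_lock_at 1"
proof -
  obtain b0 where "bc < b0" "U 1 0 b0 < L 1 0 b0" by (rule root_zero_unlocked_somewhere)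
  then have "bounded_lock 1 0" unfolding bounded_lock_def by blast
  then show "bounded_lock_at 0" unfolding bounded_lock_at_def by (intro exI[of _ 0] exI[of _ 1]) simp
  obtain b1 where "bc < b1" "U 1 1 b1 < L 1 1 b1" by (rule root_unlocked_somewhere)
  then have "bounded_lock 1 1" unfolding bounded_lock_def by blast
  then show "bounded_lock_at 1" unfolding bounded_lock_at_def by (intro exI[of _ 1] exI[of _ 1]) simp
qed

lemma bounded_lock_level: "x \<in> farey_level_set n \<Longrightarrow> bounded_lock_at x"
  by (induction n arbitrary: x) (use bounded_lock_root bounded_lock_child in auto)

text \<open>Each edge of the path leads to a first child. The alternative of equal ends accounts for
  a single vertex; in the theorem the strict inequality of levels rules it out.\<close>

lemma height_path:
  "vs \<noteq> [] \<Longrightarrow> successively farey_edge vs \<Longrightarrow> sorted (map farey_level vs) \<Longrightarrow>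
    last vs = hd vs \<or> reduced_height F (of_rat (last vs)) < reduced_height F (of_rat (hd vs))"
proof (induction vs)
  case (Cons x vs)
  show ?case
  proof (cases vs)
    case (Cons y ys)
    have e: "farey_edge x y" and le: "farey_level x \<le> farey_level y"
      using Cons.prems \<open>vs = y # ys\<close> by auto
    obtain n where "x \<in> farey_level_set n" using e farey_level_exists by (auto simp: farey_edge_def)
    then have "reduced_height F (of_rat y) < reduced_height F (of_rat x)"
      using bounded_lock_child[OF bounded_lock_level farey_edge_child[OF e le]] by blast
    moreover have "last vs = hd vs \<or> reduced_height F (of_rat (last vs)) < reduced_height F (of_rat (hd vs))"
      using Cons.IH Cons.prems \<open>vs = y # ys\<close> by auto
    ultimately show ?thesis using \<open>vs = y # ys\<close> by auto
  qed simp
qed simp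

end

theorem corollary1:
  fixes F :: "real \<Rightarrow> real \<Rightarrow> real \<Rightarrow> real" and r r' :: rat
  assumes "class_N F"
    and "farey_higher r r'"
  shows "reduced_height F (of_rat r) > reduced_height F (of_rat r')"
proof -
  interpret family_N F by unfold_locales (rule assms)
  obtain vs where vs: "vs \<noteq> []" "hd vs = r" "last vs = r'" "successively farey_edge vs"
    "sorted (map farey_level vs)" and lt: "farey_level r < farey_level r'"
    using assms(2) by (auto simp: farey_higher_def)
  have "r' \<noteq> r" using lt by auto
  then show ?thesis using height_path[OF vs(1,4,5)] vs(2,3) by auto
qed

end
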